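(* Assume that, as $p\to\infty$, the matrices $A_p$ satisfy $$\mathrm{tr}(A_p^2)=o(p),\qquad \sup_{\mathbf u\in[-1,1]^p}\sum_{i=1}^p\Big|\sum_{j=1}^pA_p(i,j)u_j\Big|=O(p).$$ Then the following hold. (i) As $p\to\infty$, $\log Z_p-R_p=o(p)$, where $R_p=\sup_{\mathbf u\in[-1,1]^p}M_p(\mathbf u)$. (ii) Let $b_i:=\mathbb E_\mu(\beta_i\mid\beta_k,\,k\neq i)$ and $\mathbf b:=(b_1,\dots,b_p)$, a random vector under $\boldsymbol\beta\sim\mu=\mu_{\mathbf y,\mathbf X}$. Then $M_p(\mathbf b)-R_p=o(p)$ in $\mu$-probability, i.e. for every $\varepsilon>0$, $\mu\big(M_p(\mathbf b)<R_p-p\varepsilon\big)\to0$. (iii) Suppose there exists (for each $p$) $\hat{\mathbf u}=\hat{\mathbf u}_p\in[-1,1]^p$ such that for every $\eta>0$ $$\limsup_{p\to\infty}\frac1p\Big[\sup_{\mathbf u\in[-1,1]^p:\ \|\mathbf u-\hat{\mathbf u}\|_2^2\ge p\eta}M_p(\mathbf u)-R_p\Big]<0.$$ Assume further that the empirical measures $\frac1p\sum_{i=1}^p\delta_{D_p(i,i)}$ are uniformly integrable. Then for any $\varepsilon>0$ and any continuous function $\zeta:[-1,1]\times[0,1]\to\mathbb R$, $$\mu_{\mathbf y,\mathbf X}\Big(\Big|\frac1p\sum_{i=1}^p\zeta\Big(\beta_i,\frac ip\Big)-\frac1p\sum_{i=1}^p\int_{[-1,1]}\zeta\Big(z,\frac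 ip\Big)\,\pi_{(h(\hat u_i,d_i),d_i)}(dz)\Big|>\varepsilon\Big)\to0 .$$
   Context: Fix $\sigma^2>0$ and a probability measure $\pi$ on $[-1,1]$ whose support contains both $-1$ and $1$. For $\gamma=(\gamma_1,\gamma_2)\in\mathbb R^2$ let $c(\gamma)=\log\int_{[-1,1]}e^{\gamma_1z-\gamma_2z^2/2}\,d\pi(z)$ and let $\pi_\gamma$ be the probability measure with $\frac{d\pi_\gamma}{d\pi}(z)=\exp(\gamma_1z-\frac{\gamma_2}2z^2-c(\gamma))$. Write $\dot c=\partial c/\partial\gamma_1$; for fixed $\gamma_2$, $\dot c(\cdot,\gamma_2)$ is a strictly increasing bijection $\mathbb R\to(-1,1)$, and for $t\in(-1,1)$, $h(t,\gamma_2)$ is the unique real with $\dot c(h(t,\gamma_2),\gamma_2)=t$. Convention: $h(\pm1,\gamma_2)=\pm\infty$ and $\pi_{(\pm\infty,\gamma_2)}=\pi_{\pm\infty}$ is the point mass at $\pm1$. Define $G:[-1,1]\times\mathbb R\to[0,\infty]$ by $G(u,d)=u\,h(u,d)-c(h(u,d),d)+c(0,d)$ for $u\in(-1,1)$ and $G(\pm1,d)=\mathrm{D_{KL}}(\pi_{\pm\infty}\|\pi_{(0,d)})$. Asymptotics: $p\to\infty$, $n=n(p)\to\infty$. The data $\mathbf y\in\mathbb R^n$ and $\mathbf X\in\mathbb R^{n\times p}$ are deterministic. $A_p$ and $D_p$ are the off-diagonal and diagonal parts of $\mathbf X^{\mathrm T}\mathbf X$ (so $A_p(i,i)=0$, $D_p(i,i)=(\mathbf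 X^{\mathrm T}\mathbf X)_{ii}$, $A_p(i,j)=(\mathbf X^{\mathrm T}\mathbf X)_{ij}$ for $i\ne j$), $d_i=D_p(i,i)/\sigma^2$, $\mathbf z=\mathbf X^{\mathrm T}\mathbf y$. The posterior $\mu=\mu_{\mathbf y,\mathbf X}$ is the probability measure on $[-1,1]^p$ with $\frac{d\mu}{d\pi^{\otimes p}}(\boldsymbol\beta)\propto\exp(-\frac1{2\sigma^2}\|\mathbf y-\mathbf X\boldsymbol\beta\|_2^2)$; equivalently $\mu(d\boldsymbol\beta)=Z_p^{-1}\exp(-\frac1{2\sigma^2}[\boldsymbol\beta^{\mathrm T}A_p\boldsymbol\beta-2\mathbf z^{\mathrm T}\boldsymbol\beta])\prod_i\pi_{(0,d_i)}(d\beta_i)$, where $$Z_p=\int_{[-1,1]^p}\exp\Big(-\frac1{2\sigma^2}[\boldsymbol\beta^{\mathrm T}A_p\boldsymbol\beta-2\mathbf z^{\mathrm T}\boldsymbol\beta]\Big)\prod_{i=1}^p\pi_{(0,d_i)}(d\beta_i).$$ For $\mathbf u\in[-1,1]^p$, $M_p(\mathbf u)=-\frac1{2\sigma^2}[\mathbf u^{\mathrm T}A_p\mathbf u-2\mathbf z^{\mathrm T}\mathbf u]-\sum_{i=1}^pG(u_i,d_i)\in[-\infty,\infty)$. Uniform integrability of $\frac1p\sum_i\delta_{D_p(i,i)}$ means $\lim_{K\to\infty}\limsup_{p\to\infty}\frac1p\sum_iD_p(i,i)\mathbf 1\{D_p(i,i)>K\}=0$. *)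

theory Defs
  imports "HOL-Probability.Probability" "HOL-Library.Landau_Symbols"
begin

text \<open>
  The dimensions vary with the sequence index, so vectors are functions on \<open>{1..p}\<close> and matrices are
  functions of two indices; only the values at indices in range are ever used. Measures on the
  interval \<open>{-1..1}\<close> live on the Borel sigma-algebra restricted to it.
\<close>

definition cube :: "nat \<Rightarrow> (nat \<Rightarrow> real) set" where
  "cube p = {1..p} \<rightarrow>\<^sub>E {-1..1}"

definition support :: "'a::topological_space measure \<Rightarrow> 'a set" where
  "support M = {x \<in> space M. \<forall>U. open U \<longrightarrow> x \<in> U \<longrightarrow> emeasure M (U \<inter> space M) > 0}"

subsection \<open>Exponential tilts of the prior\<close>

definition cgf :: "real measure \<Rightarrow> real \<Rightarrow> real \<Rightarrow> real" where
  "cgf \<pi> g1 g2 = ln (\<integral>z. exp (g1 * z - g2 * z\<^sup>2 / 2) \<partial>\<pi>)"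

definition cgf_dot :: "real measure \<Rightarrow> real \<Rightarrow> real \<Rightarrow> real" where
  "cgf_dot \<pi> g1 g2 = deriv (\<lambda>x. cgf \<pi> x g2) g1"

text \<open>For an infinite first parameter the tilt is the point mass at the corresponding endpoint.\<close>

definition tilt :: "real measure \<Rightarrow> ereal \<Rightarrow> real \<Rightarrow> real measure" where
  "tilt \<pi> g1 g2 = (case g1 of
      ereal x \<Rightarrow> density \<pi> (\<lambda>z. ennreal (exp (x * z - g2 / 2 * z\<^sup>2 - cgf \<pi> x g2)))
    | PInfty \<Rightarrow> return \<pi> 1
    | MInfty \<Rightarrow> return \<pi> (-1))"

definition hfun :: "real measure \<Rightarrow> real \<Rightarrow> real \<Rightarrow> real" where
  "hfun \<pi> t g2 = (THE x. cgf_dot \<pi> x g2 = t)"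

definition hbar :: "real measure \<Rightarrow> real \<Rightarrow> real \<Rightarrow> ereal" where
  "hbar \<pi> t g2 = (if t = 1 then \<infinity> else if t = -1 then -\<infinity> else ereal (hfun \<pi> t g2))"

text \<open>
  The divergence of \<open>P\<close> from \<open>Q\<close>. The library function \<^const>\<open>KL_divergence\<close> is real-valued and takes
  the reference measure \<open>Q\<close> first. For probability measures the negative part of the log-density is
  always \<open>P\<close>-integrable, so non-integrability means that the divergence is infinite.
\<close>

definition D_KL :: "'a measure \<Rightarrow> 'a measure \<Rightarrow> ereal" where
  "D_KL P Q =
     (if absolutely_continuous Q P \<and> integrable P (entropy_density (exp 1) Q P)
      then ereal (KL_divergence (exp 1) Q P) else \<infinity>)"

text \<open>
  Outside \<open>{-1..1}\<close> the value is set to \<open>\<infinity>\<close>. This is used only on the null set where a version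
  of a conditional expectation leaves the interval.
\<close>

definition Gfun :: "real measure \<Rightarrow> real \<Rightarrow> real \<Rightarrow> ereal" where
  "Gfun \<pi> u d =
     (if -1 < u \<and> u < 1 then
        ereal (u * hfun \<pi> u d - cgf \<pi> (hfun \<pi> u d) d + cgf \<pi> 0 d)
      else if u = 1 \<or> u = -1 then D_KL (tilt \<pi> (hbar \<pi> u d) d) (tilt \<pi> 0 d)
      else \<infinity>)"

subsection \<open>The linear model\<close>

text \<open>\<open>X\<close> is an \<open>n\<close> by \<open>p\<close> matrix and \<open>gram n X\<close> is the product of its transpose with \<open>X\<close>.\<close>

definition gram :: "nat \<Rightarrow> (nat \<Rightarrow> nat \<Rightarrow> real) \<Rightarrow> nat \<Rightarrow> nat \<Rightarrow> real" where
  "gram n X i j = (\<Sum>k=1..n. X k i * X k j)"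

definition offdiag :: "nat \<Rightarrow> (nat \<Rightarrow> nat \<Rightarrow> real) \<Rightarrow> nat \<Rightarrow> nat \<Rightarrow> real" where
  "offdiag n X i j = (if i = j then 0 else gram n X i j)"

definition diag :: "nat \<Rightarrow> (nat \<Rightarrow> nat \<Rightarrow> real) \<Rightarrow> nat \<Rightarrow> nat \<Rightarrow> real" where
  "diag n X i j = (if i = j then gram n X i j else 0)"

definition mat_prod ::
  "nat \<Rightarrow> (nat \<Rightarrow> nat \<Rightarrow> real) \<Rightarrow> (nat \<Rightarrow> nat \<Rightarrow> real) \<Rightarrow> nat \<Rightarrow> nat \<Rightarrow> real" where
  "mat_prod p A B i j = (\<Sum>k=1..p. A i k * B k j)"

definition mat_trace :: "nat \<Rightarrow> (nat \<Rightarrow> nat \<Rightarrow> real) \<Rightarrow> real" where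
  "mat_trace p A = (\<Sum>i=1..p. A i i)"

definition zvec :: "nat \<Rightarrow> (nat \<Rightarrow> nat \<Rightarrow> real) \<Rightarrow> (nat \<Rightarrow> real) \<Rightarrow> nat \<Rightarrow> real" where
  "zvec n X y i = (\<Sum>k=1..n. X k i * y k)"

definition dvec :: "real \<Rightarrow> nat \<Rightarrow> (nat \<Rightarrow> nat \<Rightarrow> real) \<Rightarrow> nat \<Rightarrow> real" where
  "dvec \<sigma> n X i = diag n X i i / \<sigma>\<^sup>2"

definition hamiltonian ::
  "real \<Rightarrow> nat \<Rightarrow> nat \<Rightarrow> (nat \<Rightarrow> nat \<Rightarrow> real) \<Rightarrow> (nat \<Rightarrow> real) \<Rightarrow> (nat \<Rightarrow> real) \<Rightarrow> real" where
  "hamiltonian \<sigma> n p X y u =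
     - (1 / (2 * \<sigma>\<^sup>2)) *
       ((\<Sum>i=1..p. \<Sum>j=1..p. u i * offdiag n X i j * u j) - 2 * (\<Sum>i=1..p. zvec n X y i * u i))"

definition likelihood ::
  "real \<Rightarrow> nat \<Rightarrow> nat \<Rightarrow> (nat \<Rightarrow> nat \<Rightarrow> real) \<Rightarrow> (nat \<Rightarrow> real) \<Rightarrow> (nat \<Rightarrow> real) \<Rightarrow> real" where
  "likelihood \<sigma> n p X y \<beta> =
     exp (- (1 / (2 * \<sigma>\<^sup>2)) * (\<Sum>k=1..n. (y k - (\<Sum>j=1..p. X k j * \<beta> j))\<^sup>2))"

definition posterior ::
  "real \<Rightarrow> real measure \<Rightarrow> nat \<Rightarrow> nat \<Rightarrow> (nat \<Rightarrow> nat \<Rightarrow> real) \<Rightarrow> (nat \<Rightarrow> real) \<Rightarrow> (nat \<Rightarrow> real) measure"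
  where
  "posterior \<sigma> \<pi> n p X y =
     density (Pi\<^sub>M {1..p} (\<lambda>_. \<pi>))
       (\<lambda>\<beta>. ennreal (likelihood \<sigma> n p X y \<beta> /
               (\<integral>\<beta>'. likelihood \<sigma> n p X y \<beta>' \<partial>Pi\<^sub>M {1..p} (\<lambda>_. \<pi>))))"

definition norm_const ::
  "real \<Rightarrow> real measure \<Rightarrow> nat \<Rightarrow> nat \<Rightarrow> (nat \<Rightarrow> nat \<Rightarrow> real) \<Rightarrow> (nat \<Rightarrow> real) \<Rightarrow> real" where
  "norm_const \<sigma> \<pi> n p X y =
     (\<integral>\<beta>. exp (hamiltonian \<sigma> n p X y \<beta>) \<partial>Pi\<^sub>M {1..p} (\<lambda>i. tilt \<pi> 0 (dvec \<sigma> n X i)))"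

definition Mfun ::
  "real \<Rightarrow> real measure \<Rightarrow> nat \<Rightarrow> nat \<Rightarrow> (nat \<Rightarrow> nat \<Rightarrow> real) \<Rightarrow> (nat \<Rightarrow> real) \<Rightarrow> (nat \<Rightarrow> real) \<Rightarrow> ereal"
  where
  "Mfun \<sigma> \<pi> n p X y u =
     ereal (hamiltonian \<sigma> n p X y u) - (\<Sum>i=1..p. Gfun \<pi> (u i) (dvec \<sigma> n X i))"

definition Rfun ::
  "real \<Rightarrow> real measure \<Rightarrow> nat \<Rightarrow> nat \<Rightarrow> (nat \<Rightarrow> nat \<Rightarrow> real) \<Rightarrow> (nat \<Rightarrow> real) \<Rightarrow> ereal" where
  "Rfun \<sigma> \<pi> n p X y = (SUP u\<in>cube p. Mfun \<sigma> \<pi> n p X y u)"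

text \<open>The sigma-algebra generated by all coordinates except the \<open>i\<close>-th.\<close>

definition others_algebra :: "real measure \<Rightarrow> nat \<Rightarrow> nat \<Rightarrow> (nat \<Rightarrow> real) measure" where
  "others_algebra \<pi> p i =
     vimage_algebra (space (Pi\<^sub>M {1..p} (\<lambda>_. \<pi>))) (\<lambda>\<beta>. restrict \<beta> ({1..p} - {i}))
       (Pi\<^sub>M ({1..p} - {i}) (\<lambda>_. \<pi>))"

definition cond_mean ::
  "real \<Rightarrow> real measure \<Rightarrow> nat \<Rightarrow> nat \<Rightarrow> (nat \<Rightarrow> nat \<Rightarrow> real) \<Rightarrow> (nat \<Rightarrow> real) \<Rightarrow>
   (nat \<Rightarrow> real) \<Rightarrow> (nat \<Rightarrow> real)" where
  "cond_mean \<sigma> \<pi> n p X y \<beta> =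
     (\<lambda>i. real_cond_exp (posterior \<sigma> \<pi> n p X y) (others_algebra \<pi> p i) (\<lambda>\<beta>'. \<beta>' i) \<beta>)"

end

theory Submission
  imports Defs
begin

text \<open>
  Absorb the diagonal of the Gram matrix into the prior of each coordinate. The posterior becomes
  a Gibbs measure over the product of the measures \<open>\<rho> i\<close>, the tilts of the prior with
  parameters \<open>(0, d i)\<close>, with energy
  \<open>H(u) = 1/2 u\<^sup>T a u + c\<^sup>T u\<close>, where \<open>a = - A / \<sigma>\<^sup>2\<close> has zero diagonal and \<open>c = z / \<sigma>\<^sup>2\<close>.
  Given the other coordinates, the \<open>i\<close>-th one has law \<open>\<rho> i\<close> tilted by the field
  \<open>\<theta> i = c i + (a \<beta>) i\<close>. With \<open>\<Lambda> i\<close> the logarithmic moment generating function of \<open>\<rho> i\<close>, the conditional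
  mean is \<open>b i = \<Lambda>' i (\<theta> i)\<close> and \<open>G(b i, d i) = b i \<theta> i - \<Lambda> i (\<theta> i)\<close>, so the mean-field functional at
  \<open>b\<close> is explicit. The theorem rests on the chain
  \<open>E M(b) \<le> R \<le> log Z \<le> E M(b) + o(p)\<close>.

  The first inequality is the definition of \<open>R\<close>. The second is the Gibbs variational principle with
  product laws (\<open>variational_lower_bound\<close>). For the third, put \<open>w = \<beta> - b\<close> and
  \<open>F = \<Sum>i. \<beta> i \<theta> i - \<Lambda> i (\<theta> i)\<close>; then \<open>H = M(b) + F - 1/2 w\<^sup>T a w\<close>
  (\<open>energy_decomposition\<close>), and Jensen's inequality gives
  \<open>log Z \<le> log \<integral> exp F d\<rho> + E M(b) - 1/2 E w\<^sup>T a w\<close>. Two estimates finish it, both in terms of the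
  squared Frobenius norm of \<open>a\<close>, which is \<open>o(p)\<close> by the trace condition.

  \<^item> \<open>E w\<^sup>T a w\<close> is bounded by a multiple of the squared norm: \<open>w i\<close> is centred given the other
    coordinates, while \<open>w j\<close> moves by at most a multiple of \<open>\<bar>a i j\<bar>\<close> when \<open>\<beta> i\<close> is reset
    (\<open>residual_correlation\<close>).

  \<^item> \<open>log \<integral> exp F d\<rho> = o(p)\<close>: for a fixed vector \<open>\<theta>\<close> the integral would equal 1, and the random
    field is replaced by a mixture over sign vectors \<open>s\<close> of the fixed fields \<open>c + \<tau> a s\<close>
    (\<open>integral_exp_excess\<close>). The mixture costs \<open>p / \<tau>\<close> with \<open>\<tau>\<close> arbitrarily large.

  The chain gives the first claim. Since \<open>R - M(b)\<close> is nonnegative with expectation \<open>o(p)\<close>, Markov's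
  inequality gives the second. For the third, near-optimality of \<open>b\<close> and the separation
  hypothesis force \<open>b\<close> to be close to \<open>uhat\<close> in mean square. The correlation estimate, applied
  to \<open>\<zeta>\<close> instead of the identity, shows that the sum of \<open>\<zeta> (\<beta> i, i / p)\<close> is within \<open>o(p)\<close> of the sum of the conditional
  expectations. These are integrals of \<open>\<zeta>\<close> under the tilts with means \<open>b i\<close>, and such integrals are almost
  Lipschitz in the mean uniformly in \<open>d\<close>, endpoints included, because exponential tilts are
  stochastically ordered (\<open>texp_almost_mono\<close>, \<open>tilted_integral_stable\<close>).
\<close>

section \<open>Elementary inequalities\<close>

lemma exp_mult_le:
  fixes z \<theta> :: real
  assumes "\<bar>z\<bar> \<le> 1" shows "exp (\<theta> * z) \<le> exp \<bar>\<theta>\<bar>"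
  using assms mult_left_le[of "\<bar>z\<bar>" "\<bar>\<theta>\<bar>"] abs_ge_self[of "\<theta> * z"]
  by (simp add: abs_mult)

lemma abs_mult_ident_le:
  fixes z B :: real
  assumes "\<bar>z\<bar> \<le> 1" "\<bar>w\<bar> \<le> B" shows "\<bar>z * w\<bar> \<le> B"
  using mult_mono[OF assms] assms by (simp add: abs_mult)

lemma lipschitz_from_deriv:
  fixes g :: "real \<Rightarrow> real"
  assumes "\<And>t. (g has_real_derivative g' t) (at t)" "\<And>t. \<bar>g' t\<bar> \<le> K"
  shows "\<bar>g x - g y\<bar> \<le> K * \<bar>x - y\<bar>"
  using field_differentiable_bound[of UNIV g g' K x y] assms by simp

lemma abs_mult_le_abs:
  fixes x y :: real
  shows "\<bar>y\<bar> \<le> 1 \<Longrightarrow> \<bar>x * y\<bar> \<le> \<bar>x\<bar>"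
  by (simp add: abs_mult mult_left_le)

lemma sum_abs_le_sum:
  fixes f g :: "'j \<Rightarrow> real"
  assumes "\<And>i. i \<in> J \<Longrightarrow> \<bar>f i\<bar> \<le> g i" shows "\<bar>\<Sum>i\<in>J. f i\<bar> \<le> (\<Sum>i\<in>J. g i)"
  by (rule order_trans[OF sum_abs sum_mono]) (use assms in auto)

text \<open>
  Serves in place of the Cauchy--Schwarz inequality: it bounds absolute values by squares
  linearly, so that it passes under sums and averages, at the price of the free parameter \<open>\<delta>\<close>.
\<close>

lemma young_abs:
  fixes x \<delta> :: real
  assumes \<delta>: "\<delta> > 0"
  shows "2 * \<bar>x\<bar> \<le> \<delta> + x\<^sup>2 / \<delta>"
proof -
  have "0 \<le> (\<bar>x\<bar> - \<delta>)\<^sup>2 / \<delta>" using \<delta> by simp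
  also have "\<dots> = \<delta> + x\<^sup>2 / \<delta> - 2 * \<bar>x\<bar>" using \<delta> by (simp add: field_simps power2_eq_square)
  finally show ?thesis by simp
qed

section \<open>Exponential tilts on an interval\<close>

locale interval_measure = prob_space M for M :: "real measure" +
  assumes sets_interval: "sets M = sets (restrict_space borel {-1..1})"
begin

lemma space_interval: "space M = {-1..1}"
  using sets_eq_imp_space_eq[OF sets_interval] by (simp add: space_restrict_space)

lemma measurable_interval: "f \<in> borel_measurable borel \<Longrightarrow> f \<in> borel_measurable M"
  unfolding measurable_cong_sets[OF sets_interval refl] by (rule measurable_restrict_space1)

lemma measurable_interval_cont:
  fixes f :: "real \<Rightarrow> real"
  shows "continuous_on {-1..1} f \<Longrightarrow> f \<in> borel_measurable M"
  unfolding measurable_cong_sets[OF sets_interval refl]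
  by (rule borel_measurable_continuous_on_restrict)

lemma measurable_ident_interval [measurable]: "(\<lambda>z. z) \<in> borel_measurable M"
  by (rule measurable_interval) simp

lemma integrable_interval:
  fixes f :: "real \<Rightarrow> real"
  assumes "f \<in> borel_measurable M" "\<And>z. \<bar>z\<bar> \<le> 1 \<Longrightarrow> \<bar>f z\<bar> \<le> B"
  shows "integrable M f"
  using assms by (intro integrable_const_bound[of f B] AE_I2) (auto simp: space_interval)

lemma integral_mono_interval:
  fixes f g :: "real \<Rightarrow> real"
  assumes "integrable M f" "integrable M g" "\<And>z. \<bar>z\<bar> \<le> 1 \<Longrightarrow> f z \<le> g z"
  shows "(\<integral>z. f z \<partial>M) \<le> (\<integral>z. g z \<partial>M)"
  using assms by (intro integral_mono) (auto simp: space_interval)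

text \<open>
  \<open>texp \<theta> f\<close> is the integral of \<open>f\<close> under the measure with density proportional to
  \<open>exp (\<theta> z)\<close>. Keeping it a quotient of integrals against the fixed measure makes it an explicit
  function of \<open>\<theta>\<close>, which is then differentiated under the integral sign.
\<close>

definition mgf :: "real \<Rightarrow> real" where
  "mgf \<theta> = (\<integral>z. exp (\<theta> * z) \<partial>M)"

definition logmgf :: "real \<Rightarrow> real" where
  "logmgf \<theta> = ln (mgf \<theta>)"

definition texp :: "real \<Rightarrow> (real \<Rightarrow> real) \<Rightarrow> real" where
  "texp \<theta> f = (\<integral>z. f z * exp (\<theta> * z) \<partial>M) / mgf \<theta>"

lemma integrable_weighted:
  fixes f :: "real \<Rightarrow> real"
  assumes [measurable]: "f \<in> borel_measurable M" and "\<And>z. \<bar>z\<bar> \<le> 1 \<Longrightarrow> \<bar>f z\<bar> \<le> B"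
  shows "integrable M (\<lambda>z. f z * exp (\<theta> * z))"
proof (rule integrable_interval)
  fix z :: real assume z: "\<bar>z\<bar> \<le> 1"
  show "\<bar>f z * exp (\<theta> * z)\<bar> \<le> B * exp \<bar>\<theta>\<bar>"
    using mult_mono[OF assms(2)[OF z] exp_mult_le[OF z, of \<theta>]] assms(2)[OF z]
    by (simp add: abs_mult order_trans[OF abs_ge_zero])
qed measurable

lemma integrable_exp: "integrable M (\<lambda>z. exp (\<theta> * z))"
  using integrable_weighted[of "\<lambda>_. 1" 1] by simp

lemma mgf_pos: "mgf \<theta> > 0"
proof -
  have "(\<integral>z. exp (- \<bar>\<theta>\<bar>) \<partial>M) \<le> mgf \<theta>" unfolding mgf_def
  proof (rule integral_mono_interval[OF _ integrable_exp])
    fix z :: real assume z: "\<bar>z\<bar> \<le> 1"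
    show "exp (- \<bar>\<theta>\<bar>) \<le> exp (\<theta> * z)"
      using exp_mult_le[of "-z" \<theta>] z by simp
  qed simp
  then show ?thesis by (simp add: prob_space) (meson exp_gt_zero less_le_trans)
qed

lemma exp_logmgf: "exp (logmgf \<theta>) = mgf \<theta>"
  by (simp add: logmgf_def mgf_pos)

lemma texp_mono:
  assumes "f \<in> borel_measurable M" "\<And>z. \<bar>z\<bar> \<le> 1 \<Longrightarrow> \<bar>f z\<bar> \<le> B"
    "g \<in> borel_measurable M" "\<And>z. \<bar>z\<bar> \<le> 1 \<Longrightarrow> \<bar>g z\<bar> \<le> C"
    and "\<And>z. \<bar>z\<bar> \<le> 1 \<Longrightarrow> f z \<le> g z"
  shows "texp \<theta> f \<le> texp \<theta> g"
  unfolding texp_def using mgf_pos[of \<theta>]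
  by (intro divide_right_mono integral_mono_interval integrable_weighted[OF assms(1,2)]
      integrable_weighted[OF assms(3,4)]) (auto intro: mult_right_mono assms(5))

lemma texp_const [simp]: "texp \<theta> (\<lambda>_. k) = k"
  using mgf_pos[of \<theta>] by (simp add: texp_def mgf_def)

lemma texp_add:
  assumes "f \<in> borel_measurable M" "\<And>z. \<bar>z\<bar> \<le> 1 \<Longrightarrow> \<bar>f z\<bar> \<le> B"
    "g \<in> borel_measurable M" "\<And>z. \<bar>z\<bar> \<le> 1 \<Longrightarrow> \<bar>g z\<bar> \<le> C"
  shows "texp \<theta> (\<lambda>z. f z + g z) = texp \<theta> f + texp \<theta> g"
  unfolding texp_def
  using integrable_weighted[OF assms(1,2), of \<theta>] integrable_weighted[OF assms(3,4), of \<theta>]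
  by (simp add: ring_distribs add_divide_distrib)

lemma texp_cmult: "texp \<theta> (\<lambda>z. k * f z) = k * texp \<theta> f"
  unfolding texp_def by (simp add: mult.assoc)

lemma texp_abs_le:
  assumes "f \<in> borel_measurable M" "\<And>z. \<bar>z\<bar> \<le> 1 \<Longrightarrow> \<bar>f z\<bar> \<le> B"
  shows "\<bar>texp \<theta> f\<bar> \<le> B"
proof -
  have B: "f z \<le> B \<and> - B \<le> f z \<and> \<bar>B\<bar> \<le> B" if "\<bar>z\<bar> \<le> 1" for z
    using assms(2)[OF that] by auto
  have "texp \<theta> f \<le> texp \<theta> (\<lambda>_. B)"
    by (rule texp_mono[OF assms, where C = B]) (use B in auto)
  moreover have "texp \<theta> (\<lambda>_. - B) \<le> texp \<theta> f"
    by (rule texp_mono[OF _ _ assms, where B = B]) (use B in auto)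
  ultimately show ?thesis by (simp add: abs_le_iff)
qed

text \<open>
  The error of the difference quotient is controlled by \<open>exp x = 1 + x + O(x\<^sup>2)\<close>, uniformly in
  \<open>z\<close> because the interval is bounded.
\<close>

lemma DERIV_weighted:
  fixes f :: "real \<Rightarrow> real"
  assumes [measurable]: "f \<in> borel_measurable M" and B: "\<And>z. \<bar>z\<bar> \<le> 1 \<Longrightarrow> \<bar>f z\<bar> \<le> B"
  shows "((\<lambda>\<theta>. \<integral>z. f z * exp (\<theta> * z) \<partial>M) has_real_derivative
           (\<integral>z. z * f z * exp (\<theta> * z) \<partial>M)) (at \<theta>)"
proof -
  let ?N = "\<lambda>\<theta>. \<integral>z. f z * exp (\<theta> * z) \<partial>M" and ?D = "\<integral>z. z * f z * exp (\<theta> * z) \<partial>M"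
  let ?K = "B * exp \<bar>\<theta>\<bar> * exp 1"
  have zf: "\<bar>z * f z\<bar> \<le> B" if "\<bar>z\<bar> \<le> 1" for z
    using abs_mult_ident_le[OF that B[OF that]] .
  have int: "integrable M (\<lambda>z. f z * exp (t * z))" for t by (rule integrable_weighted[OF assms])
  have intz: "integrable M (\<lambda>z. z * f z * exp (t * z))" for t
    by (rule integrable_weighted[OF _ zf]) auto
  have est: "\<bar>(?N (\<theta> + h) - ?N \<theta>) / h - ?D\<bar> \<le> ?K * \<bar>h\<bar>" if h: "h \<noteq> 0" "\<bar>h\<bar> \<le> 1" for h
  proof -
    let ?g = "\<lambda>z. f z * exp ((\<theta> + h) * z) - f z * exp (\<theta> * z) - h * (z * f z * exp (\<theta> * z))"
    have ig: "integrable M ?g" by (intro Bochner_Integration.integrable_diff integrable_mult_right int intz)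
    have eq: "?N (\<theta> + h) - ?N \<theta> - h * ?D = (\<integral>z. ?g z \<partial>M)"
      using int intz by simp
    have pt: "\<bar>?g z\<bar> \<le> ?K * h\<^sup>2" if z: "\<bar>z\<bar> \<le> 1" for z
    proof -
      have hz: "\<bar>h * z\<bar> \<le> \<bar>h\<bar>" "\<bar>h * z\<bar> \<le> 1" using z h mult_mono[of "\<bar>h\<bar>" 1 "\<bar>z\<bar>" 1] mult_left_le[of "\<bar>z\<bar>" "\<bar>h\<bar>"]
        by (auto simp: abs_mult)
      have "\<bar>exp (h * z) - (\<Sum>i\<le>1. (h * z) ^ i / fact i)\<bar> \<le> exp \<bar>h * z\<bar> * \<bar>h * z\<bar> ^ 2"
        using Taylor_exp_field[of "h * z" 1] by (simp add: power2_eq_square)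
      also have "\<dots> \<le> exp 1 * \<bar>h\<bar>\<^sup>2"
        using hz by (intro mult_mono power_mono) auto
      finally have "\<bar>exp (h * z) - 1 - h * z\<bar> \<le> exp 1 * h\<^sup>2" by (simp add: algebra_simps)
      moreover have "?g z = f z * exp (\<theta> * z) * (exp (h * z) - 1 - h * z)"
        by (simp add: algebra_simps exp_add)
      moreover have "\<bar>f z * exp (\<theta> * z)\<bar> \<le> B * exp \<bar>\<theta>\<bar>"
        using mult_mono[OF B[OF z] exp_mult_le[OF z, of \<theta>]] B[OF z]
        by (simp add: abs_mult order_trans[OF abs_ge_zero])
      ultimately show ?thesis
        using mult_mono[of "\<bar>f z * exp (\<theta> * z)\<bar>" "B * exp \<bar>\<theta>\<bar>" "\<bar>exp (h * z) - 1 - h * z\<bar>" "exp 1 * h\<^sup>2"]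
          B[OF z] by (simp add: abs_mult mult.assoc)
    qed
    have "\<bar>\<integral>z. ?g z \<partial>M\<bar> \<le> (\<integral>z. \<bar>?g z\<bar> \<partial>M)" by (rule integral_abs_bound)
    also have "\<dots> \<le> (\<integral>z. ?K * h\<^sup>2 \<partial>M)"
      by (rule integral_mono_interval[OF integrable_abs[OF ig]]) (use pt in auto)
    finally have "\<bar>?N (\<theta> + h) - ?N \<theta> - h * ?D\<bar> \<le> ?K * h\<^sup>2"
      unfolding eq by (simp add: prob_space)
    then have "\<bar>?N (\<theta> + h) - ?N \<theta> - h * ?D\<bar> / \<bar>h\<bar> \<le> ?K * h\<^sup>2 / \<bar>h\<bar>"
      by (rule divide_right_mono) simp
    moreover have "\<bar>?N (\<theta> + h) - ?N \<theta> - h * ?D\<bar> / \<bar>h\<bar> = \<bar>(?N (\<theta> + h) - ?N \<theta>) / h - ?D\<bar>"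
      using h by (simp add: abs_divide[symmetric] diff_divide_distrib del: abs_divide)
    moreover have "?K * h\<^sup>2 / \<bar>h\<bar> = ?K * \<bar>h\<bar>"
    proof -
      have "h\<^sup>2 / \<bar>h\<bar> = \<bar>h\<bar>" using h by (simp add: power2_eq_square field_simps flip: abs_mult)
      then show ?thesis by (simp only: times_divide_eq_right[symmetric])
    qed
    ultimately show ?thesis by simp
  qed
  have "((\<lambda>h. (?N (\<theta> + h) - ?N \<theta>) / h - ?D) \<longlongrightarrow> 0) (at 0)"
  proof (rule Lim_null_comparison)
    show "\<forall>\<^sub>F h in at 0. norm ((?N (\<theta> + h) - ?N \<theta>) / h - ?D) \<le> ?K * \<bar>h\<bar>"
      unfolding eventually_at by (rule exI[of _ 1]) (use est in auto)
    show "((\<lambda>h. ?K * \<bar>h\<bar>) \<longlongrightarrow> 0) (at 0)" by (auto intro!: tendsto_eq_intros)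
  qed
  then show ?thesis unfolding DERIV_def by (simp add: LIM_zero_iff)
qed

lemma DERIV_mgf: "(mgf has_real_derivative mgf \<theta> * texp \<theta> (\<lambda>z. z)) (at \<theta>)"
  using DERIV_weighted[of "\<lambda>_. 1" 1 \<theta>] mgf_pos[of \<theta>]
  by (simp add: texp_def mgf_def[abs_def])

lemma DERIV_logmgf: "(logmgf has_real_derivative texp \<theta> (\<lambda>z. z)) (at \<theta>)"
  unfolding logmgf_def[abs_def]
  by (rule DERIV_cong[OF DERIV_chain2[OF DERIV_ln DERIV_mgf]]) (use mgf_pos[of \<theta>] in auto)

lemma DERIV_texp:
  assumes [measurable]: "f \<in> borel_measurable M" and B: "\<And>z. \<bar>z\<bar> \<le> 1 \<Longrightarrow> \<bar>f z\<bar> \<le> B"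
  shows "((\<lambda>\<theta>. texp \<theta> f) has_real_derivative
      texp \<theta> (\<lambda>z. z * f z) - texp \<theta> (\<lambda>z. z) * texp \<theta> f) (at \<theta>)"
proof -
  have "((\<lambda>\<theta>. (\<integral>z. f z * exp (\<theta> * z) \<partial>M) / mgf \<theta>) has_real_derivative
      ((\<integral>z. z * f z * exp (\<theta> * z) \<partial>M) * mgf \<theta> - (\<integral>z. f z * exp (\<theta> * z) \<partial>M) *
        (mgf \<theta> * texp \<theta> (\<lambda>z. z))) / (mgf \<theta> * mgf \<theta>)) (at \<theta>)"
    by (rule DERIV_divide[OF DERIV_weighted[OF assms] DERIV_mgf]) (use mgf_pos[of \<theta>] in auto)
  then show ?thesis
    unfolding texp_def[of _ f] texp_def[of _ "\<lambda>z. z * f z"]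
    by (rule DERIV_cong) (use mgf_pos[of \<theta>] in \<open>simp add: field_simps\<close>)
qed

lemma mean_abs_le: "\<bar>texp \<theta> (\<lambda>z. z)\<bar> \<le> 1"
  by (rule texp_abs_le) auto

text \<open>
  The derivative of a tilted expectation is the covariance of \<open>f\<close> with the identity, hence at
  most \<open>2 B\<close>. The constant does not depend on the measure, so one bound serves all coordinates.
\<close>

lemma texp_lipschitz:
  assumes [measurable]: "f \<in> borel_measurable M" and B: "\<And>z. \<bar>z\<bar> \<le> 1 \<Longrightarrow> \<bar>f z\<bar> \<le> B"
  shows "\<bar>texp \<theta> f - texp \<theta>' f\<bar> \<le> 2 * B * \<bar>\<theta> - \<theta>'\<bar>"
proof (rule lipschitz_from_deriv[OF DERIV_texp[OF assms]])
  fix t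
  have "\<bar>texp t (\<lambda>z. z * f z)\<bar> \<le> B"
    by (rule texp_abs_le) (use abs_mult_ident_le B in auto)
  moreover have "\<bar>texp t (\<lambda>z. z) * texp t f\<bar> \<le> B"
    by (rule abs_mult_ident_le[OF mean_abs_le texp_abs_le[OF assms]])
  ultimately show "\<bar>texp t (\<lambda>z. z * f z) - texp t (\<lambda>z. z) * texp t f\<bar> \<le> 2 * B" by linarith
qed

lemma logmgf_lipschitz: "\<bar>logmgf \<theta> - logmgf \<theta>'\<bar> \<le> \<bar>\<theta> - \<theta>'\<bar>"
  using lipschitz_from_deriv[OF DERIV_logmgf mean_abs_le] by simp

text \<open>
  Tilting by a larger parameter moves mass to the right, so it increases expectations of
  increasing functions. To allow functions that are increasing only up to \<open>e\<close>, the classical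
  association argument is run with the single pivot \<open>x\<close> at which the likelihood ratio
  \<open>exp (\<delta> z)\<close> crosses its mean \<open>r\<close>: on both sides of the pivot the product of the two increments
  is nonnegative up to an error proportional to \<open>e\<close>.
\<close>

lemma texp_almost_mono:
  fixes f :: "real \<Rightarrow> real"
  assumes [measurable]: "f \<in> borel_measurable M" and B: "\<And>z. \<bar>z\<bar> \<le> 1 \<Longrightarrow> \<bar>f z\<bar> \<le> B"
    and am: "\<And>x y. -1 \<le> x \<Longrightarrow> x \<le> y \<Longrightarrow> y \<le> 1 \<Longrightarrow> f x \<le> f y + e"
    and "\<theta> \<le> \<theta>'"
  shows "texp \<theta> f \<le> texp \<theta>' f + 2 * e"
proof (cases "\<theta> = \<theta>'")
  case True
  then show ?thesis using am[of 0 0] by simp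
next
  case False
  define \<delta> where "\<delta> = \<theta>' - \<theta>"
  have \<delta>: "\<delta> > 0" using False assms(4) by (simp add: \<delta>_def)
  define r where "r = mgf \<theta>' / mgf \<theta>"
  define x where "x = ln r / \<delta>"
  have pos: "mgf \<theta> > 0" "mgf \<theta>' > 0" "r > 0" by (simp_all add: mgf_pos r_def)
  have ex: "exp (\<delta> * x) = r" using \<delta> pos by (simp add: x_def)
  have split: "exp (\<theta>' * z) = exp (\<theta> * z) * exp (\<delta> * z)" for z
    by (simp add: \<delta>_def exp_add[symmetric] algebra_simps)
  have "r = texp \<theta> (\<lambda>z. exp (\<delta> * z))"
    unfolding r_def texp_def mgf_def[of \<theta>'] split by (simp add: mult.commute)
  moreover have "texp \<theta> (\<lambda>z. exp (\<delta> * z)) \<le> texp \<theta> (\<lambda>z. exp \<delta>)"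
    by (rule texp_mono[where B = "exp \<delta>" and C = "exp \<delta>"])
      (use \<delta> exp_mult_le[of _ \<delta>] in auto)
  moreover have "texp \<theta> (\<lambda>z. exp (- \<delta>)) \<le> texp \<theta> (\<lambda>z. exp (\<delta> * z))"
    by (rule texp_mono[where B = "exp (-\<delta>)" and C = "exp \<delta>"])
      (use \<delta> exp_mult_le[of _ \<delta>] mult_left_mono[of "-1" _ \<delta>] in \<open>auto simp: abs_le_iff\<close>)
  ultimately have "exp (- \<delta>) \<le> exp (\<delta> * x)" "exp (\<delta> * x) \<le> exp \<delta>" by (simp_all add: ex)
  then have x: "-1 \<le> x" "x \<le> 1"
    using \<delta> mult_le_cancel_left_pos[OF \<delta>, of "-1" x] mult_le_cancel_left_pos[OF \<delta>, of x 1] by auto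
  have e: "e \<ge> 0" using am[of 0 0] by simp
  have pt: "(f z - f x) * (exp (\<theta>' * z) - r * exp (\<theta> * z)) \<ge> - e * (exp (\<theta>' * z) + r * exp (\<theta> * z))"
    if z: "\<bar>z\<bar> \<le> 1" for z
  proof -
    have "(f z - f x) * (exp (\<delta> * z) - r) \<ge> - e * (exp (\<delta> * z) + r)"
    proof (cases "x \<le> z")
      case True
      then have w: "exp (\<delta> * z) - r \<ge> 0" using \<delta> by (simp add: ex[symmetric])
      have "f z - f x \<ge> - e" using am[of x z] True x z by linarith
      then have "(f z - f x) * (exp (\<delta> * z) - r) \<ge> - e * (exp (\<delta> * z) - r)"
        using w by (rule mult_right_mono)
      moreover have "e * r \<ge> 0" using e pos by simp
      ultimately show ?thesis by (simp add: algebra_simps)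
    next
      case False
      then have w: "r - exp (\<delta> * z) \<ge> 0" using \<delta> by (simp add: ex[symmetric])
      have "f x - f z \<ge> - e" using am[of z x] False x z by linarith
      then have "(f x - f z) * (r - exp (\<delta> * z)) \<ge> - e * (r - exp (\<delta> * z))"
        using w by (rule mult_right_mono)
      moreover have "e * exp (\<delta> * z) \<ge> 0" using e by simp
      ultimately show ?thesis by (simp add: algebra_simps)
    qed
    then have "exp (\<theta> * z) * ((f z - f x) * (exp (\<delta> * z) - r)) \<ge> exp (\<theta> * z) * (- e * (exp (\<delta> * z) + r))"
      by (rule mult_left_mono) simp
    then show ?thesis by (simp add: split algebra_simps)
  qed
  let ?N = "\<lambda>t. \<integral>z. f z * exp (t * z) \<partial>M"
  have int: "integrable M (\<lambda>z. f z * exp (t * z))" for t by (rule integrable_weighted[OF assms(1,2)])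
  note [simp] = int integrable_exp
  have "(\<integral>z. - e * exp (\<theta>' * z) - e * r * exp (\<theta> * z) \<partial>M)
      \<le> (\<integral>z. f z * exp (\<theta>' * z) - r * (f z * exp (\<theta> * z)) - f x * exp (\<theta>' * z) + f x * r * exp (\<theta> * z) \<partial>M)"
  proof (rule integral_mono_interval)
    fix z :: real assume "\<bar>z\<bar> \<le> 1"
    from pt[OF this] show "- e * exp (\<theta>' * z) - e * r * exp (\<theta> * z) \<le>
       f z * exp (\<theta>' * z) - r * (f z * exp (\<theta> * z)) - f x * exp (\<theta>' * z) + f x * r * exp (\<theta> * z)"
      by (simp add: algebra_simps)
  qed simp_all
  then have "- e * mgf \<theta>' - e * r * mgf \<theta> \<le> ?N \<theta>' - r * ?N \<theta> - f x * mgf \<theta>' + f x * r * mgf \<theta>"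
    by (simp add: mgf_def)
  moreover have rm: "r * mgf \<theta> = mgf \<theta>'" using pos by (simp add: r_def)
  ultimately have "r * ?N \<theta> \<le> ?N \<theta>' + 2 * e * mgf \<theta>'" by (simp add: mult.assoc)
  then have "r * ?N \<theta> / mgf \<theta>' \<le> (?N \<theta>' + 2 * e * mgf \<theta>') / mgf \<theta>'"
    using pos by (intro divide_right_mono) auto
  then show ?thesis using pos by (simp add: texp_def r_def add_divide_distrib)
qed

end

text \<open>
  Charging every neighbourhood of both endpoints is what makes the means of the tilts fill the
  whole open interval.
\<close>

locale spread_interval_measure = interval_measure +
  assumes charges_ends: "\<And>s e. s \<in> {1, -1} \<Longrightarrow> e > 0 \<Longrightarrow> prob {z \<in> space M. s * z > 1 - e} > 0"
begin

lemma texp_pos: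
  assumes [measurable]: "g \<in> borel_measurable M" and B: "\<And>z. \<bar>z\<bar> \<le> 1 \<Longrightarrow> \<bar>g z\<bar> \<le> B"
    and nn: "\<And>z. \<bar>z\<bar> \<le> 1 \<Longrightarrow> g z \<ge> 0"
    and s: "s \<in> {1, -1}" and pos: "\<And>z. \<bar>z\<bar> \<le> 1 \<Longrightarrow> s * z > 0 \<Longrightarrow> g z > 0"
  shows "texp \<theta> g > 0"
proof -
  have "0 \<le> texp \<theta> g" using texp_mono[of "\<lambda>_. 0" 0 g B \<theta>] B nn by simp
  moreover have "texp \<theta> g \<noteq> 0"
  proof
    assume "texp \<theta> g = 0"
    then have "(\<integral>z. g z * exp (\<theta> * z) \<partial>M) = 0" using mgf_pos[of \<theta>] by (simp add: texp_def)
    then have "AE z in M. g z * exp (\<theta> * z) = 0"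
      by (subst (asm) integral_nonneg_eq_0_iff_AE[OF integrable_weighted[OF assms(1) B]])
        (auto intro!: AE_I2 mult_nonneg_nonneg nn simp: space_interval)
    note ae = this
    have "prob {z \<in> space M. s * z > 1 - 1} = 0"
    proof (rule prob_eq_0[THEN iffD2])
      show "AE z in M. z \<notin> {z \<in> space M. s * z > 1 - 1}"
        using ae AE_space
        by eventually_elim (use pos space_interval in force)
    qed measurable
    then show False using charges_ends[OF s, of 1] by simp
  qed
  ultimately show ?thesis by simp
qed

lemma mean_in_open: "-1 < texp \<theta> (\<lambda>z. z)" "texp \<theta> (\<lambda>z. z) < 1"
proof -
  have "0 < texp \<theta> (\<lambda>z. 1 + (-1) * z)"
    by (rule texp_pos[where s = "-1" and B = 2]) auto
  then show "texp \<theta> (\<lambda>z. z) < 1"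
    by (subst (asm) texp_add[where B = 1 and C = 1]) (auto simp: texp_cmult simp del: mult_minus1)
  have "0 < texp \<theta> (\<lambda>z. 1 + z)"
    by (rule texp_pos[where s = "1" and B = 2]) auto
  then show "-1 < texp \<theta> (\<lambda>z. z)"
    by (subst (asm) texp_add[where B = 1 and C = 1]) auto
qed

lemma mean_strict_mono: "strict_mono (\<lambda>\<theta>. texp \<theta> (\<lambda>z. z))"
proof (rule strict_monoI)
  fix x y :: real assume "x < y"
  then show "texp x (\<lambda>z. z) < texp y (\<lambda>z. z)"
  proof (rule DERIV_pos_imp_increasing)
    fix t
    let ?m = "texp t (\<lambda>z. z)"
    let ?s = "if ?m \<le> 0 then 1 else -1 :: real"
    have m: "\<bar>?m\<bar> \<le> 1" by (rule mean_abs_le)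
    have zz: "\<bar>z * z\<bar> \<le> 1" "\<bar>?m * z\<bar> \<le> 1" if "\<bar>z\<bar> \<le> 1" for z :: real
      using abs_mult_ident_le[OF that that] abs_mult_ident_le[OF m that] by auto
    have "0 < texp t (\<lambda>z. (z - ?m)\<^sup>2)"
    proof (rule texp_pos[where s = ?s and B = 4])
      fix z :: real assume z: "\<bar>z\<bar> \<le> 1"
      have "\<bar>z - ?m\<bar> \<le> 2" using z m by linarith
      then have "(z - ?m)\<^sup>2 \<le> 2\<^sup>2" by (subst abs_le_square_iff[symmetric]) simp
      then show "\<bar>(z - ?m)\<^sup>2\<bar> \<le> 4" by simp
    qed (auto split: if_splits)
    also have "texp t (\<lambda>z. (z - ?m)\<^sup>2) = texp t (\<lambda>z. z * z) - ?m * ?m"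
    proof -
      have i: "integrable M (\<lambda>z. z * z * exp (t * z))" "integrable M (\<lambda>z. z * exp (t * z))"
        using zz by (auto intro!: integrable_weighted[where B = 1])
      have "(\<integral>z. (z - ?m)\<^sup>2 * exp (t * z) \<partial>M) =
          (\<integral>z. z * z * exp (t * z) - 2 * ?m * (z * exp (t * z)) + ?m * ?m * exp (t * z) \<partial>M)"
        by (rule Bochner_Integration.integral_cong) (auto simp: power2_eq_square algebra_simps)
      also have "\<dots> = (\<integral>z. z * z * exp (t * z) \<partial>M)
          - 2 * ?m * (\<integral>z. z * exp (t * z) \<partial>M) + ?m * ?m * mgf t"
        using i integrable_exp[of t] by (simp add: mgf_def)
      finally show ?thesis using mgf_pos[of t] by (simp add: texp_def[of t "\<lambda>z. (z - ?m)\<^sup>2"]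
          texp_def[of t "\<lambda>z. z * z"] add_divide_distrib diff_divide_distrib) (simp add: texp_def)
    qed
    finally show "\<exists>D. ((\<lambda>\<theta>. texp \<theta> (\<lambda>z. z)) has_real_derivative D) (at t) \<and> 0 < D"
      using DERIV_texp[of "\<lambda>z. z" 1 t] by auto
  qed
qed

text \<open>
  A tilt by \<open>s T\<close> with \<open>T\<close> large weighs the charged neighbourhood of \<open>s\<close> at least by
  \<open>exp (T (1 - e))\<close> times its mass. This forces \<open>logmgf\<close> to grow with slope almost 1 on average, and the mean
  value theorem turns the average slope into a tilted mean. The sign \<open>s\<close> treats both ends at once.
\<close>

lemma mean_reaches:
  assumes s: "s \<in> {1, -1}" and "v < 1"
  shows "\<exists>\<theta>. s * texp \<theta> (\<lambda>z. z) \<ge> v"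
proof -
  define e where "e = (1 - v) / 2"
  have e: "e > 0" using assms by (simp add: e_def)
  let ?S = "{z \<in> space M. s * z > 1 - e}"
  define q where "q = prob ?S"
  have q: "0 < q" "q \<le> 1" using charges_ends[OF s e] by (auto simp: q_def)
  \<comment> \<open>Chosen so that \<open>ln q\<close> is at least \<open>- e T\<close>.\<close>
  define T where "T = 1 - ln q / e"
  have T: "T \<ge> 1" using q e by (simp add: T_def divide_nonpos_pos)
  have ss: "s * s = 1" "\<bar>s\<bar> = 1" using s by auto
  have "(\<integral>z. exp (T * (1 - e)) * indicator ?S z \<partial>M) \<le> mgf (s * T)" unfolding mgf_def
  proof (rule integral_mono_interval[OF _ integrable_exp])
    fix z :: real assume "\<bar>z\<bar> \<le> 1"
    have "T * (1 - e) \<le> s * T * z" if "s * z > 1 - e"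
      using mult_left_mono[of "1 - e" "s * z" T] that T by (simp add: ac_simps)
    then show "exp (T * (1 - e)) * indicator ?S z \<le> exp (s * T * z)"
      by (auto simp: indicator_def)
  qed (auto intro!: integrable_real_indicator simp: less_top[symmetric])
  then have "exp (T * (1 - e)) * q \<le> mgf (s * T)" by (simp add: q_def)
  then have "ln (exp (T * (1 - e)) * q) \<le> logmgf (s * T)"
    unfolding logmgf_def using q by (intro ln_mono) (auto simp: mgf_pos)
  then have low: "T * (1 - e) + ln q \<le> logmgf (s * T)" using q by (simp add: ln_mult)
  have "\<exists>x>0. x < T \<and> logmgf (s * T) - logmgf (s * 0) = (T - 0) * (s * texp (s * x) (\<lambda>z. z))"
  proof (rule MVT2[of 0 T])
    fix x
    show "((\<lambda>x. logmgf (s * x)) has_real_derivative s * texp (s * x) (\<lambda>z. z)) (at x)"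
      by (rule DERIV_cong[OF DERIV_chain2[OF DERIV_logmgf]]) (auto intro!: derivative_eq_intros)
  qed (use T in auto)
  then obtain x where x: "logmgf (s * T) = T * (s * texp (s * x) (\<lambda>z. z))"
    by (auto simp: logmgf_def mgf_def prob_space)
  have "v = 1 - 2 * e" by (simp add: e_def field_simps)
  have "T * v \<le> T * (1 - e) + ln q"
    unfolding \<open>v = 1 - 2 * e\<close> T_def using e by (simp add: field_simps)
  then have "T * v \<le> T * (s * texp (s * x) (\<lambda>z. z))" using low x by linarith
  then show ?thesis using T by (intro exI[of _ "s * x"]) simp
qed

lemma mean_surj:
  assumes "-1 < u" "u < 1"
  shows "\<exists>\<theta>. texp \<theta> (\<lambda>z. z) = u"
proof -
  obtain x y where xy: "texp x (\<lambda>z. z) \<ge> u" "texp y (\<lambda>z. z) \<le> u"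
    using mean_reaches[of 1 u] mean_reaches[of "-1" "-u"] assms by auto
  moreover have "y \<le> x"
    using xy strict_mono_less[OF mean_strict_mono, of x y] by linarith
  moreover have "\<forall>t. isCont (\<lambda>\<theta>. texp \<theta> (\<lambda>z. z)) t"
    using DERIV_isCont[OF DERIV_texp[of "\<lambda>z. z" 1]] by simp
  ultimately show ?thesis
    using IVT[of "\<lambda>\<theta>. texp \<theta> (\<lambda>z. z)" y u x] by blast
qed

end

section \<open>Gibbs measures with quadratic energy\<close>

text \<open>
  The Gibbs measure is absolutely continuous with respect to a product measure, with energy
  a quadratic polynomial whose matrix has zero diagonal. The field at \<open>i\<close> is the derivative of the energy
  in the \<open>i\<close>-th coordinate; it does not involve that coordinate, so the conditional law of the
  coordinate given all others is the site measure tilted by the field. \<open>site_mean\<close> is therefore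
  the vector of conditional means, and \<open>frobenius2\<close> is the squared Frobenius norm of the matrix.
\<close>

locale quadratic_gibbs =
  fixes I :: "'i set" and \<rho> :: "'i \<Rightarrow> real measure"
    and a :: "'i \<Rightarrow> 'i \<Rightarrow> real" and c :: "'i \<Rightarrow> real"
  assumes finite_I: "finite I" and site: "\<And>i. interval_measure (\<rho> i)"
    and sym: "\<And>i j. a i j = a j i" and diag0: "\<And>i. a i i = 0"
begin

abbreviation base :: "('i \<Rightarrow> real) measure" where "base \<equiv> Pi\<^sub>M I \<rho>"

abbreviation site_exp :: "'i \<Rightarrow> real \<Rightarrow> (real \<Rightarrow> real) \<Rightarrow> real" where
  "site_exp i \<equiv> interval_measure.texp (\<rho> i)"

abbreviation site_log :: "'i \<Rightarrow> real \<Rightarrow> real" where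
  "site_log i \<equiv> interval_measure.logmgf (\<rho> i)"

definition field :: "('i \<Rightarrow> real) \<Rightarrow> 'i \<Rightarrow> real" where
  "field \<beta> i = c i + (\<Sum>j\<in>I. a i j * \<beta> j)"

definition energy :: "('i \<Rightarrow> real) \<Rightarrow> real" where
  "energy \<beta> = 1 / 2 * (\<Sum>i\<in>I. \<Sum>j\<in>I. \<beta> i * a i j * \<beta> j) + (\<Sum>i\<in>I. c i * \<beta> i)"

definition partition :: real where
  "partition = (\<integral>\<beta>. exp (energy \<beta>) \<partial>base)"

definition gibbs :: "('i \<Rightarrow> real) measure" where
  "gibbs = density base (\<lambda>\<beta>. ennreal (exp (energy \<beta>) / partition))"

definition site_mean :: "('i \<Rightarrow> real) \<Rightarrow> 'i \<Rightarrow> real" where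
  "site_mean \<beta> i = site_exp i (field \<beta> i) (\<lambda>z. z)"

definition frobenius2 :: real where
  "frobenius2 = (\<Sum>i\<in>I. \<Sum>j\<in>I. (a i j)\<^sup>2)"

lemma product_sites: "product_sigma_finite \<rho>"
  unfolding product_sigma_finite_def
  using site interval_measure.axioms(1) prob_space_imp_sigma_finite by blast

lemma prob_base: "prob_space base"
  by (rule prob_space_PiM) (rule interval_measure.axioms(1)[OF site])

lemma space_base: "space base = I \<rightarrow>\<^sub>E {-1..1}"
  by (simp add: space_PiM interval_measure.space_interval[OF site])

lemma coord_le: "\<beta> \<in> space base \<Longrightarrow> i \<in> I \<Longrightarrow> \<bar>\<beta> i\<bar> \<le> 1"
  by (auto simp: space_base abs_le_iff dest: PiE_mem)

lemma update_in_space: "\<beta> \<in> space base \<Longrightarrow> i \<in> I \<Longrightarrow> x \<in> {-1..1} \<Longrightarrow> \<beta>(i := x) \<in> space base"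
  by (auto simp: space_base PiE_iff extensional_def)

lemma measurable_at_coord:
  assumes "i \<in> I" "f \<in> borel_measurable (\<rho> i)"
  shows "(\<lambda>\<beta>. f (\<beta> i)) \<in> borel_measurable base"
  by (rule measurable_compose[OF measurable_component_singleton[OF assms(1), of \<rho>] assms(2)])

lemma measurable_coord [measurable]: "i \<in> I \<Longrightarrow> (\<lambda>\<beta>. \<beta> i) \<in> borel_measurable base"
  using measurable_at_coord[of i "\<lambda>z. z"] interval_measure.measurable_ident_interval[OF site] by auto

lemma measurable_field [measurable]: "(\<lambda>\<beta>. field \<beta> i) \<in> borel_measurable base"
  unfolding field_def by measurable

lemma measurable_energy [measurable]: "energy \<in> borel_measurable base"
  unfolding energy_def[abs_def] by measurable

lemma measurable_site_exp:
  assumes "f \<in> borel_measurable (\<rho> i)" "\<And>z. \<bar>z\<bar> \<le> 1 \<Longrightarrow> \<bar>f z\<bar> \<le> B"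
  shows "(\<lambda>\<beta>. site_exp i (field \<beta> i) f) \<in> borel_measurable base"
proof -
  have "continuous_on UNIV (\<lambda>\<theta>. site_exp i \<theta> f)"
    by (rule continuous_at_imp_continuous_on)
      (use DERIV_isCont[OF interval_measure.DERIV_texp[OF site assms]] in blast)
  then show ?thesis by (rule borel_measurable_continuous_on) measurable
qed

lemma measurable_site_mean [measurable]: "(\<lambda>\<beta>. site_mean \<beta> i) \<in> borel_measurable base"
  unfolding site_mean_def
  by (rule measurable_site_exp[where B = 1])
    (auto intro: interval_measure.measurable_ident_interval[OF site])

lemma measurable_site_log [measurable]: "(\<lambda>\<beta>. site_log i (field \<beta> i)) \<in> borel_measurable base"
proof -
  have "continuous_on UNIV (site_log i)"
    by (rule continuous_at_imp_continuous_on)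
      (use DERIV_isCont[OF interval_measure.DERIV_logmgf[OF site]] in blast)
  then show ?thesis by (rule borel_measurable_continuous_on) measurable
qed

lemma site_mean_le: "\<bar>site_mean \<beta> i\<bar> \<le> 1"
  unfolding site_mean_def by (rule interval_measure.mean_abs_le[OF site])

definition energy_bound :: real where
  "energy_bound = (\<Sum>i\<in>I. \<Sum>j\<in>I. \<bar>a i j\<bar>) + (\<Sum>i\<in>I. \<bar>c i\<bar>)"

lemma energy_le:
  assumes "\<And>i. i \<in> I \<Longrightarrow> \<bar>\<beta> i\<bar> \<le> 1"
  shows "\<bar>energy \<beta>\<bar> \<le> energy_bound"
proof -
  have "\<bar>\<beta> i * a i j * \<beta> j\<bar> \<le> \<bar>a i j\<bar>" if "i \<in> I" "j \<in> I" for i j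
    using abs_mult_le_abs[OF assms[OF that(2)], of "a i j * \<beta> i"] abs_mult_le_abs[OF assms[OF that(1)], of "a i j"]
    by (simp add: ac_simps)
  then have "\<bar>\<Sum>i\<in>I. \<Sum>j\<in>I. \<beta> i * a i j * \<beta> j\<bar> \<le> (\<Sum>i\<in>I. \<Sum>j\<in>I. \<bar>a i j\<bar>)"
    by (intro sum_abs_le_sum) auto
  moreover have "\<bar>\<Sum>i\<in>I. c i * \<beta> i\<bar> \<le> (\<Sum>i\<in>I. \<bar>c i\<bar>)"
    by (intro sum_abs_le_sum abs_mult_le_abs assms)
  ultimately show ?thesis unfolding energy_def energy_bound_def by linarith
qed

lemma field_le:
  assumes "\<And>i. i \<in> I \<Longrightarrow> \<bar>\<beta> i\<bar> \<le> 1" and i: "i \<in> I"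
  shows "\<bar>field \<beta> i\<bar> \<le> energy_bound"
proof -
  have "\<bar>\<Sum>j\<in>I. a i j * \<beta> j\<bar> \<le> (\<Sum>j\<in>I. \<bar>a i j\<bar>)"
    by (intro sum_abs_le_sum abs_mult_le_abs assms(1))
  also have "\<dots> \<le> (\<Sum>i\<in>I. \<Sum>j\<in>I. \<bar>a i j\<bar>)"
    by (rule member_le_sum[OF i _ finite_I]) (simp add: sum_nonneg)
  finally have "\<bar>\<Sum>j\<in>I. a i j * \<beta> j\<bar> \<le> (\<Sum>i\<in>I. \<Sum>j\<in>I. \<bar>a i j\<bar>)" .
  moreover have "\<bar>c i\<bar> \<le> (\<Sum>i\<in>I. \<bar>c i\<bar>)"
    by (rule member_le_sum[OF i _ finite_I]) simp
  ultimately show ?thesis unfolding field_def energy_bound_def by linarith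
qed

lemma integrable_base:
  fixes g :: "('i \<Rightarrow> real) \<Rightarrow> real"
  assumes "g \<in> borel_measurable base" "\<And>\<beta>. \<beta> \<in> space base \<Longrightarrow> \<bar>g \<beta>\<bar> \<le> C"
  shows "integrable base g"
  using assms prob_base by (intro finite_measure.integrable_const_bound[where B = C] AE_I2)
    (auto simp: prob_space_def)

lemma energy_space_le: "\<beta> \<in> space base \<Longrightarrow> \<bar>energy \<beta>\<bar> \<le> energy_bound"
  by (rule energy_le) (rule coord_le)

lemma exp_energy_le: "\<beta> \<in> space base \<Longrightarrow> exp (energy \<beta>) \<le> exp energy_bound"
  using energy_space_le[of \<beta>] by simp

lemma integrable_exp_energy: "integrable base (\<lambda>\<beta>. exp (energy \<beta>))"
  by (rule integrable_base[where C = "exp energy_bound"]) (use exp_energy_le in auto)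

lemma partition_pos: "partition > 0"
proof -
  interpret prob_space base by (rule prob_base)
  have "exp (- energy_bound) = (\<integral>\<beta>. exp (- energy_bound) \<partial>base)" by (simp add: prob_space)
  also have "\<dots> \<le> partition" unfolding partition_def
  proof (intro integral_mono integrable_exp_energy)
    fix \<beta> assume "\<beta> \<in> space base"
    then show "exp (- energy_bound) \<le> exp (energy \<beta>)" using energy_le[of \<beta>] coord_le[of \<beta>] by fastforce
  qed simp
  finally show ?thesis by (meson exp_gt_zero less_le_trans)
qed

lemma sets_gibbs [simp, measurable_cong]: "sets gibbs = sets base"
  by (simp add: gibbs_def)

lemma space_gibbs [simp]: "space gibbs = space base"
  by (simp add: gibbs_def)

lemma prob_gibbs: "prob_space gibbs"
proof
  have "emeasure gibbs (space gibbs) = (\<integral>\<^sup>+\<beta>. ennreal (exp (energy \<beta>) / partition) \<partial>base)"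
    unfolding space_gibbs unfolding gibbs_def by (subst emeasure_density) (auto intro!: nn_integral_cong)
  also have "\<dots> = ennreal (\<integral>\<beta>. exp (energy \<beta>) / partition \<partial>base)"
    using integrable_exp_energy partition_pos by (intro nn_integral_eq_integral) (auto simp: less_imp_le)
  also have "\<dots> = 1" using partition_pos by (simp add: partition_def[symmetric])
  finally show "emeasure gibbs (space gibbs) = 1" .
qed

lemma gibbs_mass [simp]: "measure gibbs (space base) = 1"
  using prob_space.prob_space[OF prob_gibbs] by simp

lemma integral_gibbs:
  fixes g :: "('i \<Rightarrow> real) \<Rightarrow> real"
  assumes "g \<in> borel_measurable base"
  shows "(\<integral>\<beta>. g \<beta> \<partial>gibbs) = (\<integral>\<beta>. exp (energy \<beta>) * g \<beta> \<partial>base) / partition"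
  unfolding gibbs_def using assms partition_pos by (subst integral_density) (auto simp: less_imp_le)

lemma integrable_gibbs:
  fixes g :: "('i \<Rightarrow> real) \<Rightarrow> real"
  assumes "g \<in> borel_measurable base" "\<And>\<beta>. \<beta> \<in> space base \<Longrightarrow> \<bar>g \<beta>\<bar> \<le> C"
  shows "integrable gibbs g"
  using assms prob_gibbs by (intro finite_measure.integrable_const_bound[where B = C] AE_I2)
    (auto simp: prob_space_def)

lemma field_update: "i \<in> I \<Longrightarrow> field (\<beta>(i := x)) j = field \<beta> j + a j i * (x - \<beta> i)"
  unfolding field_def using finite_I
  by (simp add: sum.remove[of I i] algebra_simps)

lemma field_update_self: "i \<in> I \<Longrightarrow> field (\<beta>(i := x)) i = field \<beta> i"
  by (simp add: field_update diag0)

text \<open>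
  Each coordinate enters the energy affinely, because the diagonal vanishes.
\<close>

lemma energy_update:
  assumes i: "i \<in> I"
  shows "energy (\<beta>(i := x)) = energy (\<beta>(i := 0)) + x * field (\<beta>(i := 0)) i"
proof -
  let ?J = "I - {i}"
  have I: "I = insert i ?J" "i \<notin> ?J" "finite ?J" using i finite_I by auto
  have s: "(\<Sum>k\<in>I. f k) = f i + (\<Sum>k\<in>?J. f k)" for f :: "'i \<Rightarrow> real"
    using finite_I i by (simp add: sum.remove)
  have n: "k \<noteq> i" if "k \<in> ?J" for k using that by auto
  have q: "(\<Sum>k\<in>I. \<Sum>l\<in>I. (\<beta>(i := y)) k * a k l * (\<beta>(i := y)) l)
     = (\<Sum>k\<in>?J. \<Sum>l\<in>?J. \<beta> k * a k l * \<beta> l) + 2 * y * (\<Sum>l\<in>?J. a i l * \<beta> l)" for y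
  proof -
    have "(\<Sum>k\<in>I. \<Sum>l\<in>I. (\<beta>(i := y)) k * a k l * (\<beta>(i := y)) l)
       = (\<Sum>l\<in>?J. y * a i l * \<beta> l) + (\<Sum>k\<in>?J. \<beta> k * a k i * y + (\<Sum>l\<in>?J. \<beta> k * a k l * \<beta> l))"
      unfolding s by (intro arg_cong2[where f = "(+)"] sum.cong) (auto simp: diag0 intro!: sum.cong)
    also have "(\<Sum>k\<in>?J. \<beta> k * a k i * y + (\<Sum>l\<in>?J. \<beta> k * a k l * \<beta> l))
       = (\<Sum>k\<in>?J. y * a i k * \<beta> k) + (\<Sum>k\<in>?J. \<Sum>l\<in>?J. \<beta> k * a k l * \<beta> l)"
      unfolding sum.distrib by (intro arg_cong2[where f = "(+)"] sum.cong) (auto simp: sym[of _ i])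
    finally show ?thesis by (simp add: sum_distrib_left ac_simps sum.distrib[symmetric])
  qed
  have l: "(\<Sum>k\<in>I. c k * (\<beta>(i := y)) k) = c i * y + (\<Sum>k\<in>?J. c k * \<beta> k)" for y
    unfolding s by (intro arg_cong2[where f = "(+)"] sum.cong) auto
  have f: "field (\<beta>(i := 0)) i = c i + (\<Sum>l\<in>?J. a i l * \<beta> l)"
    unfolding field_def s by (auto intro!: sum.cong simp: diag0)
  show ?thesis unfolding energy_def q l f by (simp add: algebra_simps)
qed

text \<open>
  This expresses that \<open>site_exp i (field \<beta> i) f\<close> is the conditional expectation of \<open>f (\<beta> i)\<close> given
  the other coordinates, tested against functions \<open>F\<close> of those. By Fubini the \<open>i\<close>-th coordinate is
  integrated first, and the remaining one-dimensional integral vanishes by the definition of the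
  tilted expectation.
\<close>

lemma gibbs_resample:
  assumes i: "i \<in> I" and f[measurable]: "f \<in> borel_measurable (\<rho> i)" "\<And>z. \<bar>z\<bar> \<le> 1 \<Longrightarrow> \<bar>f z\<bar> \<le> B"
    and F[measurable]: "F \<in> borel_measurable base" and FC: "\<And>\<beta>. \<beta> \<in> space base \<Longrightarrow> \<bar>F \<beta>\<bar> \<le> C"
    and indep: "\<And>\<beta> x. \<beta> \<in> space base \<Longrightarrow> x \<in> {-1..1} \<Longrightarrow> F (\<beta>(i := x)) = F \<beta>"
  shows "(\<integral>\<beta>. (f (\<beta> i) - site_exp i (field \<beta> i) f) * F \<beta> \<partial>gibbs) = 0"
proof -
  interpret s: interval_measure "\<rho> i" by (rule site)
  interpret p: product_sigma_finite \<rho> by (rule product_sites)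
  let ?J = "I - {i}"
  have J: "insert i ?J = I" "i \<notin> ?J" "finite ?J" using i finite_I by auto
  let ?V = "\<lambda>\<beta>. f (\<beta> i) - site_exp i (field \<beta> i) f"
  let ?g = "\<lambda>\<beta>. exp (energy \<beta>) * (?V \<beta> * F \<beta>)"
  have [measurable]: "(\<lambda>\<beta>. f (\<beta> i)) \<in> borel_measurable base"
      "(\<lambda>\<beta>. site_exp i (field \<beta> i) f) \<in> borel_measurable base"
    by (rule measurable_at_coord[OF i f(1)], rule measurable_site_exp[OF f])
  have V: "\<bar>?V \<beta>\<bar> \<le> 2 * B" if "\<beta> \<in> space base" for \<beta>
    using f(2)[OF coord_le[OF that i]] s.texp_abs_le[OF f, of "field \<beta> i"] by linarith
  have "integrable base ?g"
  proof (rule integrable_base)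
    fix \<beta> assume b: "\<beta> \<in> space base"
    have "\<bar>exp (energy \<beta>) * (?V \<beta> * F \<beta>)\<bar> = exp (energy \<beta>) * (\<bar>?V \<beta>\<bar> * \<bar>F \<beta>\<bar>)" by (simp add: abs_mult)
    also have "\<dots> \<le> exp energy_bound * (2 * B * C)"
      using exp_energy_le[OF b] V[OF b] FC[OF b] by (intro mult_mono) auto
    finally show "\<bar>?g \<beta>\<bar> \<le> exp energy_bound * (2 * B * C)" .
  qed measurable
  then have "(\<integral>\<beta>. ?g \<beta> \<partial>base) = (\<integral>x. (\<integral>y. ?g (x(i := y)) \<partial>\<rho> i) \<partial>Pi\<^sub>M ?J \<rho>)"
    using p.product_integral_insert[of ?J i ?g] J by simp
  also have "\<dots> = (\<integral>x. 0 \<partial>Pi\<^sub>M ?J \<rho>)"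
  proof (rule Bochner_Integration.integral_cong[OF refl])
    fix x assume x: "x \<in> space (Pi\<^sub>M ?J \<rho>)"
    define x0 where "x0 = x(i := 0)"
    have x0: "x0 \<in> space base"
      using x i by (auto simp: x0_def space_PiM interval_measure.space_interval[OF site] PiE_iff extensional_def)
    define t where "t = field x0 i"
    have upd: "x(i := y) = x0(i := y)" "x0(i := 0) = x0" for y by (auto simp: x0_def)
    have "(\<integral>y. ?g (x(i := y)) \<partial>\<rho> i) =
       (\<integral>y. exp (energy x0) * F x0 * (f y * exp (t * y) - site_exp i t f * exp (t * y)) \<partial>\<rho> i)"
    proof (rule Bochner_Integration.integral_cong[OF refl])
      fix y assume "y \<in> space (\<rho> i)"
      then have y: "y \<in> {-1..1}" by (simp add: s.space_interval)
      show "?g (x(i := y)) = exp (energy x0) * F x0 * (f y * exp (t * y) - site_exp i t f * exp (t * y))"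
        unfolding upd(1) indep[OF x0 y] energy_update[OF i] upd(2) field_update_self[OF i]
        by (simp add: t_def exp_add algebra_simps)
    qed
    also have "\<dots> = 0"
      using s.integrable_weighted[OF f, of t] s.integrable_exp[of t] s.mgf_pos[of t]
      by (simp add: s.texp_def s.mgf_def)
    finally show "(\<integral>y. ?g (x(i := y)) \<partial>\<rho> i) = 0" .
  qed
  finally show ?thesis by (subst integral_gibbs) auto
qed

definition residual :: "('i \<Rightarrow> real \<Rightarrow> real) \<Rightarrow> ('i \<Rightarrow> real) \<Rightarrow> 'i \<Rightarrow> real" where
  "residual f \<beta> i = f i (\<beta> i) - site_exp i (field \<beta> i) (f i)"

lemma measurable_residual:
  assumes "i \<in> I" "f i \<in> borel_measurable (\<rho> i)" "\<And>z. \<bar>z\<bar> \<le> 1 \<Longrightarrow> \<bar>f i z\<bar> \<le> B"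
  shows "(\<lambda>\<beta>. residual f \<beta> i) \<in> borel_measurable base"
  unfolding residual_def
  by (intro borel_measurable_diff measurable_at_coord measurable_site_exp[where B = B] assms)

lemma residual_le:
  assumes "i \<in> I" "f i \<in> borel_measurable (\<rho> i)" "\<And>z. \<bar>z\<bar> \<le> 1 \<Longrightarrow> \<bar>f i z\<bar> \<le> B" "\<beta> \<in> space base"
  shows "\<bar>residual f \<beta> i\<bar> \<le> 2 * B"
  using assms(3)[OF coord_le[OF assms(4,1)]]
    interval_measure.texp_abs_le[OF site assms(2,3), of "field \<beta> i"]
  unfolding residual_def by linarith

text \<open>
  The residual at \<open>i\<close> is centred given the other coordinates. The residual at \<open>j\<close> depends on \<open>\<beta> i\<close>
  only through the field, with coefficient \<open>a i j\<close>; resetting \<open>\<beta> i\<close> to zero makes it independent of \<open>\<beta> i\<close>,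
  so that the product has mean zero, at a cost of order \<open>\<bar>a i j\<bar>\<close>.
\<close>

lemma residual_correlation:
  assumes ij: "i \<in> I" "j \<in> I" "i \<noteq> j"
    and f: "\<And>i. i \<in> I \<Longrightarrow> f i \<in> borel_measurable (\<rho> i)" "\<And>i z. i \<in> I \<Longrightarrow> \<bar>z\<bar> \<le> 1 \<Longrightarrow> \<bar>f i z\<bar> \<le> B"
  shows "\<bar>\<integral>\<beta>. residual f \<beta> i * residual f \<beta> j \<partial>gibbs\<bar> \<le> 4 * B\<^sup>2 * \<bar>a i j\<bar>"
proof -
  interpret g: prob_space gibbs by (rule prob_gibbs)
  let ?F = "\<lambda>\<beta>. residual f (\<beta>(i := 0)) j"
  have B: "B \<ge> 0" using f(2)[OF ij(1), of 0] by simp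
  have [measurable]: "(\<lambda>\<beta>. \<beta>(i := 0)) \<in> measurable base base"
  proof -
    have "(\<lambda>\<beta> k. if k = i then 0 else \<beta> k) \<in> measurable base base"
    proof (rule measurable_PiM_single')
      fix k assume k: "k \<in> I"
      show "(\<lambda>\<beta>. if k = i then 0 else \<beta> k) \<in> measurable base (\<rho> k)"
      proof (cases "k = i")
        case True
        then show ?thesis by (simp add: interval_measure.space_interval[OF site])
      next
        case False
        then show ?thesis using measurable_component_singleton[OF k, of \<rho>] by simp
      qed
    next
      show "(\<lambda>\<beta> k. if k = i then 0 else \<beta> k) \<in> space base \<rightarrow> (\<Pi>\<^sub>E k\<in>I. space (\<rho> k))"
        using update_in_space[OF _ ij(1), of _ 0] by (auto simp: fun_upd_def space_PiM)
    qed
    then show ?thesis by (simp add: fun_upd_def)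
  qed
  have mV: "(\<lambda>\<beta>. residual f \<beta> k) \<in> borel_measurable base" if "k \<in> I" for k
    by (rule measurable_residual[where B = B]) (use f that in auto)
  have [measurable]: "(\<lambda>\<beta>. residual f \<beta> i) \<in> borel_measurable base" "(\<lambda>\<beta>. residual f \<beta> j) \<in> borel_measurable base"
    "?F \<in> borel_measurable base"
    using mV ij by (auto intro: measurable_compose[OF _ mV])
  have bV: "\<bar>residual f \<beta> k\<bar> \<le> 2 * B" if "k \<in> I" "\<beta> \<in> space base" for k \<beta>
    by (rule residual_le) (use f that in auto)
  have b0: "\<beta>(i := 0) \<in> space base" if "\<beta> \<in> space base" for \<beta>
    using update_in_space[OF that ij(1), of 0] by simp
  have zero: "(\<integral>\<beta>. residual f \<beta> i * ?F \<beta> \<partial>gibbs) = 0"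
    unfolding residual_def[of f _ i]
    by (rule gibbs_resample[where B = B and C = "2 * B"]) (use ij f bV b0 in auto)
  have b2: "\<bar>x * y\<bar> \<le> (2 * B) * (2 * B)" if "\<bar>x\<bar> \<le> 2 * B" "\<bar>y\<bar> \<le> 2 * B" for x y :: real
    using mult_mono[OF that] B by (simp add: abs_mult)
  have int: "integrable gibbs (\<lambda>\<beta>. residual f \<beta> i * residual f \<beta> j)"
      "integrable gibbs (\<lambda>\<beta>. residual f \<beta> i * ?F \<beta>)"
    by (rule integrable_gibbs[where C = "(2 * B) * (2 * B)"]; use b2 bV ij b0 in auto)+
  have diff: "\<bar>residual f \<beta> j - ?F \<beta>\<bar> \<le> 2 * B * \<bar>a i j\<bar>" if b: "\<beta> \<in> space base" for \<beta>
  proof -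
    have "\<bar>residual f \<beta> j - ?F \<beta>\<bar> = \<bar>site_exp j (field (\<beta>(i := 0)) j) (f j) - site_exp j (field \<beta> j) (f j)\<bar>"
      using ij by (simp add: residual_def)
    also have "\<dots> \<le> 2 * B * \<bar>field (\<beta>(i := 0)) j - field \<beta> j\<bar>"
      by (rule interval_measure.texp_lipschitz[OF site]) (use f ij in auto)
    also have "field (\<beta>(i := 0)) j - field \<beta> j = - (a i j * \<beta> i)"
      using field_update[OF ij(1), of \<beta> 0 j] sym[of i j] by simp
    also have "2 * B * \<bar>- (a i j * \<beta> i)\<bar> \<le> 2 * B * \<bar>a i j\<bar>"
      using abs_mult_le_abs[OF coord_le[OF b ij(1)], of "a i j"] B by (intro mult_left_mono) auto
    finally show ?thesis .
  qed
  have eq: "(\<integral>\<beta>. residual f \<beta> i * residual f \<beta> j \<partial>gibbs)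
      = (\<integral>\<beta>. residual f \<beta> i * residual f \<beta> j - residual f \<beta> i * ?F \<beta> \<partial>gibbs)"
    using int zero by simp
  have "\<bar>\<integral>\<beta>. residual f \<beta> i * residual f \<beta> j \<partial>gibbs\<bar> \<le> (\<integral>\<beta>. \<bar>residual f \<beta> i * residual f \<beta> j - residual f \<beta> i * ?F \<beta>\<bar> \<partial>gibbs)"
    unfolding eq by (rule integral_abs_bound)
  also have "\<dots> \<le> (\<integral>\<beta>. 4 * B\<^sup>2 * \<bar>a i j\<bar> \<partial>gibbs)"
  proof (rule integral_mono)
    fix \<beta> assume "\<beta> \<in> space gibbs"
    then have b: "\<beta> \<in> space base" by simp
    have "\<bar>residual f \<beta> i\<bar> * \<bar>residual f \<beta> j - ?F \<beta>\<bar> \<le> (2 * B) * (2 * B * \<bar>a i j\<bar>)"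
      by (rule mult_mono[OF bV[OF ij(1) b] diff[OF b]]) (simp_all add: B)
    moreover have "(2 * B) * (2 * B * \<bar>a i j\<bar>) = 4 * B\<^sup>2 * \<bar>a i j\<bar>"
      by (simp add: power2_eq_square)
    ultimately show "\<bar>residual f \<beta> i * residual f \<beta> j - residual f \<beta> i * ?F \<beta>\<bar> \<le> 4 * B\<^sup>2 * \<bar>a i j\<bar>"
      unfolding right_diff_distrib[symmetric] abs_mult by linarith
  next
    show "integrable gibbs (\<lambda>\<beta>. \<bar>residual f \<beta> i * residual f \<beta> j - residual f \<beta> i * ?F \<beta>\<bar>)"
      by (intro integrable_abs Bochner_Integration.integrable_diff int)
  qed simp
  finally show ?thesis by simp
qed

text \<open>
  The correlation bound contributes one factor \<open>\<bar>a i j\<bar>\<close> and the matrix itself the other.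
\<close>

lemma residual_quadratic_form:
  shows "\<bar>\<integral>\<beta>. (\<Sum>i\<in>I. \<Sum>j\<in>I. (\<beta> i - site_mean \<beta> i) * a i j * (\<beta> j - site_mean \<beta> j)) \<partial>gibbs\<bar> \<le> 4 * frobenius2"
proof -
  let ?w = "\<lambda>\<beta> i. \<beta> i - site_mean \<beta> i"
  have w: "?w \<beta> i = residual (\<lambda>_ z. z) \<beta> i" for \<beta> i by (simp add: residual_def site_mean_def)
  have wb: "\<bar>?w \<beta> i\<bar> \<le> 2" if "i \<in> I" "\<beta> \<in> space base" for i \<beta>
    using coord_le[OF that(2,1)] site_mean_le[of \<beta> i] by linarith
  have int: "integrable gibbs (\<lambda>\<beta>. ?w \<beta> i * ?w \<beta> j)" if "i \<in> I" "j \<in> I" for i j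
  proof (rule integrable_gibbs[where C = "2 * 2"])
    fix \<beta> assume "\<beta> \<in> space base"
    then show "\<bar>?w \<beta> i * ?w \<beta> j\<bar> \<le> 2 * 2"
      unfolding abs_mult using wb that by (intro mult_mono) auto
  qed (use that in measurable)
  have eq1: "(\<integral>\<beta>. (\<Sum>i\<in>I. \<Sum>j\<in>I. ?w \<beta> i * a i j * ?w \<beta> j) \<partial>gibbs)
      = (\<integral>\<beta>. (\<Sum>i\<in>I. \<Sum>j\<in>I. a i j * (?w \<beta> i * ?w \<beta> j)) \<partial>gibbs)"
    by (simp add: ac_simps)
  have eq2: "(\<integral>\<beta>. (\<Sum>i\<in>I. \<Sum>j\<in>I. a i j * (?w \<beta> i * ?w \<beta> j)) \<partial>gibbs) = (\<Sum>i\<in>I. \<Sum>j\<in>I. a i j * (\<integral>\<beta>. ?w \<beta> i * ?w \<beta> j \<partial>gibbs))"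
    using int by (simp add: Bochner_Integration.integral_sum Bochner_Integration.integrable_sum)
  have "\<bar>\<Sum>i\<in>I. \<Sum>j\<in>I. a i j * (\<integral>\<beta>. ?w \<beta> i * ?w \<beta> j \<partial>gibbs)\<bar> \<le> (\<Sum>i\<in>I. \<Sum>j\<in>I. 4 * (a i j)\<^sup>2)"
  proof (intro sum_abs_le_sum)
    fix i j assume ij: "i \<in> I" "j \<in> I"
    show "\<bar>a i j * (\<integral>\<beta>. ?w \<beta> i * ?w \<beta> j \<partial>gibbs)\<bar> \<le> 4 * (a i j)\<^sup>2"
    proof (cases "i = j")
      case False
      have "\<bar>\<integral>\<beta>. ?w \<beta> i * ?w \<beta> j \<partial>gibbs\<bar> \<le> 4 * 1\<^sup>2 * \<bar>a i j\<bar>"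
        unfolding w by (rule residual_correlation[OF ij False])
          (auto intro: interval_measure.measurable_ident_interval[OF site])
      then have "\<bar>a i j\<bar> * \<bar>\<integral>\<beta>. ?w \<beta> i * ?w \<beta> j \<partial>gibbs\<bar> \<le> \<bar>a i j\<bar> * (4 * 1\<^sup>2 * \<bar>a i j\<bar>)"
        by (rule mult_left_mono) simp
      then show ?thesis by (simp add: abs_mult power2_eq_square)
    qed (simp add: diag0)
  qed
  then show ?thesis unfolding eq1 eq2 by (simp add: frobenius2_def sum_distrib_left)
qed

lemma residual_sum_second_moment:
  assumes f: "\<And>i. i \<in> I \<Longrightarrow> f i \<in> borel_measurable (\<rho> i)" "\<And>i z. i \<in> I \<Longrightarrow> \<bar>z\<bar> \<le> 1 \<Longrightarrow> \<bar>f i z\<bar> \<le> B"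
    and B: "B \<ge> 0"
  shows "(\<integral>\<beta>. (\<Sum>i\<in>I. residual f \<beta> i)\<^sup>2 \<partial>gibbs) \<le> 4 * B\<^sup>2 * (real (card I) + (\<Sum>i\<in>I. \<Sum>j\<in>I. \<bar>a i j\<bar>))"
proof -
  interpret g: prob_space gibbs by (rule prob_gibbs)
  have [measurable]: "(\<lambda>\<beta>. residual f \<beta> k) \<in> borel_measurable base" if "k \<in> I" for k
    by (rule measurable_residual[where B = B]) (use f that in auto)
  have bV: "\<bar>residual f \<beta> k\<bar> \<le> 2 * B" if "k \<in> I" "\<beta> \<in> space base" for k \<beta>
    by (rule residual_le) (use f that in auto)
  have bVV: "\<bar>residual f \<beta> i * residual f \<beta> j\<bar> \<le> 4 * B\<^sup>2" if "i \<in> I" "j \<in> I" "\<beta> \<in> space base" for i j \<beta>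
    using mult_mono[OF bV[OF that(1,3)] bV[OF that(2,3)]] B by (simp add: abs_mult power2_eq_square)
  have int: "integrable gibbs (\<lambda>\<beta>. residual f \<beta> i * residual f \<beta> j)" if "i \<in> I" "j \<in> I" for i j
    by (rule integrable_gibbs[where C = "4 * B\<^sup>2"]) (use that bVV in auto)
  have "(\<integral>\<beta>. (\<Sum>i\<in>I. residual f \<beta> i)\<^sup>2 \<partial>gibbs)
      = (\<Sum>i\<in>I. \<Sum>j\<in>I. (\<integral>\<beta>. residual f \<beta> i * residual f \<beta> j \<partial>gibbs))"
    using int by (simp add: power2_eq_square sum_product Bochner_Integration.integral_sum Bochner_Integration.integrable_sum)
  also have "\<dots> \<le> (\<Sum>i\<in>I. \<Sum>j\<in>I. 4 * B\<^sup>2 * ((if i = j then 1 else 0) + \<bar>a i j\<bar>))"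
  proof (intro sum_mono)
    fix i j assume ij: "i \<in> I" "j \<in> I"
    show "(\<integral>\<beta>. residual f \<beta> i * residual f \<beta> j \<partial>gibbs) \<le> 4 * B\<^sup>2 * ((if i = j then 1 else 0) + \<bar>a i j\<bar>)"
    proof (cases "i = j")
      case True
      have "(\<integral>\<beta>. residual f \<beta> i * residual f \<beta> j \<partial>gibbs) \<le> (\<integral>\<beta>. 4 * B\<^sup>2 \<partial>gibbs)"
        by (intro integral_mono int ij) (use bVV[OF ij] in \<open>auto simp: abs_le_iff\<close>)
      then show ?thesis using True by (simp add: diag0)
    next
      case False
      then show ?thesis using residual_correlation[OF ij False f] by (simp add: abs_le_iff)
    qed
  qed
  also have "\<dots> = 4 * B\<^sup>2 * (real (card I) + (\<Sum>i\<in>I. \<Sum>j\<in>I. \<bar>a i j\<bar>))"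
    using finite_I by (simp add: sum_distrib_left[symmetric] sum.distrib)
  finally show ?thesis .
qed

end

section \<open>Upper bound for the partition function\<close>

lemma sum_PiE_prod_weight:
  fixes w :: "'i \<Rightarrow> 'b \<Rightarrow> real"
  assumes "finite I" "finite S" and one: "\<And>i. i \<in> I \<Longrightarrow> (\<Sum>x\<in>S. w i x) = 1"
  shows "(\<Sum>s\<in>I \<rightarrow>\<^sub>E S. \<Prod>i\<in>I. w i (s i)) = 1"
  using prod_sum_PiE[of I "\<lambda>_. S" w] assms by simp

text \<open>
  Bienayme's formula for independent centred variables \<open>x j\<close> on the finite product space with
  product weights \<open>w\<close>.
\<close>

lemma sum_PiE_second_moment:
  fixes w x :: "'i \<Rightarrow> 'b \<Rightarrow> real"
  assumes fin: "finite I" "finite S" and one: "\<And>i. i \<in> I \<Longrightarrow> (\<Sum>s\<in>S. w i s) = 1"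
    and centred: "\<And>i. i \<in> I \<Longrightarrow> (\<Sum>s\<in>S. w i s * x i s) = 0"
  shows "(\<Sum>s\<in>I \<rightarrow>\<^sub>E S. (\<Prod>i\<in>I. w i (s i)) * (\<Sum>j\<in>I. x j (s j))\<^sup>2)
     = (\<Sum>j\<in>I. \<Sum>s\<in>S. w j s * (x j s)\<^sup>2)"
proof -
  have pair: "(\<Sum>s\<in>I \<rightarrow>\<^sub>E S. (\<Prod>i\<in>I. w i (s i)) * (x j (s j) * x k (s k)))
     = (if j = k then \<Sum>s\<in>S. w j s * (x j s)\<^sup>2 else 0)" if jk: "j \<in> I" "k \<in> I" for j k
  proof -
    let ?h = "\<lambda>i s. w i s * ((if i = j then x j s else 1) * (if i = k then x k s else 1))"
    have "(\<Prod>i\<in>I. w i (s i)) * (x j (s j) * x k (s k)) = (\<Prod>i\<in>I. ?h i (s i))" for s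
    proof -
      have "(\<Prod>i\<in>I. if i = l then x l (s i) else 1) = x l (s l)" if "l \<in> I" for l
        using prod.delta[OF fin(1), of l "\<lambda>i. x l (s i)"] that by simp
      then show ?thesis using jk by (simp add: prod.distrib)
    qed
    then have "(\<Sum>s\<in>I \<rightarrow>\<^sub>E S. (\<Prod>i\<in>I. w i (s i)) * (x j (s j) * x k (s k))) = (\<Prod>i\<in>I. \<Sum>s\<in>S. ?h i s)"
      using prod_sum_PiE[of I "\<lambda>_. S" ?h] fin by simp
    also have "\<dots> = (if j = k then \<Sum>s\<in>S. w j s * (x j s)\<^sup>2 else 0)"
    proof (cases "j = k")
      case True
      have "(\<Prod>i\<in>I. \<Sum>s\<in>S. ?h i s) = (\<Prod>i\<in>I. if i = j then \<Sum>s\<in>S. w j s * (x j s)\<^sup>2 else 1)"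
        by (rule prod.cong) (auto simp: True one power2_eq_square)
      then show ?thesis using fin jk True by simp
    next
      case False
      have "(\<Sum>s\<in>S. ?h j s) = 0" using False centred[OF jk(1)] by simp
      then have "(\<Prod>i\<in>I. \<Sum>s\<in>S. ?h i s) = 0" using jk(1) by (intro prod_zero[OF fin(1)] bexI[of _ j])
      then show ?thesis using False by simp
    qed
    finally show ?thesis .
  qed
  have "(\<Sum>s\<in>I \<rightarrow>\<^sub>E S. (\<Prod>i\<in>I. w i (s i)) * (\<Sum>j\<in>I. x j (s j))\<^sup>2)
     = (\<Sum>s\<in>I \<rightarrow>\<^sub>E S. \<Sum>j\<in>I. \<Sum>k\<in>I. (\<Prod>i\<in>I. w i (s i)) * (x j (s j) * x k (s k)))"
  proof -
    have "(\<Sum>j\<in>I. x j (s j))\<^sup>2 = (\<Sum>j\<in>I. \<Sum>k\<in>I. x j (s j) * x k (s k))" for s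
      by (simp only: power2_eq_square sum_product)
    then show ?thesis by (simp only: sum_distrib_left)
  qed
  also have "\<dots> = (\<Sum>j\<in>I. \<Sum>k\<in>I. \<Sum>s\<in>I \<rightarrow>\<^sub>E S. (\<Prod>i\<in>I. w i (s i)) * (x j (s j) * x k (s k)))"
    by (subst sum.swap) (intro sum.cong refl sum.swap)
  also have "\<dots> = (\<Sum>j\<in>I. \<Sum>k\<in>I. if j = k then \<Sum>s\<in>S. w j s * (x j s)\<^sup>2 else 0)"
    by (intro sum.cong refl pair)
  also have "\<dots> = (\<Sum>j\<in>I. \<Sum>s\<in>S. w j s * (x j s)\<^sup>2)" using fin by simp
  finally show ?thesis .
qed

text \<open>
  Jensen's inequality, from the tangent line of the exponential at the mean.
\<close>

lemma exp_weighted_sum_le: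
  fixes W x :: "'s \<Rightarrow> real"
  assumes "\<And>s. s \<in> T \<Longrightarrow> W s \<ge> 0" "sum W T = 1"
  shows "exp (\<Sum>s\<in>T. W s * x s) \<le> (\<Sum>s\<in>T. W s * exp (x s))"
proof -
  let ?m = "\<Sum>s\<in>T. W s * x s"
  have "exp ?m * (\<Sum>s\<in>T. W s * (1 + (x s - ?m))) \<le> (\<Sum>s\<in>T. W s * exp (x s))"
    unfolding sum_distrib_left
  proof (rule sum_mono)
    fix s assume s: "s \<in> T"
    have "exp (x s) = exp ?m * exp (x s - ?m)" by (simp add: exp_add[symmetric])
    moreover have "W s * (exp ?m * (1 + (x s - ?m))) \<le> W s * (exp ?m * exp (x s - ?m))"
      using assms(1)[OF s] by (intro mult_left_mono exp_ge_add_one_self) auto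
    ultimately show "exp ?m * (W s * (1 + (x s - ?m))) \<le> W s * exp (x s)" by (simp add: ac_simps)
  qed
  moreover have "(\<Sum>s\<in>T. W s * (1 + (x s - ?m))) = 1"
  proof -
    have "(\<Sum>s\<in>T. W s * (1 + (x s - ?m))) = (\<Sum>s\<in>T. W s + (W s * x s - W s * ?m))"
      by (simp add: algebra_simps)
    also have "\<dots> = sum W T + (?m - sum W T * ?m)"
      by (simp only: sum.distrib sum_subtractf sum_distrib_right[symmetric])
    finally show ?thesis using assms(2) by simp
  qed
  ultimately show ?thesis by simp
qed

context quadratic_gibbs
begin

text \<open>
  \<open>mean_field \<beta>\<close> is the mean-field functional evaluated at the vector of conditional means. In the
  functional the entropy of a site with mean \<open>u\<close> is the convex conjugate of \<open>site_log i\<close>, and at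
  \<open>u = site_mean \<beta> i\<close> the supremum defining it is attained at the field.
  \<open>excess\<close> is the same linearised term with \<open>\<beta>\<close> in place of its conditional mean: for a field that does not
  depend on \<open>\<beta>\<close>, it would be the log-density of a product of tilted site measures.
\<close>

definition excess :: "('i \<Rightarrow> real) \<Rightarrow> real" where
  "excess \<beta> = (\<Sum>i\<in>I. \<beta> i * field \<beta> i - site_log i (field \<beta> i))"

definition mean_field :: "('i \<Rightarrow> real) \<Rightarrow> real" where
  "mean_field \<beta> = energy (site_mean \<beta>)
     - (\<Sum>i\<in>I. site_mean \<beta> i * field \<beta> i - site_log i (field \<beta> i))"

lemma measurable_excess [measurable]: "excess \<in> borel_measurable base"
  unfolding excess_def[abs_def] by measurable

lemma measurable_mean_field [measurable]: "mean_field \<in> borel_measurable base"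
  unfolding mean_field_def[abs_def] energy_def by measurable

lemma site_log_le: "\<bar>site_log i \<theta>\<bar> \<le> \<bar>\<theta>\<bar>"
proof -
  interpret s: interval_measure "\<rho> i" by (rule site)
  have "s.logmgf 0 = 0" by (simp add: s.logmgf_def s.mgf_def s.prob_space)
  then show ?thesis using s.logmgf_lipschitz[of \<theta> 0] by simp
qed

lemma site_term_le:
  assumes "\<beta> \<in> space base" "i \<in> I" "\<bar>u\<bar> \<le> 1"
  shows "\<bar>u * field \<beta> i - site_log i (field \<beta> i)\<bar> \<le> 2 * energy_bound"
proof -
  have "\<bar>field \<beta> i\<bar> \<le> energy_bound" using field_le[of \<beta> i] coord_le[OF assms(1)] assms(2) by blast
  moreover have "\<bar>u * field \<beta> i\<bar> \<le> \<bar>field \<beta> i\<bar>"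
    using abs_mult_le_abs[OF assms(3), of "field \<beta> i"] by (simp add: ac_simps)
  ultimately show ?thesis using site_log_le[of i "field \<beta> i"] by linarith
qed

lemma excess_le: "\<beta> \<in> space base \<Longrightarrow> \<bar>excess \<beta>\<bar> \<le> real (card I) * (2 * energy_bound)"
  unfolding excess_def
  using sum_abs_le_sum[of I _ "\<lambda>_. 2 * energy_bound"] site_term_le coord_le by simp

lemma mean_field_le: "\<beta> \<in> space base \<Longrightarrow> \<bar>mean_field \<beta>\<bar> \<le> energy_bound + real (card I) * (2 * energy_bound)"
proof -
  assume b: "\<beta> \<in> space base"
  have "\<bar>\<Sum>i\<in>I. site_mean \<beta> i * field \<beta> i - site_log i (field \<beta> i)\<bar> \<le> (\<Sum>i\<in>I. 2 * energy_bound)"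
    by (intro sum_abs_le_sum site_term_le b site_mean_le)
  then show ?thesis unfolding mean_field_def using energy_le[of "site_mean \<beta>"] site_mean_le by fastforce
qed

lemma energy_decomposition:
  "energy \<beta> = mean_field \<beta> + excess \<beta>
     - 1 / 2 * (\<Sum>i\<in>I. \<Sum>j\<in>I. (\<beta> i - site_mean \<beta> i) * a i j * (\<beta> j - site_mean \<beta> j))"
proof -
  let ?b = "site_mean \<beta>" and ?L = "\<Sum>i\<in>I. site_log i (field \<beta> i)"
  define q where "q u v = (\<Sum>i\<in>I. \<Sum>j\<in>I. u i * a i j * v j)" for u v :: "'i \<Rightarrow> real"
  define l where "l u = (\<Sum>i\<in>I. c i * u i)" for u :: "'i \<Rightarrow> real"
  have q_sym: "q u v = q v u" for u v
    unfolding q_def by (subst sum.swap) (auto simp: sym[of _ _] ac_simps intro!: sum.cong)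
  have e: "energy u = 1 / 2 * q u u + l u" for u by (simp add: energy_def q_def l_def)
  have f: "(\<Sum>i\<in>I. u i * field \<beta> i - site_log i (field \<beta> i)) = l u + q u \<beta> - ?L" for u
    by (simp add: field_def q_def l_def sum.distrib sum_subtractf sum_distrib_left algebra_simps)
  have w: "(\<Sum>i\<in>I. \<Sum>j\<in>I. (\<beta> i - ?b i) * a i j * (\<beta> j - ?b j)) = q \<beta> \<beta> - q \<beta> ?b - q ?b \<beta> + q ?b ?b"
    by (simp add: q_def sum.distrib sum_subtractf algebra_simps)
  show ?thesis unfolding mean_field_def excess_def w e f using q_sym[of \<beta> ?b] by (simp add: field_simps)
qed

text \<open>
  The integral of \<open>exp excess\<close> against the product measure is \<open>partition\<close> times the Gibbs
  expectation of \<open>exp (excess - energy)\<close>, to which Jensen's inequality applies.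
\<close>

lemma log_partition_jensen:
  "ln partition \<le> ln (\<integral>\<beta>. exp (excess \<beta>) \<partial>base) + (\<integral>\<beta>. energy \<beta> - excess \<beta> \<partial>gibbs)"
proof -
  interpret prob_space gibbs by (rule prob_gibbs)
  define K where "K = (\<integral>\<beta>. exp (excess \<beta>) \<partial>base)"
  let ?C = "real (card I) * (2 * energy_bound)"
  let ?h = "\<lambda>\<beta>. excess \<beta> - energy \<beta>"
  have h: "\<bar>?h \<beta>\<bar> \<le> ?C + energy_bound" if "\<beta> \<in> space base" for \<beta>
    using excess_le[OF that] energy_space_le[OF that] by linarith
  have inth: "integrable gibbs ?h" by (rule integrable_gibbs[OF _ h]) auto
  have intexp: "integrable gibbs (\<lambda>\<beta>. exp (?h \<beta>))"
    by (rule integrable_gibbs[where C = "exp (?C + energy_bound)"]) (use h in \<open>auto simp: abs_le_iff\<close>)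
  have eqK: "(\<integral>\<beta>. exp (?h \<beta>) \<partial>gibbs) = K / partition"
    by (subst integral_gibbs) (auto simp: K_def exp_diff)
  have Jen: "exp (\<integral>\<beta>. ?h \<beta> \<partial>gibbs) \<le> K / partition"
  proof -
    let ?m = "\<integral>\<beta>. ?h \<beta> \<partial>gibbs"
    have "(\<integral>\<beta>. exp ?m * (1 + (?h \<beta> - ?m)) \<partial>gibbs) \<le> (\<integral>\<beta>. exp (?h \<beta>) \<partial>gibbs)"
    proof (rule integral_mono[OF _ intexp])
      fix \<beta>
      have "exp (?h \<beta>) = exp ?m * exp (?h \<beta> - ?m)" by (simp add: exp_add[symmetric])
      moreover have "exp ?m * (1 + (?h \<beta> - ?m)) \<le> exp ?m * exp (?h \<beta> - ?m)"
        by (intro mult_left_mono exp_ge_add_one_self) auto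
      ultimately show "exp ?m * (1 + (?h \<beta> - ?m)) \<le> exp (?h \<beta>)" by simp
    qed (intro integrable_mult_right Bochner_Integration.integrable_add Bochner_Integration.integrable_diff inth integrable_const)
    moreover have "(\<integral>\<beta>. exp ?m * (1 + (?h \<beta> - ?m)) \<partial>gibbs) = exp ?m"
    proof -
      have "(\<integral>\<beta>. exp ?m * (1 + (?h \<beta> - ?m)) \<partial>gibbs) = exp ?m * (1 + (?m - ?m))"
        using inth by (simp only: Bochner_Integration.integral_mult_right Bochner_Integration.integral_add
            Bochner_Integration.integral_diff integrable_const Bochner_Integration.integrable_diff integrable_mult_right
            Bochner_Integration.integrable_add integral_mult_right_zero lebesgue_integral_const prob_space scaleR_one)
      then show ?thesis by simp
    qed
    ultimately show ?thesis unfolding eqK by simp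
  qed
  have K: "K > 0"
  proof -
    have "K / partition > 0" using less_le_trans[OF exp_gt_zero Jen] .
    then show ?thesis using partition_pos by (simp add: zero_less_divide_iff)
  qed
  have "(\<integral>\<beta>. ?h \<beta> \<partial>gibbs) \<le> ln (K / partition)"
    using Jen K partition_pos by (subst ln_ge_iff) auto
  then have "ln partition \<le> ln K - (\<integral>\<beta>. ?h \<beta> \<partial>gibbs)" using K partition_pos by (simp add: ln_div)
  moreover have "- (\<integral>\<beta>. ?h \<beta> \<partial>gibbs) = (\<integral>\<beta>. energy \<beta> - excess \<beta> \<partial>gibbs)"
    by (subst integral_minus[symmetric]) simp
  ultimately show ?thesis unfolding K_def by linarith
qed

lemma integral_prod_sites:
  fixes f :: "'i \<Rightarrow> real \<Rightarrow> real"
  assumes "\<And>i. i \<in> I \<Longrightarrow> integrable (\<rho> i) (f i)"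
  shows "(\<integral>\<beta>. (\<Prod>i\<in>I. f i (\<beta> i)) \<partial>base) = (\<Prod>i\<in>I. \<integral>z. f i z \<partial>\<rho> i)"
  using product_sigma_finite.product_integral_prod[OF product_sites finite_I] assms by blast

text \<open>
  If the field were deterministic, \<open>exp excess\<close> would be a probability density. The idea is to
  approximate the field by \<open>2 ^ card I\<close> deterministic ones, indexed by sign vectors \<open>s\<close>: choose the
  signs independently with mean \<open>\<beta> i / \<tau>\<close>. Then the field \<open>c + \<tau> a s\<close> has mean \<open>field \<beta>\<close> and variance of order
  \<open>\<tau>\<^sup>2 \<Sum>j. (a i j)\<^sup>2\<close> at \<open>i\<close>, which bounds the error of the approximation. By
  Jensen's inequality \<open>exp excess\<close> is, up to the factor from this error, at most a mixture over \<open>s\<close> of the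
  densities for deterministic fields. Each mixture weight is at most \<open>((1 + 1/\<tau>) / 2) ^ card I\<close>, so summing over all \<open>s\<close>
  costs only \<open>(1 + 1/\<tau>) ^ card I \<le> exp (card I / \<tau>)\<close>.
\<close>

lemma integral_exp_excess:
  assumes \<tau>: "\<tau> \<ge> 1" and \<delta>: "\<delta> > 0"
  shows "ln (\<integral>\<beta>. exp (excess \<beta>) \<partial>base)
     \<le> real (card I) / \<tau> + real (card I) * \<delta> + \<tau>\<^sup>2 * frobenius2 / \<delta>"
proof -
  interpret b: prob_space base by (rule prob_base)
  let ?S = "{-1, 1 :: real}"
  let ?T = "I \<rightarrow>\<^sub>E ?S"
  define W where "W \<beta> s = (\<Prod>i\<in>I. (1 + s i * \<beta> i / \<tau>) / 2)" for \<beta> s :: "'i \<Rightarrow> real"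
  define \<theta> where "\<theta> s i = c i + \<tau> * (\<Sum>j\<in>I. a i j * s j)" for s i
  define \<phi> where "\<phi> \<beta> s = (\<Sum>i\<in>I. \<beta> i * \<theta> s i - site_log i (\<theta> s i))" for \<beta> s
  let ?err = "real (card I) * \<delta> + \<tau>\<^sup>2 * frobenius2 / \<delta>"
  have finT: "finite ?T" using finite_I by (intro finite_PiE) auto
  have ratio: "\<bar>x / \<tau>\<bar> \<le> 1 / \<tau>" "\<bar>x / \<tau>\<bar> \<le> 1" if "\<bar>x\<bar> \<le> 1" for x
    using that \<tau> by (auto simp: field_simps)
  have Wfac: "0 \<le> (1 + s i * \<beta> i / \<tau>) / 2 \<and> (1 + s i * \<beta> i / \<tau>) / 2 \<le> (1 + 1 / \<tau>) / 2"
    if "i \<in> I" "s \<in> ?T" "\<beta> \<in> space base" for s \<beta> i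
  proof -
    have "s i \<in> ?S" using that(1,2) by (rule PiE_mem[rotated])
    then have "s i = 1 \<or> s i = -1" by auto
    moreover have "\<bar>\<beta> i / \<tau>\<bar> \<le> 1 / \<tau>" "\<bar>\<beta> i / \<tau>\<bar> \<le> 1"
      by (rule ratio[OF coord_le[OF that(3,1)]])+
    then have "\<beta> i / \<tau> \<le> 1 / \<tau>" "- (\<beta> i / \<tau>) \<le> 1 / \<tau>" "\<beta> i / \<tau> \<le> 1" "- (\<beta> i / \<tau>) \<le> 1"
      by linarith+
    moreover have "s i * \<beta> i / \<tau> = \<beta> i / \<tau> \<or> s i * \<beta> i / \<tau> = - (\<beta> i / \<tau>)"
      using \<open>s i = 1 \<or> s i = -1\<close> by auto
    moreover have "0 \<le> (1 + x) / 2 \<and> (1 + x) / 2 \<le> (1 + r) / 2"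
      if "x = y \<or> x = - y" "y \<le> r" "- y \<le> r" "y \<le> 1" "- y \<le> 1" for x y r :: real
      using that by auto
    ultimately show ?thesis by blast
  qed
  have W0: "W \<beta> s \<ge> 0" if "s \<in> ?T" "\<beta> \<in> space base" for s \<beta>
    unfolding W_def using Wfac that by (intro prod_nonneg) auto
  have W1: "W \<beta> s \<le> ((1 + 1 / \<tau>) / 2) ^ card I" if "s \<in> ?T" "\<beta> \<in> space base" for s \<beta>
  proof -
    have "W \<beta> s \<le> (\<Prod>i\<in>I. (1 + 1 / \<tau>) / 2)"
      unfolding W_def using Wfac that by (intro prod_mono) auto
    then show ?thesis by simp
  qed
  have W_sum: "(\<Sum>s\<in>?T. W \<beta> s) = 1" for \<beta>
    unfolding W_def
    by (rule sum_PiE_prod_weight[OF finite_I, where w = "\<lambda>i x. (1 + x * \<beta> i / \<tau>) / 2"]) (auto simp: field_simps)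
  \<comment> \<open>The weights make \<open>\<tau> s j\<close> a variable with mean \<open>\<beta> j\<close> and second moment \<open>\<tau>\<^sup>2\<close>.\<close>
  have W_var: "(\<Sum>s\<in>?T. W \<beta> s * (\<theta> s i - field \<beta> i)\<^sup>2) \<le> \<tau>\<^sup>2 * (\<Sum>j\<in>I. (a i j)\<^sup>2)" for \<beta> i
  proof -
    let ?w = "\<lambda>k x. (1 + x * \<beta> k / \<tau>) / 2" and ?x = "\<lambda>j x. a i j * (\<tau> * x - \<beta> j)"
    have "\<theta> s i - field \<beta> i = (\<Sum>j\<in>I. ?x j (s j))" for s
      by (simp add: \<theta>_def field_def sum_subtractf sum_distrib_left algebra_simps)
    then have "(\<Sum>s\<in>?T. W \<beta> s * (\<theta> s i - field \<beta> i)\<^sup>2) = (\<Sum>j\<in>I. \<Sum>x\<in>?S. ?w j x * (?x j x)\<^sup>2)"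
      unfolding W_def
      using sum_PiE_second_moment[OF finite_I, of ?S ?w ?x] \<tau> by (simp add: field_simps)
    also have "\<dots> \<le> (\<Sum>j\<in>I. \<tau>\<^sup>2 * (a i j)\<^sup>2)"
    proof (rule sum_mono)
      fix j
      have "(\<Sum>x\<in>?S. ?w j x * (?x j x)\<^sup>2) = (a i j)\<^sup>2 * (\<tau>\<^sup>2 - (\<beta> j)\<^sup>2)"
        using \<tau> by (simp add: field_simps power2_eq_square)
      also have "\<dots> \<le> (a i j)\<^sup>2 * \<tau>\<^sup>2" by (intro mult_left_mono) auto
      finally show "(\<Sum>x\<in>?S. ?w j x * (?x j x)\<^sup>2) \<le> \<tau>\<^sup>2 * (a i j)\<^sup>2" by (simp add: ac_simps)
    qed
    finally show ?thesis by (simp add: sum_distrib_left)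
  qed
  have W_abs: "(\<Sum>s\<in>?T. W \<beta> s * (2 * \<bar>\<theta> s i - field \<beta> i\<bar>)) \<le> \<delta> + \<tau>\<^sup>2 * (\<Sum>j\<in>I. (a i j)\<^sup>2) / \<delta>"
    if "\<beta> \<in> space base" for \<beta> i
  proof -
    have "(\<Sum>s\<in>?T. W \<beta> s * (2 * \<bar>\<theta> s i - field \<beta> i\<bar>)) \<le> (\<Sum>s\<in>?T. W \<beta> s * (\<delta> + (\<theta> s i - field \<beta> i)\<^sup>2 / \<delta>))"
      using W0 that by (intro sum_mono mult_left_mono young_abs[OF \<delta>]) auto
    also have "\<dots> = \<delta> * (\<Sum>s\<in>?T. W \<beta> s) + (\<Sum>s\<in>?T. W \<beta> s * (\<theta> s i - field \<beta> i)\<^sup>2) / \<delta>"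
      by (simp add: ring_distribs sum.distrib sum_distrib_left sum_divide_distrib ac_simps)
    also have "\<dots> \<le> \<delta> + \<tau>\<^sup>2 * (\<Sum>j\<in>I. (a i j)\<^sup>2) / \<delta>"
      using W_sum[of \<beta>] divide_right_mono[OF W_var[of \<beta> i], of \<delta>] \<delta> by simp
    finally show ?thesis .
  qed
  have close: "excess \<beta> \<le> (\<Sum>s\<in>?T. W \<beta> s * \<phi> \<beta> s) + ?err" if b: "\<beta> \<in> space base" for \<beta>
  proof -
    have pt: "excess \<beta> - \<phi> \<beta> s \<le> (\<Sum>i\<in>I. 2 * \<bar>\<theta> s i - field \<beta> i\<bar>)" for s
      unfolding excess_def \<phi>_def sum_subtractf[symmetric]
    proof (rule sum_mono)
      fix i assume i: "i \<in> I"
      have "\<bar>\<beta> i * (field \<beta> i - \<theta> s i)\<bar> \<le> \<bar>\<theta> s i - field \<beta> i\<bar>"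
        using abs_mult_le_abs[OF coord_le[OF b i], of "field \<beta> i - \<theta> s i"] by (simp add: ac_simps abs_minus_commute)
      moreover have "\<bar>site_log i (\<theta> s i) - site_log i (field \<beta> i)\<bar> \<le> \<bar>\<theta> s i - field \<beta> i\<bar>"
        by (rule interval_measure.logmgf_lipschitz[OF site])
      ultimately show "\<beta> i * field \<beta> i - site_log i (field \<beta> i) - (\<beta> i * \<theta> s i - site_log i (\<theta> s i))
          \<le> 2 * \<bar>\<theta> s i - field \<beta> i\<bar>"
        by (simp add: right_diff_distrib abs_le_iff)
    qed
    have "excess \<beta> - (\<Sum>s\<in>?T. W \<beta> s * \<phi> \<beta> s) = (\<Sum>s\<in>?T. W \<beta> s * (excess \<beta> - \<phi> \<beta> s))"
      using W_sum[of \<beta>] by (simp add: right_diff_distrib sum_subtractf sum_distrib_right[symmetric])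
    also have "\<dots> \<le> (\<Sum>s\<in>?T. W \<beta> s * (\<Sum>i\<in>I. 2 * \<bar>\<theta> s i - field \<beta> i\<bar>))"
      using W0 b by (intro sum_mono mult_left_mono pt) auto
    also have "\<dots> = (\<Sum>i\<in>I. \<Sum>s\<in>?T. W \<beta> s * (2 * \<bar>\<theta> s i - field \<beta> i\<bar>))"
      unfolding sum_distrib_left by (rule sum.swap)
    also have "\<dots> \<le> (\<Sum>i\<in>I. \<delta> + \<tau>\<^sup>2 * (\<Sum>j\<in>I. (a i j)\<^sup>2) / \<delta>)"
      by (intro sum_mono W_abs b)
    also have "\<dots> = ?err"
      by (simp add: sum.distrib frobenius2_def sum_distrib_left sum_divide_distrib)
    finally show ?thesis by linarith
  qed
  have phi_int: "integrable base (\<lambda>\<beta>. exp (\<phi> \<beta> s))" and phi_one: "(\<integral>\<beta>. exp (\<phi> \<beta> s) \<partial>base) = 1" for s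
  proof -
    let ?f = "\<lambda>i z. exp (\<theta> s i * z) / exp (site_log i (\<theta> s i))"
    have fi: "integrable (\<rho> i) (?f i)" for i
      using interval_measure.integrable_exp[OF site] by simp
    have eq: "exp (\<phi> \<beta> s) = (\<Prod>i\<in>I. ?f i (\<beta> i))" for \<beta>
      by (simp add: \<phi>_def exp_sum finite_I exp_diff ac_simps)
    show "integrable base (\<lambda>\<beta>. exp (\<phi> \<beta> s))"
      unfolding eq by (rule product_sigma_finite.product_integrable_prod[OF product_sites finite_I fi])
    have site_one: "(\<integral>z. ?f i z \<partial>\<rho> i) = 1" for i
    proof -
      interpret s: interval_measure "\<rho> i" by (rule site)
      show ?thesis using s.mgf_pos[of "\<theta> s i"] by (simp add: s.exp_logmgf s.mgf_def)
    qed
    show "(\<integral>\<beta>. exp (\<phi> \<beta> s) \<partial>base) = 1"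
      unfolding eq integral_prod_sites[of ?f, OF fi] by (simp only: site_one prod.neutral_const)
  qed
  let ?q = "((1 + 1 / \<tau>) / 2) ^ card I"
  have pointwise: "exp (excess \<beta>) \<le> exp ?err * ?q * (\<Sum>s\<in>?T. exp (\<phi> \<beta> s))" if b: "\<beta> \<in> space base" for \<beta>
  proof -
    have "exp (excess \<beta>) \<le> exp ?err * exp (\<Sum>s\<in>?T. W \<beta> s * \<phi> \<beta> s)"
      using close[OF b] by (simp add: exp_add[symmetric] add.commute)
    also have "\<dots> \<le> exp ?err * (\<Sum>s\<in>?T. W \<beta> s * exp (\<phi> \<beta> s))"
      using W0 b by (intro mult_left_mono exp_weighted_sum_le W_sum) auto
    also have "\<dots> \<le> exp ?err * (\<Sum>s\<in>?T. ?q * exp (\<phi> \<beta> s))"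
      using W1 b by (intro mult_left_mono sum_mono mult_right_mono) auto
    finally show ?thesis by (simp add: sum_distrib_left mult.assoc)
  qed
  have int_ex: "integrable base (\<lambda>\<beta>. exp (excess \<beta>))"
    by (rule integrable_base[where C = "exp (real (card I) * (2 * energy_bound))"])
      (use excess_le in \<open>auto simp: abs_le_iff\<close>)
  have "(\<integral>\<beta>. exp (excess \<beta>) \<partial>base) \<le> (\<integral>\<beta>. exp ?err * ?q * (\<Sum>s\<in>?T. exp (\<phi> \<beta> s)) \<partial>base)"
    using phi_int by (intro integral_mono int_ex integrable_mult_right Bochner_Integration.integrable_sum pointwise)
  also have "\<dots> = exp ?err * ?q * real (card ?T)"
    using phi_int phi_one by (simp add: Bochner_Integration.integral_sum)
  also have "real (card ?T) = 2 ^ card I"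
    using finite_I by (simp add: card_PiE)
  also have "exp ?err * ?q * 2 ^ card I = exp ?err * (1 + 1 / \<tau>) ^ card I"
    by (simp add: power_divide)
  also have "\<dots> \<le> exp ?err * exp (1 / \<tau>) ^ card I"
    using \<tau> exp_ge_add_one_self[of "1 / \<tau>"] by (intro mult_left_mono power_mono) auto
  also have "\<dots> = exp (?err + real (card I) / \<tau>)"
    by (simp add: exp_add exp_of_nat_mult[symmetric])
  finally have le: "(\<integral>\<beta>. exp (excess \<beta>) \<partial>base) \<le> exp (?err + real (card I) / \<tau>)" .
  have "(\<integral>\<beta>. exp (excess \<beta>) \<partial>base) > 0"
  proof -
    have "(\<integral>\<beta>. exp (- (real (card I) * (2 * energy_bound))) \<partial>base) \<le> (\<integral>\<beta>. exp (excess \<beta>) \<partial>base)"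
      by (rule integral_mono[OF _ int_ex]) (use excess_le in \<open>fastforce simp: abs_le_iff\<close>)+
    then have "exp (- (real (card I) * (2 * energy_bound))) \<le> (\<integral>\<beta>. exp (excess \<beta>) \<partial>base)"
      using b.prob_space by simp
    then show ?thesis by (rule less_le_trans[OF exp_gt_zero])
  qed
  then have "ln (\<integral>\<beta>. exp (excess \<beta>) \<partial>base) \<le> ?err + real (card I) / \<tau>"
    using le by (metis ln_exp ln_le_cancel_iff exp_gt_zero)
  then show ?thesis by simp
qed

lemma log_partition_le_mean_field:
  assumes "\<tau> \<ge> 1" "\<delta> > 0"
  shows "ln partition \<le> (\<integral>\<beta>. mean_field \<beta> \<partial>gibbs) + 2 * frobenius2
     + real (card I) / \<tau> + real (card I) * \<delta> + \<tau>\<^sup>2 * frobenius2 / \<delta>"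
proof -
  let ?Q = "\<lambda>\<beta>. \<Sum>i\<in>I. \<Sum>j\<in>I. (\<beta> i - site_mean \<beta> i) * a i j * (\<beta> j - site_mean \<beta> j)"
  have im: "integrable gibbs mean_field"
    by (rule integrable_gibbs[OF _ mean_field_le]) auto
  have ih: "integrable gibbs (\<lambda>\<beta>. energy \<beta> - excess \<beta>)"
    by (rule integrable_gibbs[where C = "energy_bound + real (card I) * (2 * energy_bound)"])
      (use excess_le energy_space_le in \<open>fastforce simp: abs_le_iff\<close>)+
  have Q: "?Q \<beta> = 2 * (mean_field \<beta> - (energy \<beta> - excess \<beta>))" for \<beta>
    using energy_decomposition[of \<beta>] by simp
  have "(\<integral>\<beta>. ?Q \<beta> \<partial>gibbs) = 2 * ((\<integral>\<beta>. mean_field \<beta> \<partial>gibbs) - (\<integral>\<beta>. energy \<beta> - excess \<beta> \<partial>gibbs))"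
    unfolding Q integral_mult_right_zero Bochner_Integration.integral_diff[OF im ih] ..
  then have "(\<integral>\<beta>. energy \<beta> - excess \<beta> \<partial>gibbs) \<le> (\<integral>\<beta>. mean_field \<beta> \<partial>gibbs) + 2 * frobenius2"
    using residual_quadratic_form by (simp add: abs_le_iff)
  then show ?thesis using log_partition_jensen integral_exp_excess[OF assms] by linarith
qed

end

section \<open>The Gibbs variational principle\<close>

context interval_measure
begin

text \<open>
  The measure has a density \<open>r\<close> with a prescribed mean and entropy \<open>\<integral> r ln r \<le> e\<close>. Boundedness
  of \<open>r\<close> and of \<open>ln r\<close> keeps all integrals finite; on the zero set of \<open>r\<close> the second bound is harmless
  because \<open>ln 0 = 0\<close>. Allowing zeros covers point masses at atoms as well as exponential tilts.
\<close>

definition entropy_at_most :: "real \<Rightarrow> real \<Rightarrow> bool" where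
  "entropy_at_most u e \<longleftrightarrow> (\<exists>r C. r \<in> borel_measurable M \<and> (\<forall>z. 0 \<le> r z \<and> r z \<le> C \<and> \<bar>ln (r z)\<bar> \<le> C)
     \<and> (\<integral>z. r z \<partial>M) = 1 \<and> (\<integral>z. r z * z \<partial>M) = u \<and> (\<integral>z. r z * ln (r z) \<partial>M) \<le> e)"

lemma entropy_tilt: "entropy_at_most (texp \<theta> (\<lambda>z. z)) (\<theta> * texp \<theta> (\<lambda>z. z) - logmgf \<theta>)"
  unfolding entropy_at_most_def
proof (intro exI conjI allI)
  \<comment> \<open>The exponential density is extended by constants off the interval, to be globally bounded.\<close>
  let ?k = "\<lambda>z. max (-1) (min 1 z) :: real"
  let ?r = "\<lambda>z. exp (\<theta> * ?k z - logmgf \<theta>)"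
  let ?C = "exp (\<bar>\<theta>\<bar> + \<bar>logmgf \<theta>\<bar>) + (\<bar>\<theta>\<bar> + \<bar>logmgf \<theta>\<bar>)"
  show "?r \<in> borel_measurable M" by measurable
  fix z :: real
  have k: "\<bar>?k z\<bar> \<le> 1" by auto
  have "\<bar>\<theta> * ?k z\<bar> \<le> \<bar>\<theta>\<bar>" using mult_left_le[OF k, of "\<bar>\<theta>\<bar>"] by (simp add: abs_mult)
  then have l: "\<bar>\<theta> * ?k z - logmgf \<theta>\<bar> \<le> \<bar>\<theta>\<bar> + \<bar>logmgf \<theta>\<bar>" by linarith
  then have "?r z \<le> exp (\<bar>\<theta>\<bar> + \<bar>logmgf \<theta>\<bar>)" by (simp add: abs_le_iff)
  then show "?r z \<le> ?C" by linarith
  show "\<bar>ln (?r z)\<bar> \<le> ?C"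
    using l less_imp_le[OF exp_gt_zero[of "\<bar>\<theta>\<bar> + \<bar>logmgf \<theta>\<bar>"]] unfolding ln_exp by linarith
next
  let ?k = "\<lambda>z. max (-1) (min 1 z) :: real"
  let ?r = "\<lambda>z. exp (\<theta> * ?k z - logmgf \<theta>)"
  have r: "(\<integral>z. ?r z * g z \<partial>M) = texp \<theta> g" for g
  proof -
    have "(\<integral>z. ?r z * g z \<partial>M) = (\<integral>z. g z * exp (\<theta> * z) / mgf \<theta> \<partial>M)"
      by (rule Bochner_Integration.integral_cong) (auto simp: space_interval exp_diff exp_logmgf min_def max_def)
    then show ?thesis by (simp add: texp_def)
  qed
  show "(\<integral>z. ?r z \<partial>M) = 1" using r[of "\<lambda>_. 1"] by simp
  show "(\<integral>z. ?r z * z \<partial>M) = texp \<theta> (\<lambda>z. z)" by (rule r)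
  have "(\<integral>z. ?r z * ln (?r z) \<partial>M) = (\<integral>z. ?r z * (\<theta> * z + - logmgf \<theta>) \<partial>M)"
    by (rule Bochner_Integration.integral_cong) (auto simp: space_interval min_def max_def)
  also have "\<dots> = texp \<theta> (\<lambda>z. \<theta> * z + - logmgf \<theta>)" by (rule r)
  also have "\<dots> = \<theta> * texp \<theta> (\<lambda>z. z) - logmgf \<theta>"
    by (subst texp_add[where B = "\<bar>\<theta>\<bar>" and C = "\<bar>logmgf \<theta>\<bar>"])
      (auto simp: texp_cmult abs_mult mult_left_le)
  finally show "(\<integral>z. ?r z * ln (?r z) \<partial>M) \<le> \<theta> * texp \<theta> (\<lambda>z. z) - logmgf \<theta>" by simp
qed simp

lemma entropy_atom:
  assumes x: "\<bar>x\<bar> \<le> 1" and atom: "measure M {x} > 0"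
  shows "entropy_at_most x (- ln (measure M {x}))"
  unfolding entropy_at_most_def
proof (intro exI conjI allI)
  let ?q = "measure M {x}"
  let ?r = "\<lambda>z. indicator {x} z / ?q"
  have sx: "{x} \<in> sets M"
    using x unfolding sets_interval sets_restrict_space by (auto intro!: image_eqI[of _ _ "{x}"])
  have q: "?q \<le> 1" by simp
  show "?r \<in> borel_measurable M" using sx by simp
  fix z :: real
  show "0 \<le> ?r z" by simp
  have lq: "\<bar>ln ?q\<bar> \<ge> 0" "1 / ?q > 0" "ln ?q \<le> 0" using atom q by auto
  have "?r z \<le> 1 / ?q" using atom by (auto simp: indicator_def)
  then show "?r z \<le> 1 / ?q + \<bar>ln ?q\<bar>" using lq(1) by linarith
  show "\<bar>ln (?r z)\<bar> \<le> 1 / ?q + \<bar>ln ?q\<bar>"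
  proof (cases "z = x")
    case True
    then have "ln (?r z) = - ln ?q" using atom by (simp add: ln_div)
    then show ?thesis using lq by linarith
  next
    case False
    then have "ln (?r z) = 0" by simp
    then show ?thesis using lq(1,2) by linarith
  qed
next
  let ?q = "measure M {x}"
  let ?r = "\<lambda>z. indicator {x} z / ?q"
  have sx: "{x} \<in> sets M"
    using x unfolding sets_interval sets_restrict_space by (auto intro!: image_eqI[of _ _ "{x}"])
  have r: "(\<integral>z. ?r z * g z \<partial>M) = g x" for g
  proof -
    have "(\<integral>z. ?r z * g z \<partial>M) = (\<integral>z. indicator {x} z * (g x / ?q) \<partial>M)"
      by (rule Bochner_Integration.integral_cong) (auto simp: indicator_def)
    also have "\<dots> = g x" using sx atom sets.sets_into_space[OF sx] by (simp add: Int_absorb2)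
    finally show ?thesis .
  qed
  show "(\<integral>z. ?r z \<partial>M) = 1" using r[of "\<lambda>_. 1"] by simp
  show "(\<integral>z. ?r z * z \<partial>M) = x" by (rule r)
  show "(\<integral>z. ?r z * ln (?r z) \<partial>M) \<le> - ln ?q"
    unfolding r using atom by (simp add: ln_div)
qed

end

context quadratic_gibbs
begin

text \<open>
  The Gibbs variational principle for the product law with site densities \<open>r i\<close>. Its expected energy is the
  energy of the mean vector, because the energy is multi-affine, and its entropy is the sum of the site entropies. The
  inequality is again the tangent line bound for the exponential, multiplied by the product density; where the density
  vanishes the bound is trivial.
\<close>

lemma variational_lower_bound:
  assumes ent: "\<And>i. i \<in> I \<Longrightarrow> interval_measure.entropy_at_most (\<rho> i) (u i) (e i)"
  shows "energy u - (\<Sum>i\<in>I. e i) \<le> ln partition"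
proof -
  interpret b: prob_space base by (rule prob_base)
  have "\<forall>i. \<exists>r C. i \<in> I \<longrightarrow> r \<in> borel_measurable (\<rho> i) \<and> (\<forall>z. 0 \<le> r z \<and> r z \<le> C \<and> \<bar>ln (r z)\<bar> \<le> C)
     \<and> (\<integral>z. r z \<partial>\<rho> i) = 1 \<and> (\<integral>z. r z * z \<partial>\<rho> i) = u i \<and> (\<integral>z. r z * ln (r z) \<partial>\<rho> i) \<le> e i"
    using ent unfolding interval_measure.entropy_at_most_def[OF site] by blast
  then obtain r C where rm: "\<And>i. i \<in> I \<Longrightarrow> r i \<in> borel_measurable (\<rho> i)"
    and rb: "\<And>i z. i \<in> I \<Longrightarrow> 0 \<le> r i z \<and> r i z \<le> C i \<and> \<bar>ln (r i z)\<bar> \<le> C i"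
    and r1: "\<And>i. i \<in> I \<Longrightarrow> (\<integral>z. r i z \<partial>\<rho> i) = 1"
    and ru: "\<And>i. i \<in> I \<Longrightarrow> (\<integral>z. r i z * z \<partial>\<rho> i) = u i"
    and re: "\<And>i. i \<in> I \<Longrightarrow> (\<integral>z. r i z * ln (r i z) \<partial>\<rho> i) \<le> e i"
    unfolding choice_iff by blast
  define R where "R \<beta> = (\<Prod>i\<in>I. r i (\<beta> i))" for \<beta>
  let ?h = "\<lambda>\<beta>. \<Sum>i\<in>I. ln (r i (\<beta> i))"
  have int_r: "integrable (\<rho> i) (\<lambda>z. r i z * g z)"
    if "i \<in> I" "g \<in> borel_measurable (\<rho> i)" "\<And>z. \<bar>z\<bar> \<le> 1 \<Longrightarrow> \<bar>g z\<bar> \<le> D" for i g D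
  proof (rule interval_measure.integrable_interval[OF site])
    show "(\<lambda>z. r i z * g z) \<in> borel_measurable (\<rho> i)"
      using rm[OF that(1)] that(2) by simp
    fix z :: real assume "\<bar>z\<bar> \<le> 1"
    then show "\<bar>r i z * g z\<bar> \<le> C i * D"
      using rb[OF that(1), of z] that(3)[of z] by (auto simp: abs_mult intro!: mult_mono)
  qed
  have int_r1: "integrable (\<rho> i) (r i)" if "i \<in> I" for i
    using int_r[OF that, of "\<lambda>_. 1" 1] by simp
  have one: "integrable base (\<lambda>\<beta>. R \<beta> * g (\<beta> i)) \<and> (\<integral>\<beta>. R \<beta> * g (\<beta> i) \<partial>base) = (\<integral>z. r i z * g z \<partial>\<rho> i)"
    if "i \<in> I" "integrable (\<rho> i) (\<lambda>z. r i z * g z)" for i g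
  proof -
    let ?f = "\<lambda>k z. r k z * (if k = i then g z else 1)"
    have eq: "R \<beta> * g (\<beta> i) = (\<Prod>k\<in>I. ?f k (\<beta> k))" for \<beta>
    proof -
      have "(\<Prod>k\<in>I. if k = i then g (\<beta> k) else 1) = g (\<beta> i)"
        using prod.delta[OF finite_I, of i "\<lambda>k. g (\<beta> k)"] that(1) by simp
      then show ?thesis unfolding prod.distrib R_def by simp
    qed
    have int: "integrable (\<rho> k) (?f k)" if "k \<in> I" for k
      using int_r1[OF that] \<open>integrable (\<rho> i) _\<close> by (cases "k = i") auto
    have "(\<integral>\<beta>. (\<Prod>k\<in>I. ?f k (\<beta> k)) \<partial>base) = (\<Prod>k\<in>I. \<integral>z. ?f k z \<partial>\<rho> k)"
      by (rule integral_prod_sites) (rule int)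
    also have "\<dots> = (\<Prod>k\<in>I. if k = i then \<integral>z. r i z * g z \<partial>\<rho> i else 1)"
      by (rule prod.cong) (auto simp: r1)
    also have "\<dots> = (\<integral>z. r i z * g z \<partial>\<rho> i)" using finite_I that(1) by simp
    finally show ?thesis unfolding eq
      using product_sigma_finite.product_integrable_prod[OF product_sites finite_I int] by blast
  qed
  have two: "integrable base (\<lambda>\<beta>. R \<beta> * (\<beta> i * \<beta> j)) \<and> (\<integral>\<beta>. R \<beta> * (\<beta> i * \<beta> j) \<partial>base) = u i * u j"
    if ij: "i \<in> I" "j \<in> I" "i \<noteq> j" for i j
  proof -
    let ?f = "\<lambda>k z. r k z * ((if k = i then z else 1) * (if k = j then z else 1))"
    have eq: "R \<beta> * (\<beta> i * \<beta> j) = (\<Prod>k\<in>I. ?f k (\<beta> k))" for \<beta>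
    proof -
      have "(\<Prod>k\<in>I. if k = l then \<beta> k else 1) = \<beta> l" if "l \<in> I" for l
        using prod.delta[OF finite_I, of l \<beta>] that by simp
      then show ?thesis unfolding prod.distrib R_def using ij by simp
    qed
    have int: "integrable (\<rho> k) (?f k)" if "k \<in> I" for k
    proof (rule int_r[OF that, of _ 1])
      show "(\<lambda>z. (if k = i then z else 1) * (if k = j then z else 1)) \<in> borel_measurable (\<rho> k)"
        using interval_measure.measurable_ident_interval[OF site, of k] by simp
    qed (use ij in auto)
    have "(\<integral>\<beta>. (\<Prod>k\<in>I. ?f k (\<beta> k)) \<partial>base) = (\<Prod>k\<in>I. \<integral>z. ?f k z \<partial>\<rho> k)"
      by (rule integral_prod_sites) (rule int)
    also have "\<dots> = (\<Prod>k\<in>I. (if k = i then u i else 1) * (if k = j then u j else 1))"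
      by (rule prod.cong) (use ij in \<open>auto simp: r1 ru\<close>)
    also have "\<dots> = u i * u j"
    proof -
      have "(\<Prod>k\<in>I. if k = l then u l else 1) = u l" if "l \<in> I" for l
        using prod.delta[OF finite_I, of l u] that finite_I by simp
      then show ?thesis unfolding prod.distrib using ij by simp
    qed
    finally show ?thesis unfolding eq
      using product_sigma_finite.product_integrable_prod[OF product_sites finite_I int] by blast
  qed
  have intR: "integrable base R" and R1: "(\<integral>\<beta>. R \<beta> \<partial>base) = 1"
    unfolding R_def using product_sigma_finite.product_integrable_prod[OF product_sites finite_I int_r1]
      integral_prod_sites[OF int_r1] r1 by auto
  have pair: "integrable base (\<lambda>\<beta>. a i j * (R \<beta> * (\<beta> i * \<beta> j)))
      \<and> (\<integral>\<beta>. a i j * (R \<beta> * (\<beta> i * \<beta> j)) \<partial>base) = a i j * (u i * u j)" if "i \<in> I" "j \<in> I" for i j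
    using two[OF that] by (cases "i = j") (auto simp: diag0)
  have lin: "integrable base (\<lambda>\<beta>. R \<beta> * \<beta> i) \<and> (\<integral>\<beta>. R \<beta> * \<beta> i \<partial>base) = u i" if "i \<in> I" for i
    using one[OF that int_r[OF that interval_measure.measurable_ident_interval[OF site], of 1]] ru[OF that] by simp
  have ent': "integrable base (\<lambda>\<beta>. R \<beta> * ln (r i (\<beta> i)))
      \<and> (\<integral>\<beta>. R \<beta> * ln (r i (\<beta> i)) \<partial>base) = (\<integral>z. r i z * ln (r i z) \<partial>\<rho> i)" if "i \<in> I" for i
    by (rule one[OF that int_r[OF that, of _ "C i"]]) (use rm rb that in auto)
  have RE: "R \<beta> * energy \<beta> = 1 / 2 * (\<Sum>i\<in>I. \<Sum>j\<in>I. a i j * (R \<beta> * (\<beta> i * \<beta> j))) + (\<Sum>i\<in>I. c i * (R \<beta> * \<beta> i))" for \<beta>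
    unfolding energy_def by (simp add: distrib_left sum_distrib_left ac_simps)
  have quad: "integrable base (\<lambda>\<beta>. \<Sum>i\<in>I. \<Sum>j\<in>I. a i j * (R \<beta> * (\<beta> i * \<beta> j)))"
    "(\<integral>\<beta>. (\<Sum>i\<in>I. \<Sum>j\<in>I. a i j * (R \<beta> * (\<beta> i * \<beta> j))) \<partial>base) = (\<Sum>i\<in>I. \<Sum>j\<in>I. a i j * (u i * u j))"
  proof -
    have inner: "integrable base (\<lambda>\<beta>. \<Sum>j\<in>I. a i j * (R \<beta> * (\<beta> i * \<beta> j)))"
      "(\<integral>\<beta>. (\<Sum>j\<in>I. a i j * (R \<beta> * (\<beta> i * \<beta> j))) \<partial>base) = (\<Sum>j\<in>I. a i j * (u i * u j))" if i: "i \<in> I" for i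
    proof -
      show "integrable base (\<lambda>\<beta>. \<Sum>j\<in>I. a i j * (R \<beta> * (\<beta> i * \<beta> j)))"
        by (rule Bochner_Integration.integrable_sum) (rule conjunct1[OF pair[OF i]])
      have "(\<integral>\<beta>. (\<Sum>j\<in>I. a i j * (R \<beta> * (\<beta> i * \<beta> j))) \<partial>base)
          = (\<Sum>j\<in>I. \<integral>\<beta>. a i j * (R \<beta> * (\<beta> i * \<beta> j)) \<partial>base)"
        by (rule Bochner_Integration.integral_sum) (rule conjunct1[OF pair[OF i]])
      also have "\<dots> = (\<Sum>j\<in>I. a i j * (u i * u j))"
        by (rule sum.cong[OF refl]) (rule conjunct2[OF pair[OF i]])
      finally show "(\<integral>\<beta>. (\<Sum>j\<in>I. a i j * (R \<beta> * (\<beta> i * \<beta> j))) \<partial>base) = (\<Sum>j\<in>I. a i j * (u i * u j))" .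
    qed
    show "integrable base (\<lambda>\<beta>. \<Sum>i\<in>I. \<Sum>j\<in>I. a i j * (R \<beta> * (\<beta> i * \<beta> j)))"
      by (rule Bochner_Integration.integrable_sum) (rule inner(1))
    have "(\<integral>\<beta>. (\<Sum>i\<in>I. \<Sum>j\<in>I. a i j * (R \<beta> * (\<beta> i * \<beta> j))) \<partial>base)
        = (\<Sum>i\<in>I. \<integral>\<beta>. (\<Sum>j\<in>I. a i j * (R \<beta> * (\<beta> i * \<beta> j))) \<partial>base)"
      by (rule Bochner_Integration.integral_sum) (rule inner(1))
    also have "\<dots> = (\<Sum>i\<in>I. \<Sum>j\<in>I. a i j * (u i * u j))"
      by (rule sum.cong[OF refl]) (rule inner(2))
    finally show "(\<integral>\<beta>. (\<Sum>i\<in>I. \<Sum>j\<in>I. a i j * (R \<beta> * (\<beta> i * \<beta> j))) \<partial>base)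
        = (\<Sum>i\<in>I. \<Sum>j\<in>I. a i j * (u i * u j))" .
  qed
  have line: "integrable base (\<lambda>\<beta>. \<Sum>i\<in>I. c i * (R \<beta> * \<beta> i))"
    "(\<integral>\<beta>. (\<Sum>i\<in>I. c i * (R \<beta> * \<beta> i)) \<partial>base) = (\<Sum>i\<in>I. c i * u i)"
    using lin by (simp_all add: Bochner_Integration.integral_sum)
  have intE: "integrable base (\<lambda>\<beta>. R \<beta> * energy \<beta>)"
    unfolding RE by (intro Bochner_Integration.integrable_add integrable_mult_right quad(1) line(1))
  have E: "(\<integral>\<beta>. R \<beta> * energy \<beta> \<partial>base) = energy u"
    unfolding RE Bochner_Integration.integral_add[OF integrable_mult_right[OF quad(1)] line(1)]
      integral_mult_right_zero quad(2) line(2) by (simp add: energy_def ac_simps)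
  have Rh: "R \<beta> * ?h \<beta> = (\<Sum>i\<in>I. R \<beta> * ln (r i (\<beta> i)))" for \<beta> by (simp add: sum_distrib_left)
  have inth: "integrable base (\<lambda>\<beta>. R \<beta> * ?h \<beta>)"
    and h: "(\<integral>\<beta>. R \<beta> * ?h \<beta> \<partial>base) = (\<Sum>i\<in>I. \<integral>z. r i z * ln (r i z) \<partial>\<rho> i)"
    unfolding Rh using ent' by (auto simp: Bochner_Integration.integral_sum)
  define m where "m = energy u - (\<Sum>i\<in>I. \<integral>z. r i z * ln (r i z) \<partial>\<rho> i)"
  have pt: "exp m * (R \<beta> + (R \<beta> * energy \<beta> - R \<beta> * ?h \<beta>) - m * R \<beta>) \<le> exp (energy \<beta>)" for \<beta>
  proof (cases "R \<beta> = 0")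
    case False
    then have pos: "r i (\<beta> i) > 0" if "i \<in> I" for i
      using that rb[OF that, of "\<beta> i"] finite_I unfolding R_def by (auto simp: less_le)
    have Rexp: "R \<beta> = exp (?h \<beta>)"
      unfolding R_def exp_sum[OF finite_I] using pos by (intro prod.cong) auto
    have "exp m * R \<beta> * (1 + (energy \<beta> - ?h \<beta> - m)) \<le> exp m * R \<beta> * exp (energy \<beta> - ?h \<beta> - m)"
      unfolding Rexp by (intro mult_left_mono exp_ge_add_one_self) auto
    also have "\<dots> = exp (energy \<beta>)" unfolding Rexp by (simp add: exp_add[symmetric])
    finally show ?thesis by (simp add: algebra_simps)
  qed simp
  have "(\<integral>\<beta>. exp m * (R \<beta> + (R \<beta> * energy \<beta> - R \<beta> * ?h \<beta>) - m * R \<beta>) \<partial>base) \<le> partition"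
    unfolding partition_def
    by (intro integral_mono integrable_exp_energy integrable_mult_right Bochner_Integration.integrable_add
        Bochner_Integration.integrable_diff intR intE inth pt)
  also have "(\<integral>\<beta>. exp m * (R \<beta> + (R \<beta> * energy \<beta> - R \<beta> * ?h \<beta>) - m * R \<beta>) \<partial>base) = exp m * (1 + m - m * 1)"
    unfolding m_def E[symmetric] h[symmetric] R1[symmetric]
    by (simp only: integral_mult_right_zero Bochner_Integration.integral_add Bochner_Integration.integral_diff
        Bochner_Integration.integrable_add Bochner_Integration.integrable_diff intR intE inth integrable_mult_right)
  finally have "exp m \<le> partition" by simp
  then have "m \<le> ln partition" using partition_pos by (simp add: ln_ge_iff)
  moreover have "(\<Sum>i\<in>I. \<integral>z. r i z * ln (r i z) \<partial>\<rho> i) \<le> (\<Sum>i\<in>I. e i)" by (rule sum_mono) (rule re)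
  ultimately show ?thesis by (simp add: m_def)
qed

end

section \<open>Tilts of the prior\<close>

text \<open>
  This connects the tilts of the prior in the two parameters, and the functions built from
  them, to one-parameter tilts of the fixed measures \<open>base_tilt d\<close>.
\<close>

locale endpoint_prior = interval_measure \<pi> for \<pi> :: "real measure" +
  assumes left_end: "-1 \<in> support \<pi>" and right_end: "1 \<in> support \<pi>"
begin

lemma integrable_tilt: "integrable \<pi> (\<lambda>z. exp (g * z - d * z\<^sup>2 / 2))"
proof (rule integrable_interval)
  fix z :: real assume z: "\<bar>z\<bar> \<le> 1"
  have "z\<^sup>2 \<le> 1" using z by (simp add: abs_square_le_1)
  then have "\<bar>d * z\<^sup>2\<bar> \<le> \<bar>d\<bar>" by (simp add: abs_mult mult_left_le)
  moreover have "\<bar>g * z\<bar> \<le> \<bar>g\<bar>" using z by (simp add: abs_mult mult_left_le)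
  ultimately have "g * z - d * z\<^sup>2 / 2 \<le> \<bar>g\<bar> + \<bar>d\<bar>" by linarith
  then show "\<bar>exp (g * z - d * z\<^sup>2 / 2)\<bar> \<le> exp (\<bar>g\<bar> + \<bar>d\<bar>)" by simp
qed measurable

lemma exp_cgf: "exp (cgf \<pi> g d) = (\<integral>z. exp (g * z - d * z\<^sup>2 / 2) \<partial>\<pi>)"
proof -
  have "(\<integral>z. exp (g * z - d * z\<^sup>2 / 2) \<partial>\<pi>) \<noteq> 0"
  proof
    assume "(\<integral>z. exp (g * z - d * z\<^sup>2 / 2) \<partial>\<pi>) = 0"
    then have "AE z in \<pi>. exp (g * z - d * z\<^sup>2 / 2) = 0"
      by (subst (asm) integral_nonneg_eq_0_iff_AE[OF integrable_tilt]) auto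
    then have "AE z in \<pi>. False" by simp
    then show False by simp
  qed
  moreover have "(\<integral>z. exp (g * z - d * z\<^sup>2 / 2) \<partial>\<pi>) \<ge> 0" by simp
  ultimately have "(\<integral>z. exp (g * z - d * z\<^sup>2 / 2) \<partial>\<pi>) > 0" by linarith
  then show ?thesis unfolding cgf_def by simp
qed

abbreviation base_tilt :: "real \<Rightarrow> real measure" where
  "base_tilt d \<equiv> tilt \<pi> 0 d"

lemma tilt_ereal: "tilt \<pi> (ereal g) d = density \<pi> (\<lambda>z. ennreal (exp (g * z - d / 2 * z\<^sup>2 - cgf \<pi> g d)))"
  by (simp add: tilt_def)

lemma base_tilt_eq: "base_tilt d = density \<pi> (\<lambda>z. ennreal (exp (- (d / 2 * z\<^sup>2) - cgf \<pi> 0 d)))"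
  unfolding zero_ereal_def tilt_ereal by simp

lemma integral_tilt:
  fixes f :: "real \<Rightarrow> real"
  assumes "f \<in> borel_measurable \<pi>"
  shows "(\<integral>z. f z \<partial>tilt \<pi> (ereal g) d) = (\<integral>z. f z * exp (g * z - d * z\<^sup>2 / 2) \<partial>\<pi>) / exp (cgf \<pi> g d)"
proof -
  have "(\<integral>z. f z \<partial>tilt \<pi> (ereal g) d) = (\<integral>z. exp (g * z - d / 2 * z\<^sup>2 - cgf \<pi> g d) * f z \<partial>\<pi>)"
    unfolding tilt_ereal using assms by (subst integral_density) auto
  also have "\<dots> = (\<integral>z. f z * exp (g * z - d * z\<^sup>2 / 2) / exp (cgf \<pi> g d) \<partial>\<pi>)"
    by (rule Bochner_Integration.integral_cong) (auto simp: exp_diff mult.commute)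
  finally show ?thesis by simp
qed

lemma prob_tilt: "prob_space (tilt \<pi> (ereal g) d)"
proof
  have "emeasure (tilt \<pi> (ereal g) d) (space (tilt \<pi> (ereal g) d))
      = (\<integral>\<^sup>+z. ennreal (exp (g * z - d / 2 * z\<^sup>2 - cgf \<pi> g d)) \<partial>\<pi>)"
    unfolding tilt_ereal by (subst emeasure_density) (auto intro!: nn_integral_cong)
  also have "(\<lambda>z. exp (g * z - d / 2 * z\<^sup>2 - cgf \<pi> g d)) = (\<lambda>z. exp (g * z - d * z\<^sup>2 / 2) / exp (cgf \<pi> g d))"
    by (auto simp: exp_diff)
  also have "(\<integral>\<^sup>+z. ennreal (exp (g * z - d * z\<^sup>2 / 2) / exp (cgf \<pi> g d)) \<partial>\<pi>)
      = ennreal (\<integral>z. exp (g * z - d * z\<^sup>2 / 2) / exp (cgf \<pi> g d) \<partial>\<pi>)"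
    using integrable_tilt by (intro nn_integral_eq_integral) auto
  also have "\<dots> = 1" by (simp add: exp_cgf[symmetric])
  finally show "emeasure (tilt \<pi> (ereal g) d) (space (tilt \<pi> (ereal g) d)) = 1" .
qed

lemma sets_tilt [simp, measurable_cong]: "sets (base_tilt d) = sets \<pi>"
  by (simp add: base_tilt_eq)

lemma space_tilt [simp]: "space (base_tilt d) = space \<pi>"
  by (simp add: base_tilt_eq)

lemma interval_base_tilt: "interval_measure (base_tilt d)"
  using prob_tilt[of 0 d]
  by (auto simp: interval_measure_def interval_measure_axioms_def zero_ereal_def[symmetric] sets_interval)

lemma end_charged:
  assumes s: "s \<in> {1, -1 :: real}" and e: "e > 0"
  shows "emeasure \<pi> {z \<in> space \<pi>. s * z > 1 - e} > 0"
proof -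
  have "open {z. s * z > 1 - e}" by (intro open_Collect_less continuous_intros)
  moreover have "s \<in> {z. s * z > 1 - e}" using s e by auto
  moreover have "s \<in> support \<pi>" using s left_end right_end by auto
  ultimately have "emeasure \<pi> ({z. s * z > 1 - e} \<inter> space \<pi>) > 0" unfolding support_def by blast
  also have "{z. s * z > 1 - e} \<inter> space \<pi> = {z \<in> space \<pi>. s * z > 1 - e}" by auto
  finally show ?thesis .
qed

lemma spread_base_tilt: "spread_interval_measure (base_tilt d)"
proof -
  interpret t: interval_measure "base_tilt d" by (rule interval_base_tilt)
  show ?thesis
  proof
    fix s e :: real assume se: "s \<in> {1, -1}" "e > 0"
    let ?S = "{z \<in> space \<pi>. s * z > 1 - e}"
    have S: "?S \<in> sets \<pi>" by measurable
    have "t.prob ?S \<noteq> 0"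
    proof
      assume "t.prob ?S = 0"
      then have "?S \<in> null_sets (base_tilt d)" using S by (simp add: null_sets_def t.emeasure_eq_measure)
      then have "AE z in \<pi>. z \<in> ?S \<longrightarrow> ennreal (exp (- (d / 2 * z\<^sup>2) - cgf \<pi> 0 d)) = 0"
        unfolding base_tilt_eq by (subst (asm) null_sets_density_iff) auto
      then have "AE z in \<pi>. z \<notin> ?S" by simp
      then have "emeasure \<pi> ?S = 0" using AE_iff_measurable[OF S, of "\<lambda>z. z \<notin> ?S"] by auto
      then show False using end_charged[OF se] by simp
    qed
    then show "t.prob {z \<in> space (base_tilt d). 1 - e < s * z} > 0"
      by (simp add: zero_less_measure_iff)
  qed
qed

sublocale tilted: spread_interval_measure "base_tilt d" for d by (rule spread_base_tilt)

lemma mgf_base_tilt: "tilted.mgf d \<theta> = exp (cgf \<pi> \<theta> d - cgf \<pi> 0 d)"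
proof -
  have "tilted.mgf d \<theta> = (\<integral>z. exp (\<theta> * z) * exp (0 * z - d * z\<^sup>2 / 2) \<partial>\<pi>) / exp (cgf \<pi> 0 d)"
    unfolding tilted.mgf_def unfolding zero_ereal_def by (rule integral_tilt) measurable
  also have "(\<integral>z. exp (\<theta> * z) * exp (0 * z - d * z\<^sup>2 / 2) \<partial>\<pi>) = exp (cgf \<pi> \<theta> d)"
    unfolding exp_cgf by (rule Bochner_Integration.integral_cong) (auto simp flip: exp_add)
  finally show ?thesis by (simp add: exp_diff)
qed

lemma logmgf_base_tilt: "tilted.logmgf d \<theta> = cgf \<pi> \<theta> d - cgf \<pi> 0 d"
  by (simp add: tilted.logmgf_def mgf_base_tilt)

lemma texp_base_tilt:
  assumes "f \<in> borel_measurable \<pi>"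
  shows "tilted.texp d \<theta> f = (\<integral>z. f z \<partial>tilt \<pi> (ereal \<theta>) d)"
proof -
  have "(\<integral>z. f z * exp (\<theta> * z) \<partial>base_tilt d)
      = (\<integral>z. f z * exp (\<theta> * z) * exp (0 * z - d * z\<^sup>2 / 2) \<partial>\<pi>) / exp (cgf \<pi> 0 d)"
    unfolding zero_ereal_def by (rule integral_tilt) (use assms in measurable)
  also have "(\<integral>z. f z * exp (\<theta> * z) * exp (0 * z - d * z\<^sup>2 / 2) \<partial>\<pi>)
      = (\<integral>z. f z * exp (\<theta> * z - d * z\<^sup>2 / 2) \<partial>\<pi>)"
    by (rule Bochner_Integration.integral_cong) (auto simp: mult.assoc simp flip: exp_add)
  finally show ?thesis
    unfolding tilted.texp_def integral_tilt[OF assms] mgf_base_tilt by (simp add: exp_diff)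
qed

abbreviation tmean :: "real \<Rightarrow> real \<Rightarrow> real" where
  "tmean d \<theta> \<equiv> tilted.texp d \<theta> (\<lambda>z. z)"

lemma cgf_dot_eq: "cgf_dot \<pi> \<theta> d = tmean d \<theta>"
proof -
  have "(\<lambda>x. cgf \<pi> x d) = (\<lambda>x. tilted.logmgf d x + cgf \<pi> 0 d)" by (simp add: logmgf_base_tilt)
  moreover have "((\<lambda>x. tilted.logmgf d x + cgf \<pi> 0 d) has_real_derivative tmean d \<theta>) (at \<theta>)"
    by (rule DERIV_cong[OF DERIV_add[OF tilted.DERIV_logmgf DERIV_const]]) simp
  ultimately show ?thesis unfolding cgf_dot_def by (metis DERIV_imp_deriv)
qed

lemma hfun_tmean: "hfun \<pi> (tmean d \<theta>) d = \<theta>"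
  unfolding hfun_def cgf_dot_eq
  using strict_mono_eq[OF tilted.mean_strict_mono[of d]] by (intro the_equality) auto

lemma Gfun_tmean: "Gfun \<pi> (tmean d \<theta>) d = ereal (\<theta> * tmean d \<theta> - tilted.logmgf d \<theta>)"
  using tilted.mean_in_open[of d \<theta>] by (simp add: Gfun_def hfun_tmean logmgf_base_tilt)

lemma hbar_tmean: "hbar \<pi> (tmean d \<theta>) d = ereal \<theta>"
  using tilted.mean_in_open[of d \<theta>] by (simp add: hbar_def hfun_tmean)

text \<open>
  A point mass has finite divergence from \<open>base_tilt d\<close> only if the point is an atom of it, and then the divergence is
  minus the logarithm of the mass of the atom.
\<close>

lemma entropy_Gfun_end:
  assumes x: "x = 1 \<or> x = -1" and fin: "Gfun \<pi> x d \<noteq> \<infinity>"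
  shows "\<exists>e. Gfun \<pi> x d = ereal e \<and> tilted.entropy_at_most d x e"
proof -
  let ?R = "return \<pi> x"
  let ?q = "tilted.prob d {x}"
  have t: "tilt \<pi> (hbar \<pi> x d) d = ?R" using x by (auto simp: hbar_def tilt_def)
  have sx: "{x} \<in> sets \<pi>"
    using x unfolding sets_interval sets_restrict_space by (auto intro!: image_eqI[of _ _ "{x}"])
  have xs: "x \<in> space \<pi>" using x by (auto simp: space_interval)
  have G: "Gfun \<pi> x d = D_KL ?R (base_tilt d)" using x t by (auto simp: Gfun_def)
  have ac: "absolutely_continuous (base_tilt d) ?R"
    and G2: "Gfun \<pi> x d = ereal (KL_divergence (exp 1) (base_tilt d) ?R)"
    using fin unfolding G D_KL_def by (auto split: if_splits)
  have em: "emeasure ?R {x} = 1" using sx by simp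
  have q: "?q > 0"
  proof (rule ccontr)
    assume "\<not> ?q > 0"
    then have "?q = 0" using zero_less_measure_iff by auto
    then have "{x} \<in> null_sets (base_tilt d)" using sx by (simp add: null_sets_def tilted.emeasure_eq_measure)
    then have "{x} \<in> null_sets ?R" using ac unfolding absolutely_continuous_def by blast
    then show False using em by (simp add: null_sets_def)
  qed
  let ?f = "RN_deriv (base_tilt d) ?R"
  have "density (base_tilt d) ?f = ?R"
    by (rule tilted.density_RN_deriv[OF ac]) simp
  then have "1 = emeasure (density (base_tilt d) ?f) {x}" using em by simp
  also have "\<dots> = (\<integral>\<^sup>+z. ?f z * indicator {x} z \<partial>base_tilt d)"
    using sx by (subst emeasure_density) auto
  also have "\<dots> = (\<integral>\<^sup>+z. ?f x * indicator {x} z \<partial>base_tilt d)"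
    by (rule nn_integral_cong) (auto simp: indicator_def)
  also have "\<dots> = ?f x * emeasure (base_tilt d) {x}" using sx by (subst nn_integral_cmult_indicator) auto
  finally have "enn2real (?f x) * ?q = 1"
    by (metis enn2real_1 enn2real_mult measure_def)
  then have f: "enn2real (?f x) = 1 / ?q" using q by (simp add: field_simps)
  have "KL_divergence (exp 1) (base_tilt d) ?R = entropy_density (exp 1) (base_tilt d) ?R x"
  proof -
    have "entropy_density (exp 1) (base_tilt d) ?R \<in> borel_measurable (base_tilt d)"
      by (rule measurable_entropy_density)
    then have "entropy_density (exp 1) (base_tilt d) ?R \<in> borel_measurable \<pi>"
      by (simp add: measurable_cong_sets[OF sets_tilt refl])
    then show ?thesis unfolding KL_divergence_def by (intro integral_return xs)
  qed
  also have "\<dots> = - ln ?q"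
    using q by (simp add: entropy_density_def f log_def ln_div)
  finally show ?thesis unfolding G2 using tilted.entropy_atom[OF _ q] x by auto
qed

lemma entropy_Gfun:
  assumes u: "\<bar>u\<bar> \<le> 1" and fin: "Gfun \<pi> u d \<noteq> \<infinity>"
  shows "\<exists>e. Gfun \<pi> u d = ereal e \<and> tilted.entropy_at_most d u e"
proof (cases "-1 < u \<and> u < 1")
  case True
  then obtain \<theta> where "tmean d \<theta> = u" using tilted.mean_surj by blast
  then show ?thesis using Gfun_tmean[of d \<theta>] tilted.entropy_tilt[of d \<theta>] by auto
next
  case False
  then have "u = 1 \<or> u = -1" using u by auto
  then show ?thesis using entropy_Gfun_end fin by blast
qed

text \<open>
  The integral of \<open>f\<close> under the tilt with mean \<open>u\<close> is almost Lipschitz in \<open>u\<close>, uniformly in \<open>d\<close>. The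
  functions \<open>L z + f z\<close> and \<open>L z - f z\<close> are increasing up to \<open>e\<close>, so their tilted expectations are almost
  increasing in the tilt, and \<open>L\<close> times the mean absorbs the change. At the endpoints, where the tilt is a point
  mass, the same bound follows by integrating the pointwise modulus of continuity of \<open>f\<close>.
\<close>

lemma tilted_integral_stable:
  fixes f :: "real \<Rightarrow> real"
  assumes f: "f \<in> borel_measurable \<pi>" "\<And>z. \<bar>z\<bar> \<le> 1 \<Longrightarrow> \<bar>f z\<bar> \<le> B"
    and mod: "\<And>x y. \<bar>x\<bar> \<le> 1 \<Longrightarrow> \<bar>y\<bar> \<le> 1 \<Longrightarrow> \<bar>f x - f y\<bar> \<le> L * \<bar>x - y\<bar> + e"
    and L: "L \<ge> 0" and u: "\<bar>u\<bar> \<le> 1"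
  shows "\<bar>tilted.texp d \<theta> f - (\<integral>z. f z \<partial>tilt \<pi> (hbar \<pi> u d) d)\<bar> \<le> L * \<bar>tmean d \<theta> - u\<bar> + 2 * e"
proof (cases "-1 < u \<and> u < 1")
  case True
  then obtain \<theta>' where u': "tmean d \<theta>' = u" using tilted.mean_surj by blast
  have I: "(\<integral>z. f z \<partial>tilt \<pi> (hbar \<pi> u d) d) = tilted.texp d \<theta>' f"
    unfolding u'[symmetric] hbar_tmean texp_base_tilt[OF f(1)] ..
  have mf: "f \<in> borel_measurable (base_tilt d)" using f(1) by simp
  have lin: "tilted.texp d t (\<lambda>z. L * z + s * f z) = L * tmean d t + s * tilted.texp d t f"
    if "s \<in> {1, -1}" for s t
    by (subst tilted.texp_add[where B = L and C = B])
      (use mf f(2) L that in \<open>auto simp: tilted.texp_cmult abs_mult mult_left_le\<close>)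
  have one: "s * (tilted.texp d t f - tilted.texp d t' f) \<le> L * (tmean d t' - tmean d t) + 2 * e"
    if le: "t \<le> t'" and s: "s \<in> {1, -1}" for s t t'
  proof -
    have "tilted.texp d t (\<lambda>z. L * z + s * f z) \<le> tilted.texp d t' (\<lambda>z. L * z + s * f z) + 2 * e"
    proof (rule tilted.texp_almost_mono[where B = "L + B"])
      show "(\<lambda>z. L * z + s * f z) \<in> borel_measurable (base_tilt d)" using mf by measurable
      show "\<bar>L * z + s * f z\<bar> \<le> L + B" if z: "\<bar>z\<bar> \<le> 1" for z
      proof -
        have "\<bar>L * z\<bar> \<le> L" using z L by (simp add: abs_mult mult_left_le)
        moreover have "\<bar>s * f z\<bar> \<le> B" using f(2)[OF z] s by auto
        ultimately show ?thesis by linarith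
      qed
      show "L * x + s * f x \<le> L * y + s * f y + e" if "-1 \<le> x" "x \<le> y" "y \<le> 1" for x y
      proof -
        have "\<bar>f x - f y\<bar> \<le> L * (y - x) + e" using mod[of x y] that by auto
        then show ?thesis using s by (auto simp: right_diff_distrib)
      qed
    qed (rule le)
    then show ?thesis unfolding lin[OF s] by (simp add: right_diff_distrib)
  qed
  have mono: "tmean d t \<le> tmean d t'" if "t \<le> t'" for t t'
    using that strict_mono_less_eq[OF tilted.mean_strict_mono[of d]] by blast
  show ?thesis unfolding I unfolding u'[symmetric]
  proof (cases "\<theta> \<le> \<theta>'")
    case True
    then show "\<bar>tilted.texp d \<theta> f - tilted.texp d \<theta>' f\<bar> \<le> L * \<bar>tmean d \<theta> - tmean d \<theta>'\<bar> + 2 * e"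
      using one[OF True, of 1] one[OF True, of "-1"] mono[OF True] by (simp add: abs_le_iff)
  next
    case False
    then have le: "\<theta>' \<le> \<theta>" by simp
    then show "\<bar>tilted.texp d \<theta> f - tilted.texp d \<theta>' f\<bar> \<le> L * \<bar>tmean d \<theta> - tmean d \<theta>'\<bar> + 2 * e"
      using one[OF le, of 1] one[OF le, of "-1"] mono[OF le] by (simp add: abs_le_iff)
  qed
next
  case False
  then have u: "u = 1 \<or> u = -1" using u by auto
  have xs: "u \<in> space \<pi>" using u by (auto simp: space_interval)
  have "tilt \<pi> (hbar \<pi> u d) d = return \<pi> u" using u by (auto simp: hbar_def tilt_def)
  then have I: "(\<integral>z. f z \<partial>tilt \<pi> (hbar \<pi> u d) d) = f u" using integral_return[OF xs f(1)] by simp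
  have e: "e \<ge> 0" using mod[of 0 0] by simp
  have mf: "f \<in> borel_measurable (base_tilt d)" using f(1) by simp
  have uu: "\<bar>u\<bar> \<le> 1" "\<bar>u\<bar> = 1" using u by auto
  have energy_bound: "\<bar>f z - f u\<bar> \<le> L * (1 + (- u) * z) + e" if z: "\<bar>z\<bar> \<le> 1" for z
    using mod[OF z uu(1)] u z by (auto simp: algebra_simps)
  have aff: "tilted.texp d \<theta> (\<lambda>z. (L * (- u)) * z + (L + e)) = L * (1 - u * tmean d \<theta>) + e"
    by (subst tilted.texp_add[where B = L and C = "L + e"])
      (use L e uu in \<open>auto simp: tilted.texp_cmult abs_mult mult_left_le algebra_simps\<close>)
  have one: "s * (tilted.texp d \<theta> f - f u) \<le> L * (1 - u * tmean d \<theta>) + e" if s: "s \<in> {1, -1}" for s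
  proof -
    have "tilted.texp d \<theta> (\<lambda>z. s * f z + - (s * f u)) \<le> tilted.texp d \<theta> (\<lambda>z. (L * (- u)) * z + (L + e))"
    proof (rule tilted.texp_mono[where B = "2 * B" and C = "2 * L + e"])
      fix z :: real assume z: "\<bar>z\<bar> \<le> 1"
      show "\<bar>s * f z + - (s * f u)\<bar> \<le> 2 * B" using f(2)[OF z] f(2)[OF uu(1)] s by auto
      have "\<bar>(L * (- u)) * z\<bar> \<le> L" using z L uu by (simp add: abs_mult mult_left_le)
      then show "\<bar>(L * (- u)) * z + (L + e)\<bar> \<le> 2 * L + e" using L e by linarith
      show "s * f z + - (s * f u) \<le> (L * (- u)) * z + (L + e)"
        using energy_bound[OF z] s by (auto simp: algebra_simps)
    qed (use mf in measurable)
    moreover have "tilted.texp d \<theta> (\<lambda>z. s * f z + - (s * f u)) = s * tilted.texp d \<theta> f - s * f u"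
      by (subst tilted.texp_add[where B = B and C = B])
        (use mf f(2) s uu in \<open>auto simp: tilted.texp_cmult\<close>)
    ultimately show ?thesis unfolding aff by (simp add: right_diff_distrib)
  qed
  have "1 - u * tmean d \<theta> = \<bar>tmean d \<theta> - u\<bar>"
    using u tilted.mean_abs_le[of d \<theta>] by auto
  then show ?thesis unfolding I using one[of 1] one[of "-1"] e by (simp add: abs_le_iff)
qed

end

section \<open>The posterior as a Gibbs measure\<close>

\<comment> \<open>Keeps index sets in the form \<open>{1..p}\<close> under simplification.\<close>
declare One_nat_def [simp del]

text \<open>
  Used to absorb the diagonal part of the Gram matrix into the prior of each coordinate.
\<close>

lemma PiM_density:
  assumes fin: "finite I" and M: "product_sigma_finite M"
    and D: "product_sigma_finite (\<lambda>i. density (M i) (f i))"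
    and f: "\<And>i. i \<in> I \<Longrightarrow> f i \<in> borel_measurable (M i)"
  shows "Pi\<^sub>M I (\<lambda>i. density (M i) (f i)) = density (Pi\<^sub>M I M) (\<lambda>x. \<Prod>i\<in>I. f i (x i))"
proof (rule product_sigma_finite.PiM_eqI[OF D fin, symmetric])
  show "sets (density (Pi\<^sub>M I M) (\<lambda>x. \<Prod>i\<in>I. f i (x i))) = sets (Pi\<^sub>M I (\<lambda>i. density (M i) (f i)))"
    unfolding sets_density by (rule sets_PiM_cong) auto
  fix A assume "\<And>i. i \<in> I \<Longrightarrow> A i \<in> sets (density (M i) (f i))"
  then have A: "A i \<in> sets (M i)" if "i \<in> I" for i using that by simp
  have [measurable]: "(\<lambda>x. f i (x i)) \<in> borel_measurable (Pi\<^sub>M I M)" if "i \<in> I" for i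
    by (rule measurable_compose[OF measurable_component_singleton[OF that, of M] f[OF that]])
  have "emeasure (density (Pi\<^sub>M I M) (\<lambda>x. \<Prod>i\<in>I. f i (x i))) (Pi\<^sub>E I A)
      = (\<integral>\<^sup>+x. (\<Prod>i\<in>I. f i (x i)) * indicator (Pi\<^sub>E I A) x \<partial>Pi\<^sub>M I M)"
    using A fin by (intro emeasure_density sets_PiM_I_finite) auto
  also have "\<dots> = (\<integral>\<^sup>+x. (\<Prod>i\<in>I. f i (x i) * indicator (A i) (x i)) \<partial>Pi\<^sub>M I M)"
  proof (rule nn_integral_cong)
    fix x assume "x \<in> space (Pi\<^sub>M I M)"
    then have "x \<in> extensional I" by (simp add: space_PiM PiE_def)
    then have "indicator (Pi\<^sub>E I A) x = (\<Prod>i\<in>I. indicator (A i) (x i) :: ennreal)"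
      using fin by (cases "x \<in> Pi\<^sub>E I A") (auto simp: PiE_def Pi_def indicator_def prod_zero_iff)
    then show "(\<Prod>i\<in>I. f i (x i)) * indicator (Pi\<^sub>E I A) x = (\<Prod>i\<in>I. f i (x i) * indicator (A i) (x i))"
      by (simp add: prod.distrib)
  qed
  also have "\<dots> = (\<Prod>i\<in>I. \<integral>\<^sup>+z. f i z * indicator (A i) z \<partial>M i)"
    using f A by (intro product_sigma_finite.product_nn_integral_prod[OF M fin]) auto
  also have "\<dots> = (\<Prod>i\<in>I. emeasure (density (M i) (f i)) (A i))"
    using f A by (intro prod.cong) (auto simp: emeasure_density)
  finally show "emeasure (density (Pi\<^sub>M I M) (\<lambda>x. \<Prod>i\<in>I. f i (x i))) (Pi\<^sub>E I A)
      = (\<Prod>i\<in>I. emeasure (density (M i) (f i)) (A i))" .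
qed

text \<open>
  The posterior is the Gibbs measure over the sites \<open>base_tilt (dcoef i)\<close> with matrix
  \<open>- A / \<sigma>\<^sup>2\<close>, where \<open>A\<close> is the off-diagonal part of the Gram matrix, and linear part \<open>z / \<sigma>\<^sup>2\<close>.
\<close>

locale linear_posterior = endpoint_prior \<pi> for \<pi> :: "real measure" +
  fixes \<sigma> :: real and n p :: nat and X :: "nat \<Rightarrow> nat \<Rightarrow> real" and y :: "nat \<Rightarrow> real"
  assumes noise: "\<sigma>\<^sup>2 > 0"
begin

abbreviation dcoef :: "nat \<Rightarrow> real" where "dcoef \<equiv> dvec \<sigma> n X"
abbreviation coupling :: "nat \<Rightarrow> nat \<Rightarrow> real" where "coupling \<equiv> \<lambda>i j. - (offdiag n X i j / \<sigma>\<^sup>2)"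
abbreviation drift :: "nat \<Rightarrow> real" where "drift \<equiv> \<lambda>i. zvec n X y i / \<sigma>\<^sup>2"
abbreviation post :: "(nat \<Rightarrow> real) measure" where "post \<equiv> posterior \<sigma> \<pi> n p X y"

lemma gram_sym: "gram n X i j = gram n X j i"
  by (simp add: gram_def mult.commute)

sublocale q: quadratic_gibbs "{1..p}" "\<lambda>i. base_tilt (dcoef i)" coupling drift
  by standard (auto simp: offdiag_def gram_sym intro: interval_base_tilt)

lemma hamiltonian_eq: "hamiltonian \<sigma> n p X y u = q.energy u"
proof -
  have "(\<Sum>i=1..p. \<Sum>j=1..p. u i * coupling i j * u j) = - (\<Sum>i=1..p. \<Sum>j=1..p. u i * offdiag n X i j * u j) / \<sigma>\<^sup>2"
    by (simp add: sum_negf sum_divide_distrib)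
  moreover have "(\<Sum>i=1..p. drift i * u i) = (\<Sum>i=1..p. zvec n X y i * u i) / \<sigma>\<^sup>2"
    by (simp add: sum_divide_distrib)
  ultimately show ?thesis
    unfolding hamiltonian_def q.energy_def using noise by (simp add: field_simps)
qed

lemma norm_const_eq: "norm_const \<sigma> \<pi> n p X y = q.partition"
  by (simp add: norm_const_def q.partition_def hamiltonian_eq)

definition site_density :: "nat \<Rightarrow> real \<Rightarrow> real" where
  "site_density i z = exp (- (dcoef i / 2 * z\<^sup>2) - cgf \<pi> 0 (dcoef i))"

lemma measurable_site_density [measurable]: "site_density i \<in> borel_measurable \<pi>"
  unfolding site_density_def[abs_def] by measurable

lemma base_tilt_site: "base_tilt (dcoef i) = density \<pi> (\<lambda>z. ennreal (site_density i z))"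
  by (simp add: base_tilt_eq site_density_def)

lemma base_eq: "q.base = density (Pi\<^sub>M {1..p} (\<lambda>_. \<pi>)) (\<lambda>\<beta>. ennreal (\<Prod>i\<in>{1..p}. site_density i (\<beta> i)))"
proof -
  have "q.base = density (Pi\<^sub>M {1..p} (\<lambda>_. \<pi>)) (\<lambda>\<beta>. \<Prod>i\<in>{1..p}. ennreal (site_density i (\<beta> i)))"
    using q.product_sites unfolding base_tilt_site
    by (intro PiM_density) (auto simp: product_sigma_finite_def sigma_finite_measure_axioms)
  also have "(\<lambda>\<beta>. \<Prod>i\<in>{1..p}. ennreal (site_density i (\<beta> i))) = (\<lambda>\<beta>. ennreal (\<Prod>i\<in>{1..p}. site_density i (\<beta> i)))"
    by (intro ext prod_ennreal) (simp add: site_density_def)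
  finally show ?thesis .
qed

text \<open>
  Expanding the square splits the log-likelihood into a constant, the energy, and a quadratic
  function of each single coordinate.
\<close>

lemma likelihood_eq:
  "\<exists>K>0. \<forall>\<beta>. likelihood \<sigma> n p X y \<beta> = K * (exp (q.energy \<beta>) * (\<Prod>i\<in>{1..p}. site_density i (\<beta> i)))"
proof (intro exI conjI allI)
  let ?K = "exp (- (1 / (2 * \<sigma>\<^sup>2)) * (\<Sum>k=1..n. (y k)\<^sup>2)) * exp (\<Sum>i\<in>{1..p}. cgf \<pi> 0 (dcoef i))"
  show "?K > 0" by simp
  fix \<beta> :: "nat \<Rightarrow> real"
  have sq: "(\<Sum>k=1..n. (y k - (\<Sum>j=1..p. X k j * \<beta> j))\<^sup>2)
     = (\<Sum>k=1..n. (y k)\<^sup>2) - 2 * (\<Sum>i=1..p. zvec n X y i * \<beta> i) + (\<Sum>i=1..p. \<Sum>j=1..p. \<beta> i * gram n X i j * \<beta> j)"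
  proof -
    have cross: "(\<Sum>k=1..n. y k * (\<Sum>j=1..p. X k j * \<beta> j)) = (\<Sum>i=1..p. zvec n X y i * \<beta> i)"
      unfolding zvec_def sum_distrib_left sum_distrib_right by (subst sum.swap) (simp add: ac_simps)
    have quad: "(\<Sum>k=1..n. (\<Sum>j=1..p. X k j * \<beta> j)\<^sup>2) = (\<Sum>i=1..p. \<Sum>j=1..p. \<beta> i * gram n X i j * \<beta> j)"
    proof -
      have "(\<Sum>k=1..n. (\<Sum>j=1..p. X k j * \<beta> j)\<^sup>2) = (\<Sum>k=1..n. \<Sum>i=1..p. \<Sum>j=1..p. (X k i * \<beta> i) * (X k j * \<beta> j))"
        by (simp only: power2_eq_square sum_product)
      also have "\<dots> = (\<Sum>i=1..p. \<Sum>k=1..n. \<Sum>j=1..p. (X k i * \<beta> i) * (X k j * \<beta> j))" by (rule sum.swap)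
      also have "\<dots> = (\<Sum>i=1..p. \<Sum>j=1..p. \<Sum>k=1..n. (X k i * \<beta> i) * (X k j * \<beta> j))"
        by (rule sum.cong[OF refl sum.swap])
      also have "\<dots> = (\<Sum>i=1..p. \<Sum>j=1..p. \<beta> i * gram n X i j * \<beta> j)"
        by (intro sum.cong refl) (simp add: gram_def sum_distrib_left sum_distrib_right ac_simps)
      finally show ?thesis .
    qed
    have "(\<Sum>k=1..n. (y k - (\<Sum>j=1..p. X k j * \<beta> j))\<^sup>2)
       = (\<Sum>k=1..n. (y k)\<^sup>2 - 2 * (y k * (\<Sum>j=1..p. X k j * \<beta> j)) + (\<Sum>j=1..p. X k j * \<beta> j)\<^sup>2)"
      by (intro sum.cong refl) (simp add: power2_diff ac_simps)
    also have "\<dots> = (\<Sum>k=1..n. (y k)\<^sup>2) - 2 * (\<Sum>k=1..n. y k * (\<Sum>j=1..p. X k j * \<beta> j))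
        + (\<Sum>k=1..n. (\<Sum>j=1..p. X k j * \<beta> j)\<^sup>2)"
      by (simp only: sum.distrib sum_subtractf sum_distrib_left[symmetric])
    finally show ?thesis unfolding cross quad .
  qed
  have gram: "(\<Sum>i=1..p. \<Sum>j=1..p. \<beta> i * gram n X i j * \<beta> j)
     = (\<Sum>i=1..p. \<Sum>j=1..p. \<beta> i * offdiag n X i j * \<beta> j) + \<sigma>\<^sup>2 * (\<Sum>i=1..p. dcoef i * (\<beta> i)\<^sup>2)"
  proof -
    have "(\<Sum>j=1..p. \<beta> i * gram n X i j * \<beta> j) = (\<Sum>j=1..p. \<beta> i * offdiag n X i j * \<beta> j) + \<sigma>\<^sup>2 * (dcoef i * (\<beta> i)\<^sup>2)"
      if i: "i \<in> {1..p}" for i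
    proof -
      have "(\<Sum>j=1..p. \<beta> i * gram n X i j * \<beta> j)
          = (\<Sum>j=1..p. \<beta> i * offdiag n X i j * \<beta> j + (if i = j then \<sigma>\<^sup>2 * (dcoef i * (\<beta> i)\<^sup>2) else 0))"
        using noise by (intro sum.cong refl) (auto simp: offdiag_def dvec_def diag_def power2_eq_square)
      then show ?thesis using i by (simp add: sum.distrib)
    qed
    then show ?thesis by (simp add: sum.distrib sum_distrib_left)
  qed
  have e: "- (1 / (2 * \<sigma>\<^sup>2)) * (\<Sum>k=1..n. (y k - (\<Sum>j=1..p. X k j * \<beta> j))\<^sup>2)
     = - (1 / (2 * \<sigma>\<^sup>2)) * (\<Sum>k=1..n. (y k)\<^sup>2) + hamiltonian \<sigma> n p X y \<beta> - (\<Sum>i=1..p. dcoef i * (\<beta> i)\<^sup>2) / 2"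
    unfolding sq gram hamiltonian_def using noise by (simp add: field_simps)
  have "(\<Prod>i\<in>{1..p}. site_density i (\<beta> i)) = exp (- (\<Sum>i=1..p. dcoef i * (\<beta> i)\<^sup>2) / 2 - (\<Sum>i\<in>{1..p}. cgf \<pi> 0 (dcoef i)))"
    unfolding site_density_def exp_sum[OF finite_atLeastAtMost, symmetric]
    by (simp add: sum_subtractf sum_negf sum_divide_distrib)
  then show "likelihood \<sigma> n p X y \<beta> = ?K * (exp (q.energy \<beta>) * (\<Prod>i\<in>{1..p}. site_density i (\<beta> i)))"
    unfolding likelihood_def e hamiltonian_eq by (simp add: exp_add[symmetric] algebra_simps)
qed

lemma posterior_eq: "post = q.gibbs"
proof -
  let ?P = "Pi\<^sub>M {1..p} (\<lambda>_. \<pi>)"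
  obtain K where K: "K > 0"
    and l: "\<And>\<beta>. likelihood \<sigma> n p X y \<beta> = K * (exp (q.energy \<beta>) * (\<Prod>i\<in>{1..p}. site_density i (\<beta> i)))"
    using likelihood_eq by blast
  have cong: "sets q.base = sets ?P" by (rule sets_PiM_cong) auto
  have dm: "(\<lambda>\<beta>. site_density i (\<beta> i)) \<in> borel_measurable ?P" if "i \<in> {1..p}" for i
    by (rule measurable_compose[OF measurable_component_singleton[OF that] measurable_site_density])
  have [measurable]: "(\<lambda>\<beta>. \<Prod>i\<in>{1..p}. site_density i (\<beta> i)) \<in> borel_measurable ?P"
    using dm by (rule borel_measurable_prod)
  have [measurable]: "q.energy \<in> borel_measurable ?P"
    using q.measurable_energy by (simp add: measurable_cong_sets[OF cong refl])
  have nn: "(\<Prod>i\<in>{1..p}. site_density i (\<beta> i)) \<ge> 0" for \<beta>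
    by (intro prod_nonneg) (simp add: site_density_def)
  have Z: "(\<integral>\<beta>. likelihood \<sigma> n p X y \<beta> \<partial>?P) = K * q.partition"
  proof -
    have "q.partition = (\<integral>\<beta>. (\<Prod>i\<in>{1..p}. site_density i (\<beta> i)) * exp (q.energy \<beta>) \<partial>?P)"
      unfolding q.partition_def base_eq by (subst integral_density) (auto simp: nn)
    then show ?thesis unfolding l by (simp add: ac_simps)
  qed
  have "q.gibbs = density ?P (\<lambda>\<beta>. ennreal (\<Prod>i\<in>{1..p}. site_density i (\<beta> i)) * ennreal (exp (q.energy \<beta>) / q.partition))"
    unfolding q.gibbs_def unfolding base_eq by (rule density_density_eq) measurable
  also have "\<dots> = post"
    unfolding posterior_def Z
  proof (rule density_cong)
    show "AE \<beta> in ?P. ennreal (\<Prod>i\<in>{1..p}. site_density i (\<beta> i)) * ennreal (exp (q.energy \<beta>) / q.partition)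
        = ennreal (likelihood \<sigma> n p X y \<beta> / (K * q.partition))"
      using K q.partition_pos by (intro AE_I2) (simp add: l ennreal_mult[symmetric] nn field_simps)
    show "(\<lambda>\<beta>. ennreal (likelihood \<sigma> n p X y \<beta> / (K * q.partition))) \<in> borel_measurable ?P"
      unfolding l by measurable
  qed measurable
  finally show ?thesis ..
qed

text \<open>
  A set in the sigma-algebra of the other coordinates has an indicator that does not change with \<open>\<beta> i\<close>, so
  \<open>q.gibbs_resample\<close> verifies the defining property of the conditional expectation.
\<close>

lemma cond_mean_coord:
  assumes i: "i \<in> {1..p}"
  shows "AE \<beta> in post. cond_mean \<sigma> \<pi> n p X y \<beta> i = q.site_mean \<beta> i"
proof -
  let ?P = "Pi\<^sub>M {1..p} (\<lambda>_. \<pi>)" and ?J = "{1..p} - {i}"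
  let ?Q = "Pi\<^sub>M ?J (\<lambda>_. \<pi>)"
  let ?F = "others_algebra \<pi> p i"
  interpret g: prob_space q.gibbs by (rule q.prob_gibbs)
  have cong: "sets q.base = sets ?P" by (rule sets_PiM_cong) auto
  have sp: "space q.base = space ?P" by (rule sets_eq_imp_space_eq[OF cong])
  have restr: "(\<lambda>\<beta>. restrict \<beta> ?J) \<in> measurable ?P ?Q"
    by (rule measurable_restrict_subset) auto
  then have maps: "(\<lambda>\<beta>. restrict \<beta> ?J) \<in> space ?P \<rightarrow> space ?Q" by (auto simp: measurable_def)
  have setsF: "sets ?F = {(\<lambda>\<beta>. restrict \<beta> ?J) -` B \<inter> space ?P | B. B \<in> sets ?Q}"
    unfolding others_algebra_def by (rule sets_vimage_algebra2[OF maps])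
  have sub: "subalgebra q.gibbs ?F"
    unfolding subalgebra_def
  proof
    show "space ?F = space q.gibbs" by (simp add: others_algebra_def sp)
    show "sets ?F \<subseteq> sets q.gibbs"
      unfolding setsF using measurable_sets[OF restr] by (auto simp: cong)
  qed
  interpret F: finite_measure_subalgebra q.gibbs ?F
    by (simp add: finite_measure_subalgebra_def finite_measure_subalgebra_axioms_def sub g.finite_measure_axioms)
  have fieldF: "(\<lambda>\<beta>. q.field \<beta> i) \<in> borel_measurable ?F"
  proof -
    have r: "(\<lambda>\<beta>. restrict \<beta> ?J) \<in> measurable ?F ?Q"
      unfolding others_algebra_def by (rule measurable_vimage_algebra1[OF maps])
    have c: "(\<lambda>\<beta>. \<beta> j) \<in> borel_measurable ?F" if j: "j \<in> ?J" for j
    proof -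
      have "(\<lambda>\<beta>. (restrict \<beta> ?J) j) \<in> measurable ?F \<pi>"
        by (rule measurable_compose[OF r measurable_component_singleton[OF j]])
      then have "(\<lambda>\<beta>. (restrict \<beta> ?J) j) \<in> borel_measurable ?F"
        by (rule measurable_compose[OF _ measurable_ident_interval])
      then show ?thesis using j by simp
    qed
    have "q.field \<beta> i = drift i + (\<Sum>j\<in>?J. coupling i j * \<beta> j)" for \<beta>
      unfolding q.field_def using i by (simp add: sum.remove offdiag_def)
    then show ?thesis using c by simp
  qed
  have meanF: "(\<lambda>\<beta>. q.site_mean \<beta> i) \<in> borel_measurable ?F"
  proof -
    have "continuous_on UNIV (\<lambda>\<theta>. tmean (dcoef i) \<theta>)"
      by (rule continuous_at_imp_continuous_on)
        (use DERIV_isCont[OF tilted.DERIV_texp[of "\<lambda>z. z" _ 1]] in auto)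
    then show ?thesis unfolding q.site_mean_def by (rule borel_measurable_continuous_on) (rule fieldF)
  qed
  have int: "integrable q.gibbs (\<lambda>\<beta>. \<beta> i)" "integrable q.gibbs (\<lambda>\<beta>. q.site_mean \<beta> i)"
    using q.coord_le[OF _ i] q.site_mean_le i
    by (auto intro!: q.integrable_gibbs[where C = 1])
  have "AE \<beta> in q.gibbs. real_cond_exp q.gibbs ?F (\<lambda>\<beta>. \<beta> i) \<beta> = q.site_mean \<beta> i"
  proof (rule F.real_cond_exp_charact[OF _ int meanF])
    fix A assume A: "A \<in> sets ?F"
    then obtain B where B: "B \<in> sets ?Q" "A = (\<lambda>\<beta>. restrict \<beta> ?J) -` B \<inter> space ?P" unfolding setsF by blast
    have As: "A \<in> sets q.gibbs" using A sub by (auto simp: subalgebra_def)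
    have "(\<integral>\<beta>. ((\<lambda>z. z) (\<beta> i) - tmean (dcoef i) (q.field \<beta> i)) * indicator A \<beta> \<partial>q.gibbs) = 0"
    proof (rule q.gibbs_resample[OF i, where B = 1 and C = 1])
      show "indicator A (\<beta>(i := x)) = (indicator A \<beta> :: real)" if "\<beta> \<in> space q.base" "x \<in> {-1..1}" for \<beta> x
      proof -
        have "\<beta>(i := x) \<in> space ?P" "\<beta> \<in> space ?P"
          using q.update_in_space[OF that(1) i that(2)] that(1) by (simp_all add: sp)
        moreover have "restrict (\<beta>(i := x)) ?J = restrict \<beta> ?J" by auto
        ultimately show ?thesis unfolding B(2) indicator_def by simp
      qed
    qed (use As in \<open>auto simp: indicator_def\<close>)
    then have "(\<integral>\<beta>. indicator A \<beta> * \<beta> i - indicator A \<beta> * q.site_mean \<beta> i \<partial>q.gibbs) = 0"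
      by (simp add: q.site_mean_def algebra_simps)
    moreover have "integrable q.gibbs (\<lambda>\<beta>. indicator A \<beta> * \<beta> i)" "integrable q.gibbs (\<lambda>\<beta>. indicator A \<beta> * q.site_mean \<beta> i)"
      using integrable_mult_indicator[OF As int(1)] integrable_mult_indicator[OF As int(2)] by simp_all
    ultimately show "(\<integral>\<beta>\<in>A. \<beta> i \<partial>q.gibbs) = (\<integral>\<beta>\<in>A. q.site_mean \<beta> i \<partial>q.gibbs)"
      unfolding set_lebesgue_integral_def by simp
  qed
  then show ?thesis unfolding cond_mean_def posterior_eq .
qed

lemma cond_mean_eq: "AE \<beta> in post. \<forall>i\<in>{1..p}. cond_mean \<sigma> \<pi> n p X y \<beta> i = q.site_mean \<beta> i"
  by (rule AE_finite_allI[OF finite_atLeastAtMost cond_mean_coord])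

text \<open>
  At a mean produced by the field, the divergence \<open>Gfun\<close> is given explicitly by the field itself.
\<close>

lemma Mfun_site_mean:
  assumes "\<And>i. i \<in> {1..p} \<Longrightarrow> v i = q.site_mean \<beta> i"
  shows "Mfun \<sigma> \<pi> n p X y v = ereal (q.mean_field \<beta>)"
proof -
  have e: "q.energy v = q.energy (q.site_mean \<beta>)"
    unfolding q.energy_def
    by (intro arg_cong2[where f = "(+)"] arg_cong2[where f = "(*)"] sum.cong refl assms)
  have "(\<Sum>i=1..p. Gfun \<pi> (v i) (dcoef i))
      = (\<Sum>i=1..p. ereal (q.site_mean \<beta> i * q.field \<beta> i - tilted.logmgf (dcoef i) (q.field \<beta> i)))"
  proof (rule sum.cong[OF refl])
    fix i assume "i \<in> {1..p}"
    then have v: "v i = tmean (dcoef i) (q.field \<beta> i)" using assms by (simp add: q.site_mean_def)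
    show "Gfun \<pi> (v i) (dcoef i) = ereal (q.site_mean \<beta> i * q.field \<beta> i - tilted.logmgf (dcoef i) (q.field \<beta> i))"
      unfolding v Gfun_tmean by (simp add: q.site_mean_def mult.commute)
  qed
  then show ?thesis unfolding Mfun_def hamiltonian_eq e q.mean_field_def by simp
qed

lemma Mfun_le:
  assumes u: "u \<in> cube p"
  shows "Mfun \<sigma> \<pi> n p X y u \<le> ereal (ln q.partition)"
proof (cases "\<exists>i\<in>{1..p}. Gfun \<pi> (u i) (dcoef i) = \<infinity>")
  case True
  then have "(\<Sum>i=1..p. Gfun \<pi> (u i) (dcoef i)) = \<infinity>" by (simp add: sum_Pinfty)
  then show ?thesis unfolding Mfun_def by simp
next
  case False
  have "\<forall>i\<in>{1..p}. \<exists>e. Gfun \<pi> (u i) (dcoef i) = ereal e \<and> tilted.entropy_at_most (dcoef i) (u i) e"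
  proof
    fix i assume i: "i \<in> {1..p}"
    then have "\<bar>u i\<bar> \<le> 1" using u by (auto simp: cube_def abs_le_iff dest: PiE_mem)
    then show "\<exists>e. Gfun \<pi> (u i) (dcoef i) = ereal e \<and> tilted.entropy_at_most (dcoef i) (u i) e"
      using False i by (intro entropy_Gfun) auto
  qed
  then obtain e where e: "\<And>i. i \<in> {1..p} \<Longrightarrow> Gfun \<pi> (u i) (dcoef i) = ereal (e i)"
    "\<And>i. i \<in> {1..p} \<Longrightarrow> tilted.entropy_at_most (dcoef i) (u i) (e i)" by metis
  have "q.energy u - (\<Sum>i=1..p. e i) \<le> ln q.partition" by (rule q.variational_lower_bound) (rule e(2))
  moreover have "(\<Sum>i=1..p. Gfun \<pi> (u i) (dcoef i)) = ereal (\<Sum>i=1..p. e i)"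
    unfolding sum_ereal[symmetric] by (rule sum.cong[OF refl]) (rule e(1))
  ultimately show ?thesis unfolding Mfun_def hamiltonian_eq by simp
qed

definition opt_value :: real where "opt_value = real_of_ereal (Rfun \<sigma> \<pi> n p X y)"

lemma mean_field_le_Rfun: "ereal (q.mean_field \<beta>) \<le> Rfun \<sigma> \<pi> n p X y"
proof -
  let ?v = "restrict (q.site_mean \<beta>) {1..p}"
  have "?v \<in> cube p" using q.site_mean_le[of \<beta>] by (auto simp: cube_def abs_le_iff)
  then have "Mfun \<sigma> \<pi> n p X y ?v \<le> Rfun \<sigma> \<pi> n p X y" unfolding Rfun_def by (rule SUP_upper)
  then show ?thesis using Mfun_site_mean[of ?v \<beta>] by simp
qed

lemma Rfun_real: "Rfun \<sigma> \<pi> n p X y = ereal opt_value"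
  and opt_value_le: "opt_value \<le> ln q.partition"
  and mean_field_le_opt_value: "q.mean_field \<beta> \<le> opt_value"
proof -
  have up: "Rfun \<sigma> \<pi> n p X y \<le> ereal (ln q.partition)" unfolding Rfun_def by (rule SUP_least) (rule Mfun_le)
  have low: "ereal (q.mean_field \<beta>) \<le> Rfun \<sigma> \<pi> n p X y" for \<beta> by (rule mean_field_le_Rfun)
  show R: "Rfun \<sigma> \<pi> n p X y = ereal opt_value"
    unfolding opt_value_def using up low[of undefined] by (cases "Rfun \<sigma> \<pi> n p X y") auto
  show "opt_value \<le> ln q.partition" "q.mean_field \<beta> \<le> opt_value" using up low[of \<beta>] unfolding R by auto
qed

text \<open>
  The error in the comparison of the log-partition function with the expected mean-field value; \<open>\<tau>\<close> and
  \<open>\<delta>\<close> are the scale of the sign vectors and the slack in bounding absolute values by squares.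
\<close>

definition gap_bound :: "real \<Rightarrow> real \<Rightarrow> real" where
  "gap_bound \<tau> \<delta> = 2 * q.frobenius2 + real p / \<tau> + real p * \<delta> + \<tau>\<^sup>2 * q.frobenius2 / \<delta>"

lemma integrable_mean_field: "integrable q.gibbs q.mean_field"
  by (rule q.integrable_gibbs[OF _ q.mean_field_le]) auto

lemma expected_mean_field_le: "(\<integral>\<beta>. q.mean_field \<beta> \<partial>q.gibbs) \<le> opt_value"
proof -
  interpret g: prob_space q.gibbs by (rule q.prob_gibbs)
  have "(\<integral>\<beta>. q.mean_field \<beta> \<partial>q.gibbs) \<le> (\<integral>\<beta>. opt_value \<partial>q.gibbs)"
    by (intro integral_mono integrable_mean_field mean_field_le_opt_value) simp
  then show ?thesis by simp
qed

lemma log_partition_gap: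
  assumes "\<tau> \<ge> 1" "\<delta> > 0"
  shows "ln q.partition \<le> (\<integral>\<beta>. q.mean_field \<beta> \<partial>q.gibbs) + gap_bound \<tau> \<delta>"
  using q.log_partition_le_mean_field[OF assms] by (simp add: gap_bound_def)

text \<open>
  The variable \<open>opt_value - q.mean_field \<beta>\<close> is nonnegative with expectation at most the gap, so Markov's
  inequality applies.
\<close>

lemma mean_field_deviation:
  assumes "\<tau> \<ge> 1" "\<delta> > 0" and t: "t > 0"
  shows "measure q.gibbs {\<beta> \<in> space q.base. q.mean_field \<beta> \<le> opt_value - t} \<le> gap_bound \<tau> \<delta> / t"
proof -
  interpret g: prob_space q.gibbs by (rule q.prob_gibbs)
  have int: "integrable q.gibbs (\<lambda>\<beta>. opt_value - q.mean_field \<beta>)"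
    by (intro Bochner_Integration.integrable_diff integrable_mean_field) simp
  have "measure q.gibbs {\<beta> \<in> space q.gibbs. t \<le> opt_value - q.mean_field \<beta>} \<le> (\<integral>\<beta>. opt_value - q.mean_field \<beta> \<partial>q.gibbs) / t"
    by (rule integral_Markov_inequality_measure[OF int, where A = "space q.gibbs"]) (use t mean_field_le_opt_value in auto)
  also have "(\<integral>\<beta>. opt_value - q.mean_field \<beta> \<partial>q.gibbs) = opt_value - (\<integral>\<beta>. q.mean_field \<beta> \<partial>q.gibbs)"
    using integrable_mean_field by simp
  also have "\<dots> / t \<le> gap_bound \<tau> \<delta> / t"
    using log_partition_gap[OF assms(1,2)] opt_value_le t by (intro divide_right_mono) auto
  finally show ?thesis by (simp add: le_diff_eq add.commute)
qed

lemma residual_deviation: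
  assumes f: "\<And>i. i \<in> {1..p} \<Longrightarrow> f i \<in> borel_measurable \<pi>" "\<And>i z. i \<in> {1..p} \<Longrightarrow> \<bar>z\<bar> \<le> 1 \<Longrightarrow> \<bar>f i z\<bar> \<le> B"
    and B: "B \<ge> 0" and t: "t > 0" and \<delta>: "\<delta> > 0"
  shows "measure q.gibbs {\<beta> \<in> space q.base. \<bar>\<Sum>i\<in>{1..p}. q.residual f \<beta> i\<bar> \<ge> t}
     \<le> 4 * B\<^sup>2 * (real p + (real p)\<^sup>2 * \<delta> + q.frobenius2 / \<delta>) / t\<^sup>2"
proof -
  interpret g: prob_space q.gibbs by (rule q.prob_gibbs)
  let ?S = "\<lambda>\<beta>. \<Sum>i\<in>{1..p}. q.residual f \<beta> i"
  have f': "f i \<in> borel_measurable (base_tilt (dcoef i))" if "i \<in> {1..p}" for i using f(1)[OF that] by simp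
  have [measurable]: "(\<lambda>\<beta>. q.residual f \<beta> k) \<in> borel_measurable q.base" if "k \<in> {1..p}" for k
    by (rule q.measurable_residual[where B = B]) (use f' f(2) that in auto)
  have Sb: "\<bar>?S \<beta>\<bar> \<le> real p * (2 * B)" if "\<beta> \<in> space q.base" for \<beta>
  proof -
    have "\<bar>?S \<beta>\<bar> \<le> (\<Sum>i\<in>{1..p}. 2 * B)"
      by (intro sum_abs_le_sum q.residual_le[OF _ f' f(2)]) (use that in auto)
    then show ?thesis by simp
  qed
  have int: "integrable q.gibbs (\<lambda>\<beta>. (?S \<beta>)\<^sup>2)"
  proof (rule q.integrable_gibbs)
    show "(\<lambda>\<beta>. (?S \<beta>)\<^sup>2) \<in> borel_measurable q.base" by measurable
    fix \<beta> assume "\<beta> \<in> space q.base"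
    from power_mono[OF Sb[OF this] abs_ge_zero, of 2]
    show "\<bar>(?S \<beta>)\<^sup>2\<bar> \<le> (real p * (2 * B))\<^sup>2" by simp
  qed
  have set: "{\<beta> \<in> space q.base. \<bar>?S \<beta>\<bar> \<ge> t} = {\<beta> \<in> space q.gibbs. t\<^sup>2 \<le> (?S \<beta>)\<^sup>2}"
  proof -
    have "t \<le> \<bar>x\<bar> \<longleftrightarrow> t\<^sup>2 \<le> x\<^sup>2" for x :: real using t abs_le_square_iff[of t x] by simp
    then show ?thesis unfolding q.space_gibbs by blast
  qed
  have "measure q.gibbs {\<beta> \<in> space q.base. \<bar>?S \<beta>\<bar> \<ge> t} \<le> (\<integral>\<beta>. (?S \<beta>)\<^sup>2 \<partial>q.gibbs) / t\<^sup>2"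
    unfolding set
    by (rule integral_Markov_inequality_measure[OF int, where A = "space q.gibbs"]) (use t in auto)
  also have "\<dots> \<le> 4 * B\<^sup>2 * (real p + (real p)\<^sup>2 * \<delta> + q.frobenius2 / \<delta>) / t\<^sup>2"
  proof (rule divide_right_mono)
    have "\<bar>x\<bar> \<le> \<delta> + x\<^sup>2 / \<delta>" for x :: real
      using young_abs[OF \<delta>, of x] by linarith
    then have "(\<Sum>i\<in>{1..p}. \<Sum>j\<in>{1..p}. \<bar>coupling i j\<bar>) \<le> (\<Sum>i\<in>{1..p}. \<Sum>j\<in>{1..p}. \<delta> + (coupling i j)\<^sup>2 / \<delta>)"
      by (intro sum_mono)
    also have "\<dots> = (real p)\<^sup>2 * \<delta> + q.frobenius2 / \<delta>"
      by (simp add: sum.distrib q.frobenius2_def sum_divide_distrib power2_eq_square[of "real p"])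
    finally have "4 * B\<^sup>2 * (real p + (\<Sum>i\<in>{1..p}. \<Sum>j\<in>{1..p}. \<bar>coupling i j\<bar>))
        \<le> 4 * B\<^sup>2 * (real p + (real p)\<^sup>2 * \<delta> + q.frobenius2 / \<delta>)"
      by (intro mult_left_mono) auto
    moreover have "(\<integral>\<beta>. (?S \<beta>)\<^sup>2 \<partial>q.gibbs) \<le> 4 * B\<^sup>2 * (real (card {1..p}) + (\<Sum>i\<in>{1..p}. \<Sum>j\<in>{1..p}. \<bar>coupling i j\<bar>))"
      by (rule q.residual_sum_second_moment) (use f' f(2) B in auto)
    ultimately show "(\<integral>\<beta>. (?S \<beta>)\<^sup>2 \<partial>q.gibbs) \<le> 4 * B\<^sup>2 * (real p + (real p)\<^sup>2 * \<delta> + q.frobenius2 / \<delta>)"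
      by simp
  qed simp
  finally show ?thesis .
qed

lemma Mfun_cond_mean_deviation:
  assumes "\<tau> \<ge> 1" "\<delta> > 0" "t > 0"
  shows "measure post {\<beta> \<in> space post. Mfun \<sigma> \<pi> n p X y (cond_mean \<sigma> \<pi> n p X y \<beta>)
      < Rfun \<sigma> \<pi> n p X y - ereal t} \<le> gap_bound \<tau> \<delta> / t"
proof -
  interpret g: prob_space q.gibbs by (rule q.prob_gibbs)
  have "measure q.gibbs {\<beta> \<in> space q.gibbs. Mfun \<sigma> \<pi> n p X y (cond_mean \<sigma> \<pi> n p X y \<beta>)
      < Rfun \<sigma> \<pi> n p X y - ereal t} \<le> measure q.gibbs {\<beta> \<in> space q.base. q.mean_field \<beta> \<le> opt_value - t}"
  proof (rule g.finite_measure_mono_AE)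
    show "AE \<beta> in q.gibbs. \<beta> \<in> {\<beta> \<in> space q.gibbs. Mfun \<sigma> \<pi> n p X y (cond_mean \<sigma> \<pi> n p X y \<beta>)
      < Rfun \<sigma> \<pi> n p X y - ereal t} \<longrightarrow> \<beta> \<in> {\<beta> \<in> space q.base. q.mean_field \<beta> \<le> opt_value - t}"
      using cond_mean_eq unfolding posterior_eq
    proof eventually_elim
      case (elim \<beta>)
      then have "Mfun \<sigma> \<pi> n p X y (cond_mean \<sigma> \<pi> n p X y \<beta>) = ereal (q.mean_field \<beta>)"
        by (intro Mfun_site_mean) auto
      then show ?case by (simp add: Rfun_real)
    qed
  qed measurable
  also have "\<dots> \<le> gap_bound \<tau> \<delta> / t" by (rule mean_field_deviation[OF assms])
  finally show ?thesis unfolding posterior_eq .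
qed

text \<open>
  A point with nearly optimal mean-field value has conditional means close to \<open>uhat\<close>. By stability of
  tilted integrals, the conditional expectations of \<open>f i (\<beta> i)\<close> are then close on average to the integrals for \<open>uhat\<close>, so a large
  deviation must come from the residuals.
\<close>

lemma empirical_event_subset:
  assumes p: "p > 0" and uhat: "uhat \<in> cube p"
    and f: "\<And>i. i \<in> {1..p} \<Longrightarrow> f i \<in> borel_measurable \<pi>" "\<And>i z. i \<in> {1..p} \<Longrightarrow> \<bar>z\<bar> \<le> 1 \<Longrightarrow> \<bar>f i z\<bar> \<le> B"
    and mod: "\<And>i x z. i \<in> {1..p} \<Longrightarrow> \<bar>x\<bar> \<le> 1 \<Longrightarrow> \<bar>z\<bar> \<le> 1 \<Longrightarrow> \<bar>f i x - f i z\<bar> \<le> L * \<bar>x - z\<bar> + e"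
    and L: "L \<ge> 0" and \<delta>: "\<delta> > 0"
    and far: "\<And>u. u \<in> cube p \<Longrightarrow> (\<Sum>i=1..p. (u i - uhat i)\<^sup>2) \<ge> real p * \<delta>\<^sup>2 \<Longrightarrow>
      Mfun \<sigma> \<pi> n p X y u \<le> ereal (opt_value - real p * \<kappa>)"
    and \<beta>: "\<beta> \<in> space q.base"
    and dev: "\<bar>1 / real p * (\<Sum>i=1..p. f i (\<beta> i))
        - 1 / real p * (\<Sum>i=1..p. \<integral>z. f i z \<partial>tilt \<pi> (hbar \<pi> (uhat i) (dcoef i)) (dcoef i))\<bar> > t + 2 * e + 2 * L * \<delta>"
  shows "\<bar>\<Sum>i\<in>{1..p}. q.residual f \<beta> i\<bar> \<ge> real p * t \<or> q.mean_field \<beta> \<le> opt_value - real p * \<kappa>"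
proof (rule ccontr)
  assume "\<not> ?thesis"
  then have res: "\<bar>\<Sum>i\<in>{1..p}. q.residual f \<beta> i\<bar> < real p * t"
    and me: "q.mean_field \<beta> > opt_value - real p * \<kappa>" by auto
  let ?m = "q.site_mean \<beta>"
  let ?v = "restrict ?m {1..p}"
  let ?I = "\<lambda>i. \<integral>z. f i z \<partial>tilt \<pi> (hbar \<pi> (uhat i) (dcoef i)) (dcoef i)"
  have v: "?v \<in> cube p" using q.site_mean_le[of \<beta>] by (auto simp: cube_def abs_le_iff)
  have Mv: "Mfun \<sigma> \<pi> n p X y ?v = ereal (q.mean_field \<beta>)" by (rule Mfun_site_mean) simp
  have "(\<Sum>i=1..p. (?v i - uhat i)\<^sup>2) < real p * \<delta>\<^sup>2"
  proof (rule ccontr)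
    assume "\<not> ?thesis"
    then have "Mfun \<sigma> \<pi> n p X y ?v \<le> ereal (opt_value - real p * \<kappa>)" using far[OF v] by simp
    then show False using me unfolding Mv by simp
  qed
  then have near: "(\<Sum>i=1..p. (?m i - uhat i)\<^sup>2) < real p * \<delta>\<^sup>2" by simp
  have "(\<Sum>i=1..p. \<bar>?m i - uhat i\<bar>) \<le> (\<Sum>i=1..p. \<delta> + (?m i - uhat i)\<^sup>2 / \<delta>)"
    using young_abs[OF \<delta>] by (intro sum_mono) (smt (verit) abs_ge_zero)
  also have "\<dots> = real p * \<delta> + (\<Sum>i=1..p. (?m i - uhat i)\<^sup>2) / \<delta>"
    by (simp add: sum.distrib sum_divide_distrib)
  also have "\<dots> \<le> real p * \<delta> + real p * \<delta>\<^sup>2 / \<delta>"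
    using near \<delta> by (intro add_left_mono divide_right_mono) auto
  also have "\<dots> = 2 * real p * \<delta>" using \<delta> by (simp add: power2_eq_square[of \<delta>])
  finally have l1: "(\<Sum>i=1..p. \<bar>?m i - uhat i\<bar>) \<le> 2 * real p * \<delta>" .
  have "\<bar>\<Sum>i=1..p. tilted.texp (dcoef i) (q.field \<beta> i) (f i) - ?I i\<bar> \<le> (\<Sum>i=1..p. L * \<bar>?m i - uhat i\<bar> + 2 * e)"
  proof (rule sum_abs_le_sum)
    fix i assume i: "i \<in> {1..p}"
    have "\<bar>uhat i\<bar> \<le> 1" using uhat i by (auto simp: cube_def abs_le_iff dest: PiE_mem)
    then show "\<bar>tilted.texp (dcoef i) (q.field \<beta> i) (f i) - ?I i\<bar> \<le> L * \<bar>?m i - uhat i\<bar> + 2 * e"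
      unfolding q.site_mean_def by (intro tilted_integral_stable[OF f(1)[OF i] f(2)[OF i] mod[OF i] L])
  qed
  also have "\<dots> = L * (\<Sum>i=1..p. \<bar>?m i - uhat i\<bar>) + real p * (2 * e)"
    by (simp add: sum.distrib sum_distrib_left)
  also have "\<dots> \<le> L * (2 * real p * \<delta>) + real p * (2 * e)"
    using l1 L by (intro add_right_mono mult_left_mono)
  finally have l2: "\<bar>\<Sum>i=1..p. tilted.texp (dcoef i) (q.field \<beta> i) (f i) - ?I i\<bar> \<le> L * (2 * real p * \<delta>) + real p * (2 * e)" .
  have "(\<Sum>i=1..p. f i (\<beta> i)) - (\<Sum>i=1..p. ?I i)
      = (\<Sum>i\<in>{1..p}. q.residual f \<beta> i) + (\<Sum>i=1..p. tilted.texp (dcoef i) (q.field \<beta> i) (f i) - ?I i)"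
    by (simp add: q.residual_def sum_subtractf)
  then have "\<bar>(\<Sum>i=1..p. f i (\<beta> i)) - (\<Sum>i=1..p. ?I i)\<bar> \<le> real p * (t + 2 * e + 2 * L * \<delta>)"
    using res l2 by (simp add: algebra_simps)
  then have "\<bar>(\<Sum>i=1..p. f i (\<beta> i)) - (\<Sum>i=1..p. ?I i)\<bar> / real p \<le> t + 2 * e + 2 * L * \<delta>"
    using p by (simp add: field_simps)
  moreover have "\<bar>1 / real p * (\<Sum>i=1..p. f i (\<beta> i)) - 1 / real p * (\<Sum>i=1..p. ?I i)\<bar>
      = \<bar>(\<Sum>i=1..p. f i (\<beta> i)) - (\<Sum>i=1..p. ?I i)\<bar> / real p"
  proof -
    have "\<bar>1 / real p * x - 1 / real p * w\<bar> = \<bar>x - w\<bar> / real p" for x w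
      using p by (simp flip: diff_divide_distrib)
    then show ?thesis .
  qed
  ultimately show False using dev by linarith
qed

lemma empirical_deviation:
  assumes p: "p > 0" and uhat: "uhat \<in> cube p"
    and f: "\<And>i. i \<in> {1..p} \<Longrightarrow> f i \<in> borel_measurable \<pi>" "\<And>i z. i \<in> {1..p} \<Longrightarrow> \<bar>z\<bar> \<le> 1 \<Longrightarrow> \<bar>f i z\<bar> \<le> B"
    and mod: "\<And>i x z. i \<in> {1..p} \<Longrightarrow> \<bar>x\<bar> \<le> 1 \<Longrightarrow> \<bar>z\<bar> \<le> 1 \<Longrightarrow> \<bar>f i x - f i z\<bar> \<le> L * \<bar>x - z\<bar> + e"
    and L: "L \<ge> 0" and \<delta>: "\<delta> > 0"
    and far: "\<And>u. u \<in> cube p \<Longrightarrow> (\<Sum>i=1..p. (u i - uhat i)\<^sup>2) \<ge> real p * \<delta>\<^sup>2 \<Longrightarrow>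
      Mfun \<sigma> \<pi> n p X y u \<le> ereal (opt_value - real p * \<kappa>)"
    and B: "B \<ge> 0" and t: "t > 0" and \<kappa>: "\<kappa> > 0" and \<tau>: "\<tau> \<ge> 1" and \<eta>: "\<eta> > 0" and \<xi>: "\<xi> > 0"
  shows "measure post {\<beta> \<in> space post. \<bar>1 / real p * (\<Sum>i=1..p. f i (\<beta> i))
        - 1 / real p * (\<Sum>i=1..p. \<integral>z. f i z \<partial>tilt \<pi> (hbar \<pi> (uhat i) (dcoef i)) (dcoef i))\<bar> > t + 2 * e + 2 * L * \<delta>}
     \<le> 4 * B\<^sup>2 * (real p + (real p)\<^sup>2 * \<xi> + q.frobenius2 / \<xi>) / (real p * t)\<^sup>2 + gap_bound \<tau> \<eta> / (real p * \<kappa>)"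
proof -
  let ?dev = "\<lambda>\<beta>. \<bar>1 / real p * (\<Sum>i=1..p. f i (\<beta> i))
      - 1 / real p * (\<Sum>i=1..p. \<integral>z. f i z \<partial>tilt \<pi> (hbar \<pi> (uhat i) (dcoef i)) (dcoef i))\<bar>"
  interpret g: prob_space q.gibbs by (rule q.prob_gibbs)
  let ?A = "{\<beta> \<in> space q.base. \<bar>\<Sum>i\<in>{1..p}. q.residual f \<beta> i\<bar> \<ge> real p * t}"
  let ?C = "{\<beta> \<in> space q.base. q.mean_field \<beta> \<le> opt_value - real p * \<kappa>}"
  have f': "f i \<in> borel_measurable (base_tilt (dcoef i))" if "i \<in> {1..p}" for i using f(1)[OF that] by simp
  have mV: "(\<lambda>\<beta>. q.residual f \<beta> k) \<in> borel_measurable q.base" if "k \<in> {1..p}" for k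
    by (rule q.measurable_residual[where B = B]) (use f' f(2) that in auto)
  have mS: "(\<lambda>\<beta>. \<bar>\<Sum>i\<in>{1..p}. q.residual f \<beta> i\<bar>) \<in> borel_measurable q.base"
    by (rule borel_measurable_abs[OF borel_measurable_sum[OF mV]])
  have A: "?A \<in> sets q.gibbs"
    unfolding q.sets_gibbs by (rule borel_measurable_le[OF borel_measurable_const mS])
  have C: "?C \<in> sets q.gibbs"
    unfolding q.sets_gibbs by (rule borel_measurable_le[OF q.measurable_mean_field borel_measurable_const])
  have "measure q.gibbs {\<beta> \<in> space q.gibbs. ?dev \<beta> > t + 2 * e + 2 * L * \<delta>}
      \<le> measure q.gibbs (?A \<union> ?C)"
  proof (rule g.finite_measure_mono)
    show "{\<beta> \<in> space q.gibbs. ?dev \<beta> > t + 2 * e + 2 * L * \<delta>}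
      \<subseteq> ?A \<union> ?C"
    proof (rule subsetI, elim CollectE conjE)
      fix \<beta> assume "\<beta> \<in> space q.gibbs"
        and dev: "t + 2 * e + 2 * L * \<delta> < ?dev \<beta>"
      then have \<beta>: "\<beta> \<in> space q.base" by simp
      show "\<beta> \<in> ?A \<union> ?C"
      proof (cases "q.mean_field \<beta> \<le> opt_value - real p * \<kappa>")
        case True
        then show ?thesis using \<beta> by simp
      next
        case False
        moreover have "\<bar>\<Sum>i\<in>{1..p}. q.residual f \<beta> i\<bar> \<ge> real p * t \<or> q.mean_field \<beta> \<le> opt_value - real p * \<kappa>"
          by (rule empirical_event_subset[OF p uhat f mod L \<delta> far \<beta> dev])
        ultimately show ?thesis using \<beta> by simp
      qed
    qed
  qed (rule sets.Un[OF A C])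
  also have "\<dots> \<le> measure q.gibbs ?A + measure q.gibbs ?C" by (rule measure_Un_le[OF A C])
  also have "\<dots> \<le> 4 * B\<^sup>2 * (real p + (real p)\<^sup>2 * \<xi> + q.frobenius2 / \<xi>) / (real p * t)\<^sup>2 + gap_bound \<tau> \<eta> / (real p * \<kappa>)"
  proof (rule add_mono)
    have pt: "real p * t > 0" and pk: "real p * \<kappa> > 0" using p t \<kappa> by simp_all
    show "measure q.gibbs ?A \<le> 4 * B\<^sup>2 * (real p + (real p)\<^sup>2 * \<xi> + q.frobenius2 / \<xi>) / (real p * t)\<^sup>2"
      by (rule residual_deviation[OF f B pt \<xi>])
    show "measure q.gibbs ?C \<le> gap_bound \<tau> \<eta> / (real p * \<kappa>)"
      by (rule mean_field_deviation[OF \<tau> \<eta> pk])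
  qed
  finally show ?thesis unfolding posterior_eq .
qed

lemma frobenius2_eq:
  "q.frobenius2 = mat_trace p (mat_prod p (offdiag n X) (offdiag n X)) / (\<sigma>\<^sup>2)\<^sup>2"
proof -
  have "offdiag n X i k * offdiag n X k i = (offdiag n X i k)\<^sup>2" for i k
    by (simp add: offdiag_def gram_sym[of k i] power2_eq_square)
  then have "mat_trace p (mat_prod p (offdiag n X) (offdiag n X)) = (\<Sum>i=1..p. \<Sum>j=1..p. (offdiag n X i j)\<^sup>2)"
    by (simp add: mat_trace_def mat_prod_def)
  moreover have "q.frobenius2 = (\<Sum>i=1..p. \<Sum>j=1..p. (offdiag n X i j)\<^sup>2 / (\<sigma>\<^sup>2)\<^sup>2)"
    by (simp add: q.frobenius2_def power_divide)
  ultimately show ?thesis by (simp add: sum_divide_distrib)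
qed

lemma far_region_bound:
  assumes p: "p > 0"
    and gap: "((SUP u\<in>S. Mfun \<sigma> \<pi> n p X y u) - Rfun \<sigma> \<pi> n p X y) / ereal (real p) < ereal (- \<kappa>)"
    and S: "S \<subseteq> cube p" and u: "u \<in> S"
  shows "Mfun \<sigma> \<pi> n p X y u \<le> ereal (opt_value - real p * \<kappa>)"
proof -
  let ?s = "SUP u\<in>S. Mfun \<sigma> \<pi> n p X y u"
  have up: "Mfun \<sigma> \<pi> n p X y u \<le> ?s" by (rule SUP_upper[OF u])
  have "?s \<le> ereal (ln q.partition)" using S by (intro SUP_least Mfun_le) auto
  then consider (real) s where "?s = ereal s" | (inf) "?s = -\<infinity>" by (cases ?s) auto
  then show ?thesis
  proof cases
    case real
    then have "(s - opt_value) / real p < - \<kappa>" using gap p by (simp add: Rfun_real)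
    then have "s \<le> opt_value - real p * \<kappa>" using p by (simp add: field_simps)
    then show ?thesis using up unfolding real by (meson ereal_less_eq(3) order_trans)
  next
    case inf
    then show ?thesis using up by simp
  qed
qed

end

section \<open>Asymptotics\<close>

text \<open>
  The parameter \<open>\<tau>\<close> must be large and \<open>\<delta>\<close> small depending on \<open>\<epsilon>\<close>, but both are fixed as
  \<open>p\<close> grows, so the terms with \<open>S\<close> are negligible.
\<close>

lemma gap_negligible:
  fixes S :: "nat \<Rightarrow> real"
  assumes S: "S \<in> o(\<lambda>p. real p)" and \<epsilon>: "\<epsilon> > 0"
  shows "\<exists>\<tau> \<delta>. \<tau> \<ge> 1 \<and> \<delta> > 0 \<and>
    (\<forall>\<^sub>F p in sequentially. 2 * S p + real p / \<tau> + real p * \<delta> + \<tau>\<^sup>2 * S p / \<delta> \<le> \<epsilon> * real p)"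
proof -
  define \<tau> where "\<tau> = 1 + 4 / \<epsilon>"
  define \<delta> where "\<delta> = \<epsilon> / 4"
  define K where "K = 2 + \<tau>\<^sup>2 / \<delta>"
  have \<tau>: "\<tau> \<ge> 1" and \<delta>: "\<delta> > 0" using \<epsilon> by (auto simp: \<tau>_def \<delta>_def)
  then have K: "K > 0" unfolding K_def by (intro add_pos_nonneg) auto
  have "1 / \<tau> \<le> \<epsilon> / 4" using \<epsilon> by (simp add: \<tau>_def field_simps)
  then have t: "real p / \<tau> \<le> real p * (\<epsilon> / 4)" for p
    using mult_left_mono[of "1 / \<tau>" "\<epsilon> / 4" "real p"] by simp
  have "\<forall>\<^sub>F p in sequentially. norm (S p) \<le> \<epsilon> / (2 * K) * norm (real p)"
    using S K \<epsilon> by (intro landau_o.smallD) auto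
  then have "\<forall>\<^sub>F p in sequentially. 2 * S p + real p / \<tau> + real p * \<delta> + \<tau>\<^sup>2 * S p / \<delta> \<le> \<epsilon> * real p"
  proof eventually_elim
    case (elim p)
    then have "S p \<le> \<epsilon> / (2 * K) * real p" by (simp add: abs_le_iff)
    then have "K * S p \<le> K * (\<epsilon> / (2 * K) * real p)" using K by (intro mult_left_mono) auto
    also have "\<dots> = \<epsilon> / 2 * real p" using K by simp
    finally have "2 * S p + \<tau>\<^sup>2 * S p / \<delta> \<le> \<epsilon> / 2 * real p" by (simp add: K_def algebra_simps)
    moreover have "real p * \<delta> = real p * (\<epsilon> / 4)" by (simp add: \<delta>_def)
    moreover have "\<epsilon> * real p = \<epsilon> / 2 * real p + real p * (\<epsilon> / 4) + real p * (\<epsilon> / 4)" by simp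
    ultimately show ?case using t[of p] by linarith
  qed
  then show ?thesis using \<tau> \<delta> by blast
qed

lemma fluctuation_negligible:
  fixes S :: "nat \<Rightarrow> real"
  assumes S: "S \<in> o(\<lambda>p. real p)" and r: "r > 0" and t: "t > 0"
  shows "\<exists>\<xi>>0. \<forall>\<^sub>F p in sequentially. 4 * B\<^sup>2 * (real p + (real p)\<^sup>2 * \<xi> + S p / \<xi>) / (real p * t)\<^sup>2 \<le> r"
proof -
  define C where "C = 4 * B\<^sup>2 / t\<^sup>2 + 1"
  have C: "C > 0" "4 * B\<^sup>2 / t\<^sup>2 \<le> C" unfolding C_def by (auto intro: add_nonneg_pos)
  define \<xi> where "\<xi> = r / (3 * C)"
  have \<xi>: "\<xi> > 0" using r C by (simp add: \<xi>_def)
  have "\<forall>\<^sub>F p in sequentially. norm (S p) \<le> \<xi> * \<xi> * norm (real p)"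
    using S \<xi> by (intro landau_o.smallD) auto
  moreover have "\<forall>\<^sub>F p in sequentially. p > 0" by (rule eventually_gt_at_top)
  moreover have "\<forall>\<^sub>F p in sequentially. 1 / \<xi> \<le> real p"
    by (rule eventually_compose_filterlim[OF eventually_ge_at_top filterlim_real_sequentially])
  ultimately have "\<forall>\<^sub>F p in sequentially. 4 * B\<^sup>2 * (real p + (real p)\<^sup>2 * \<xi> + S p / \<xi>) / (real p * t)\<^sup>2 \<le> r"
  proof eventually_elim
    case (elim p)
    have p: "real p > 0" "real p \<ge> 1" using elim by auto
    have a: "real p \<le> (real p)\<^sup>2 * \<xi>"
    proof -
      have "1 \<le> real p * \<xi>" using elim \<xi> by (simp add: field_simps)
      then have "real p * 1 \<le> real p * (real p * \<xi>)" using p by (intro mult_left_mono) auto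
      then show ?thesis by (simp add: power2_eq_square mult.assoc)
    qed
    have "S p / \<xi> \<le> \<xi> * real p" using elim \<xi> by (simp add: field_simps abs_le_iff)
    also have "\<dots> \<le> \<xi> * (real p)\<^sup>2"
      using p \<xi> by (intro mult_left_mono) (auto simp: power2_eq_square)
    finally have "real p + (real p)\<^sup>2 * \<xi> + S p / \<xi> \<le> 3 * \<xi> * (real p)\<^sup>2" using a by (simp add: ac_simps)
    then have "4 * B\<^sup>2 * (real p + (real p)\<^sup>2 * \<xi> + S p / \<xi>) / (real p * t)\<^sup>2
        \<le> 4 * B\<^sup>2 * (3 * \<xi> * (real p)\<^sup>2) / (real p * t)\<^sup>2"
      by (intro divide_right_mono mult_left_mono) auto
    also have "\<dots> = 4 * B\<^sup>2 / t\<^sup>2 * (3 * \<xi>)" using p by (simp add: power_mult_distrib)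
    also have "\<dots> \<le> C * (3 * \<xi>)" using C \<xi> by (intro mult_right_mono) auto
    also have "\<dots> = r" using C by (simp add: \<xi>_def)
    finally show ?case .
  qed
  then show ?thesis using \<xi> by blast
qed

text \<open>
  For points closer than the modulus of uniform continuity the increment is below \<open>e\<close>; for others
  the linear term exceeds the total oscillation \<open>2 B\<close>.
\<close>

lemma continuous_almost_lipschitz:
  fixes \<zeta> :: "real \<times> real \<Rightarrow> real"
  assumes c: "continuous_on ({-1..1} \<times> {0..1}) \<zeta>"
    and B: "\<And>z s. \<bar>z\<bar> \<le> 1 \<Longrightarrow> s \<in> {0..1} \<Longrightarrow> \<bar>\<zeta> (z, s)\<bar> \<le> B" and e: "e > 0"
  shows "\<exists>L\<ge>0. \<forall>s\<in>{0..1}. \<forall>x z. \<bar>x\<bar> \<le> 1 \<longrightarrow> \<bar>z\<bar> \<le> 1 \<longrightarrow> \<bar>\<zeta> (x, s) - \<zeta> (z, s)\<bar> \<le> L * \<bar>x - z\<bar> + e"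
proof -
  have "uniformly_continuous_on ({-1..1} \<times> {0..1}) \<zeta>"
    by (intro compact_uniformly_continuous c compact_Times) auto
  then obtain d where d: "d > 0"
    and u: "\<And>a b. a \<in> {-1..1} \<times> {0..1} \<Longrightarrow> b \<in> {-1..1} \<times> {0..1} \<Longrightarrow> dist b a < d \<Longrightarrow> dist (\<zeta> b) (\<zeta> a) < e"
    using e unfolding uniformly_continuous_on_def by metis
  have B0: "B \<ge> 0" using B[of 0 0] by simp
  have "\<bar>\<zeta> (x, s) - \<zeta> (z, s)\<bar> \<le> 2 * B / d * \<bar>x - z\<bar> + e" if s: "s \<in> {0..1}" and xz: "\<bar>x\<bar> \<le> 1" "\<bar>z\<bar> \<le> 1" for s x z
  proof (cases "\<bar>x - z\<bar> < d")
    case True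
    have "dist (\<zeta> (x, s)) (\<zeta> (z, s)) < e"
      by (rule u) (use s xz True in \<open>auto simp: dist_Pair_Pair dist_real_def\<close>)
    moreover have "2 * B / d * \<bar>x - z\<bar> \<ge> 0" using B0 d by simp
    ultimately show ?thesis by (simp add: dist_real_def)
  next
    case False
    have "2 * B / d * d \<le> 2 * B / d * \<bar>x - z\<bar>" using False B0 d by (intro mult_left_mono) auto
    then have "2 * B \<le> 2 * B / d * \<bar>x - z\<bar>" using d by simp
    then show ?thesis using B[OF xz(1) s] B[OF xz(2) s] e by linarith
  qed
  then show ?thesis using B0 d by (intro exI[of _ "2 * B / d"]) auto
qed

theorem theorem1:
  fixes \<sigma> :: real and \<pi> :: "real measure"
    and n :: "nat \<Rightarrow> nat"
    and X :: "nat \<Rightarrow> nat \<Rightarrow> nat \<Rightarrow> real" and y :: "nat \<Rightarrow> nat \<Rightarrow> real"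
  defines "A \<equiv> \<lambda>p. offdiag (n p) (X p)"
    and "D \<equiv> \<lambda>p. diag (n p) (X p)"
    and "d \<equiv> \<lambda>p. dvec \<sigma> (n p) (X p)"
    and "\<mu> \<equiv> \<lambda>p. posterior \<sigma> \<pi> (n p) p (X p) (y p)"
    and "Z \<equiv> \<lambda>p. norm_const \<sigma> \<pi> (n p) p (X p) (y p)"
    and "M \<equiv> \<lambda>p. Mfun \<sigma> \<pi> (n p) p (X p) (y p)"
    and "R \<equiv> \<lambda>p. Rfun \<sigma> \<pi> (n p) p (X p) (y p)"
    and "b \<equiv> \<lambda>p. cond_mean \<sigma> \<pi> (n p) p (X p) (y p)"
  assumes "\<sigma>\<^sup>2 > 0"
    and "prob_space \<pi>" and "sets \<pi> = sets (restrict_space borel {-1..1})"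
    and "-1 \<in> support \<pi>" and "1 \<in> support \<pi>"
    and "filterlim n at_top sequentially"
    and "(\<lambda>p. mat_trace p (mat_prod p (A p) (A p))) \<in> o(\<lambda>p. real p)"
    and "(\<lambda>p. SUP u\<in>cube p. \<Sum>i=1..p. \<bar>\<Sum>j=1..p. A p i j * u j\<bar>) \<in> O(\<lambda>p. real p)"
  shows "((\<lambda>p. (ereal (ln (Z p)) - R p) / ereal (real p)) \<longlonglongrightarrow> 0)
    \<and> (\<forall>\<epsilon>>0. (\<lambda>p. measure (\<mu> p)
          {\<beta> \<in> space (\<mu> p). M p (b p \<beta>) < R p - ereal (real p * \<epsilon>)}) \<longlonglongrightarrow> 0)
    \<and> (\<forall>uhat :: nat \<Rightarrow> nat \<Rightarrow> real.
          (\<forall>p. uhat p \<in> cube p) \<longrightarrow>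
          (\<forall>\<eta>>0. limsup (\<lambda>p. ((SUP u\<in>{u \<in> cube p. (\<Sum>i=1..p. (u i - uhat p i)\<^sup>2) \<ge> real p * \<eta>}. M p u)
                              - R p) / ereal (real p)) < 0) \<longrightarrow>
          ((\<lambda>K. limsup (\<lambda>p. ereal (1 / real p *
                  (\<Sum>i=1..p. D p i i * indicator {K<..} (D p i i))))) \<longlongrightarrow> 0) at_top \<longrightarrow>
          (\<forall>\<epsilon>>0. \<forall>\<zeta> :: real \<times> real \<Rightarrow> real. continuous_on ({-1..1} \<times> {0..1}) \<zeta> \<longrightarrow>
             (\<lambda>p. measure (\<mu> p)
                {\<beta> \<in> space (\<mu> p).
                   \<bar>1 / real p * (\<Sum>i=1..p. \<zeta> (\<beta> i, real i / real p))
                    - 1 / real p * (\<Sum>i=1..p. \<integral>z. \<zeta> (z, real i / real p)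
                        \<partial>tilt \<pi> (hbar \<pi> (uhat p i) (d p i)) (d p i))\<bar> > \<epsilon>}) \<longlonglongrightarrow> 0))"
proof -
  interpret endpoint_prior \<pi>
    using assms(10-13)
    by (auto simp: endpoint_prior_def endpoint_prior_axioms_def interval_measure_def interval_measure_axioms_def)
  interpret lp: linear_posterior \<pi> \<sigma> "n p" p "X p" "y p" for p
    using assms(9) by unfold_locales
  define S where "S p = lp.q.frobenius2 p" for p
  have S: "S \<in> o(\<lambda>p. real p)"
  proof -
    have "S p = 1 / (\<sigma>\<^sup>2)\<^sup>2 * mat_trace p (mat_prod p (A p) (A p))" for p
      unfolding S_def lp.frobenius2_eq A_def by simp
    then have Seq: "S = (\<lambda>p. 1 / (\<sigma>\<^sup>2)\<^sup>2 * mat_trace p (mat_prod p (A p) (A p)))" by (rule ext)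
    show ?thesis unfolding Seq
      by (subst landau_o.small.cmult_in_iff) (use assms(9,15) in auto)
  qed
  have R: "R p = ereal (lp.opt_value p)" for p unfolding R_def by (rule lp.Rfun_real)
  have Z: "Z p = lp.q.partition p" for p unfolding Z_def by (rule lp.norm_const_eq)
  have gap: "\<exists>\<tau> \<delta>. \<tau> \<ge> 1 \<and> \<delta> > 0 \<and> (\<forall>\<^sub>F p in sequentially. lp.gap_bound p \<tau> \<delta> \<le> e * real p)" if "e > 0" for e
    using gap_negligible[OF S that] unfolding lp.gap_bound_def S_def .
  have pos: "\<forall>\<^sub>F p in sequentially. p > (0::nat)" by (rule eventually_gt_at_top)

  have i: "(\<lambda>p. (ereal (ln (Z p)) - R p) / ereal (real p)) \<longlonglongrightarrow> 0"
  proof -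
    have "(\<lambda>p. (ln (lp.q.partition p) - lp.opt_value p) / real p) \<longlonglongrightarrow> 0"
    proof (rule tendstoI)
      fix r :: real assume r: "r > 0"
      obtain \<tau> \<delta> where t: "\<tau> \<ge> 1" "\<delta> > 0"
        and ev: "\<forall>\<^sub>F p in sequentially. lp.gap_bound p \<tau> \<delta> \<le> r / 2 * real p"
        using gap[of "r / 2"] r by auto
      show "\<forall>\<^sub>F p in sequentially. dist ((ln (lp.q.partition p) - lp.opt_value p) / real p) 0 < r"
        using ev pos
      proof eventually_elim
        case (elim p)
        have "ln (lp.q.partition p) - lp.opt_value p \<le> r / 2 * real p"
          using lp.log_partition_gap[OF t, of p] lp.expected_mean_field_le[of p] elim(1) by linarith
        then have "(ln (lp.q.partition p) - lp.opt_value p) / real p \<le> r / 2"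
          using elim(2) by (simp add: divide_le_eq)
        moreover have "(ln (lp.q.partition p) - lp.opt_value p) / real p \<ge> 0" using lp.opt_value_le[of p] by simp
        ultimately show ?case using r unfolding dist_real_def by linarith
      qed
    qed
    then have lim: "(\<lambda>p. ereal ((ln (lp.q.partition p) - lp.opt_value p) / real p)) \<longlonglongrightarrow> 0"
      by (simp add: zero_ereal_def)
    show ?thesis
    proof (rule Lim_transform_eventually[OF lim])
      show "\<forall>\<^sub>F p in sequentially. ereal ((ln (lp.q.partition p) - lp.opt_value p) / real p) = (ereal (ln (Z p)) - R p) / ereal (real p)"
        using pos by eventually_elim (simp add: R Z)
    qed
  qed

  have ii: "(\<lambda>p. measure (\<mu> p) {\<beta> \<in> space (\<mu> p). M p (b p \<beta>) < R p - ereal (real p * \<epsilon>)}) \<longlonglongrightarrow> 0"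
    if \<epsilon>: "\<epsilon> > 0" for \<epsilon>
  proof (rule tendstoI)
    fix r :: real assume r: "r > 0"
    obtain \<tau> \<delta> where t: "\<tau> \<ge> 1" "\<delta> > 0"
      and ev: "\<forall>\<^sub>F p in sequentially. lp.gap_bound p \<tau> \<delta> \<le> r / 2 * \<epsilon> * real p"
      using gap[of "r / 2 * \<epsilon>"] r \<epsilon> by auto
    show "\<forall>\<^sub>F p in sequentially. dist (measure (\<mu> p) {\<beta> \<in> space (\<mu> p). M p (b p \<beta>) < R p - ereal (real p * \<epsilon>)}) 0 < r"
      using ev pos
    proof eventually_elim
      case (elim p)
      have pe: "real p * \<epsilon> > 0" using elim(2) \<epsilon> by simp
      have "measure (\<mu> p) {\<beta> \<in> space (\<mu> p). M p (b p \<beta>) < R p - ereal (real p * \<epsilon>)} \<le> lp.gap_bound p \<tau> \<delta> / (real p * \<epsilon>)"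
        unfolding \<mu>_def M_def b_def R_def by (rule lp.Mfun_cond_mean_deviation[OF t pe])
      also have "\<dots> \<le> r / 2" using elim(1) pe by (simp add: divide_le_eq ac_simps)
      finally show ?case using r by simp
    qed
  qed

  have iii: "(\<lambda>p. measure (\<mu> p) {\<beta> \<in> space (\<mu> p).
       \<bar>1 / real p * (\<Sum>i=1..p. \<zeta> (\<beta> i, real i / real p))
        - 1 / real p * (\<Sum>i=1..p. \<integral>z. \<zeta> (z, real i / real p)
            \<partial>tilt \<pi> (hbar \<pi> (uhat p i) (d p i)) (d p i))\<bar> > \<epsilon>}) \<longlonglongrightarrow> 0"
    if uhat: "\<forall>p. uhat p \<in> cube p"
      and sep: "\<forall>\<eta>>0. limsup (\<lambda>p. ((SUP u\<in>{u \<in> cube p. (\<Sum>i=1..p. (u i - uhat p i)\<^sup>2) \<ge> real p * \<eta>}. M p u)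
                              - R p) / ereal (real p)) < 0"
      and \<epsilon>: "\<epsilon> > 0" and \<zeta>: "continuous_on ({-1..1} \<times> {0..1}) \<zeta>"
    for uhat :: "nat \<Rightarrow> nat \<Rightarrow> real" and \<epsilon> :: real and \<zeta> :: "real \<times> real \<Rightarrow> real"
  proof (rule tendstoI)
    let ?dev = "\<lambda>p \<beta>. \<bar>1 / real p * (\<Sum>i=1..p. \<zeta> (\<beta> i, real i / real p))
        - 1 / real p * (\<Sum>i=1..p. \<integral>z. \<zeta> (z, real i / real p)
            \<partial>tilt \<pi> (hbar \<pi> (uhat p i) (d p i)) (d p i))\<bar>"
    fix r :: real assume r: "r > 0"
    have "bounded (\<zeta> ` ({-1..1} \<times> {0..1}))"
      by (intro compact_imp_bounded compact_continuous_image \<zeta> compact_Times) auto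
    then obtain B where B0: "\<forall>x\<in>{-1..1} \<times> {0..1}. norm (\<zeta> x) \<le> B"
      unfolding bounded_iff by auto
    have B: "\<bar>\<zeta> (z, s)\<bar> \<le> B" if "\<bar>z\<bar> \<le> 1" "s \<in> {0..1}" for z s
    proof -
      have "(z, s) \<in> {-1..1} \<times> {0..1}" using that by (auto simp: abs_le_iff)
      from bspec[OF B0 this] show ?thesis by simp
    qed
    have Bnn: "B \<ge> 0" using B[of 0 0] by simp
    \<comment> \<open>Of \<open>\<epsilon>\<close>, one half is spent on the residuals and a quarter each on \<open>2 e\<close> and \<open>2 L \<delta>\<close>.\<close>
    define e where "e = \<epsilon> / 8"
    have e: "e > 0" using \<epsilon> by (simp add: e_def)
    obtain L where L: "L \<ge> 0"
      and mod: "\<And>s x z. s \<in> {0..1} \<Longrightarrow> \<bar>x\<bar> \<le> 1 \<Longrightarrow> \<bar>z\<bar> \<le> 1 \<Longrightarrow> \<bar>\<zeta> (x, s) - \<zeta> (z, s)\<bar> \<le> L * \<bar>x - z\<bar> + e"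
      using continuous_almost_lipschitz[OF \<zeta> B e] by blast
    define \<delta> where "\<delta> = \<epsilon> / (8 * (L + 1))"
    have \<delta>: "\<delta> > 0" using \<epsilon> L by (simp add: \<delta>_def)
    have "2 * L * \<delta> \<le> \<epsilon> / 4" using \<epsilon> L by (simp add: \<delta>_def field_simps)
    then have split: "\<epsilon> / 2 + 2 * e + 2 * L * \<delta> \<le> \<epsilon>" by (simp add: e_def)
    let ?far = "\<lambda>p. {u \<in> cube p. (\<Sum>i=1..p. (u i - uhat p i)\<^sup>2) \<ge> real p * \<delta>\<^sup>2}"
    have "limsup (\<lambda>p. ((SUP u\<in>?far p. M p u) - R p) / ereal (real p)) < ereal 0"
      using sep \<delta> by (simp add: zero_ereal_def[symmetric])
    then obtain w where w: "limsup (\<lambda>p. ((SUP u\<in>?far p. M p u) - R p) / ereal (real p)) < ereal w" "w < 0"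
      using ereal_dense2 by fastforce
    define \<kappa> where "\<kappa> = - w"
    have \<kappa>: "\<kappa> > 0" using w by (simp add: \<kappa>_def)
    have far: "\<forall>\<^sub>F p in sequentially. ((SUP u\<in>?far p. M p u) - R p) / ereal (real p) < ereal (- \<kappa>)"
      using Limsup_lessD[OF w(1)] by (simp add: \<kappa>_def)
    obtain \<tau> \<eta> where t: "\<tau> \<ge> 1" "\<eta> > 0"
      and ev: "\<forall>\<^sub>F p in sequentially. lp.gap_bound p \<tau> \<eta> \<le> r / 4 * \<kappa> * real p"
      using gap[of "r / 4 * \<kappa>"] r \<kappa> by auto
    have e2: "\<epsilon> / 2 > 0" and r4: "r / 4 > 0" using \<epsilon> r by auto
    obtain \<xi> where \<xi>: "\<xi> > 0"
      and fl: "\<forall>\<^sub>F p in sequentially. 4 * B\<^sup>2 * (real p + (real p)\<^sup>2 * \<xi> + S p / \<xi>) / (real p * (\<epsilon> / 2))\<^sup>2 \<le> r / 4"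
      using fluctuation_negligible[OF S r4 e2, of B] by blast
    let ?E = "\<lambda>p. {\<beta> \<in> space (\<mu> p). ?dev p \<beta> > \<epsilon> / 2 + 2 * e + 2 * L * \<delta>}"
    show "\<forall>\<^sub>F p in sequentially. dist (measure (\<mu> p) {\<beta> \<in> space (\<mu> p).
       ?dev p \<beta> > \<epsilon>}) 0 < r"
      using far ev fl pos
    proof eventually_elim
      case (elim p)
      have in01: "real i / real p \<in> {0..1}" if "i \<in> {1..p}" for i using that elim(4) by auto
      have m: "(\<lambda>z. \<zeta> (z, real i / real p)) \<in> borel_measurable \<pi>" if "i \<in> {1..p}" for i
        by (intro measurable_interval_cont continuous_on_compose2[OF \<zeta>] continuous_intros)
          (use in01[OF that] in auto)
      have fu: "M p u \<le> ereal (lp.opt_value p - real p * \<kappa>)"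
        if "u \<in> cube p" "(\<Sum>i=1..p. (u i - uhat p i)\<^sup>2) \<ge> real p * \<delta>\<^sup>2" for u
        unfolding M_def by (rule lp.far_region_bound[OF elim(4) elim(1)[unfolded M_def R_def]]) (use that in auto)
      have pk: "real p * \<kappa> > 0" using elim(4) \<kappa> by simp
      have fin: "measure (\<mu> p) (?E p) \<le>
          4 * B\<^sup>2 * (real p + (real p)\<^sup>2 * \<xi> + lp.q.frobenius2 p / \<xi>) / (real p * (\<epsilon> / 2))\<^sup>2 + lp.gap_bound p \<tau> \<eta> / (real p * \<kappa>)"
        unfolding \<mu>_def d_def
        by (rule lp.empirical_deviation[where f = "\<lambda>i z. \<zeta> (z, real i / real p)",
              OF elim(4) spec[OF uhat] m B[OF _ in01] mod[OF in01] L \<delta> fu[unfolded M_def] Bnn e2 \<kappa> t \<xi>])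
      interpret pr: prob_space "\<mu> p" unfolding \<mu>_def lp.posterior_eq by (rule lp.q.prob_gibbs)
      have "measure (\<mu> p) {\<beta> \<in> space (\<mu> p).
         ?dev p \<beta> > \<epsilon>} \<le> measure (\<mu> p) (?E p)"
      proof (rule pr.finite_measure_mono)
        have meas: "(\<lambda>\<beta>. \<bar>1 / real p * (\<Sum>i=1..p. \<zeta> (\<beta> i, real i / real p)) - k\<bar>) \<in> borel_measurable (lp.q.base p)" for k
        proof -
          have "(\<lambda>\<beta>. \<zeta> (\<beta> i, real i / real p)) \<in> borel_measurable (lp.q.base p)" if i: "i \<in> {1..p}" for i
            by (rule lp.q.measurable_at_coord[OF i, of "\<lambda>z. \<zeta> (z, real i / real p)"]) (use m[OF i] in simp)
          then show ?thesis
            by (intro borel_measurable_abs borel_measurable_diff borel_measurable_times borel_measurable_sum borel_measurable_const)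
        qed
        show "?E p \<in> sets (\<mu> p)"
          unfolding \<mu>_def lp.posterior_eq lp.q.sets_gibbs lp.q.space_gibbs
          by (rule borel_measurable_less[OF borel_measurable_const meas])
      qed (use split in auto)
      moreover have "lp.gap_bound p \<tau> \<eta> / (real p * \<kappa>) \<le> r / 4" using elim(2) pk by (simp add: divide_le_eq ac_simps)
      ultimately have "measure (\<mu> p) {\<beta> \<in> space (\<mu> p).
         ?dev p \<beta> > \<epsilon>} \<le> r / 4 + r / 4"
        using fin elim(3) unfolding S_def by linarith
      then show ?case using r by simp
    qed
  qed

  show ?thesis
    by (intro conjI i; intro allI impI; (rule ii | rule iii); assumption)
qed

end
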